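(* Fix $s\in(0,1)$ with $s\neq s_c$. Asymptotically, $$\hat y_s(x)=\frac{1+(a_s-1)e^{cx}}{e^{cx}}\left[\frac1{a_s}-\frac{1}{c(a_s-1)}\log\frac{1+(a_s-1)e^{cx}}{a_s}\right]$$ is the optimal trajectory for $|A_{xn}|/n$ amongst those decreasing from $1$ to $0$ over $[0,s]$. More specifically, if $s_n\to s$ as $n\to\infty$, then $$\lim_{n\to\infty}\frac1n\log P_{s_n}=\int_0^s\ell_s(x)\,dx,$$ where $$\ell_s(x)=-(1+\hat y_s'(x))\left[1+\frac{c\hat y_s(x)}{1+\hat y_s'(x)}+\log\left(-\frac{c\hat y_s(x)}{1+\hat y_s'(x)}\right)\right]$$ $$=\left[\log\frac{1+(a_s-1)e^{cx}}{a_s}-\frac{c(a_s-1)}{a_s}\right]\left[1-\frac{\log(1+(a_s-1)e^{cx})}{(a_s-1)e^{cx}}\right]$$ is the cost function associated with $\hat y_s$.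
   Context: $\mathcal{G}(n,p)$ is the Erdős–Rényi random graph on the vertex set $[n]=\{1,\dots,n\}$, in which each pair of vertices is joined by an edge independently with probability $p$. Here $p=c/n$, where $c\in(0,\infty)$ is a fixed constant. A set $I\subset[n]$ is independent if no two vertices in $I$ are neighbors. Greedy algorithm: initially all vertices are available, $A_0=[n]$, and $I_0=\emptyset$. In each step $k\ge1$, a random vertex $v_k$ of the set $A_{k-1}$ of currently available vertices (those not in $I_{k-1}$ and with no neighbors in $I_{k-1}$) is added to $I_{k-1}$ to form the independent set $I_k$. The edges from $v_k$ are then revealed, and $v_k$ and its neighbors in $A_{k-1}$ are removed from $A_{k-1}$ to obtain $A_k$. The size of the independent set eventually obtained is $S_g=\min\{k\ge0: A_k=\emptyset\}$. Put $s_c=\frac1c\log(1+c)$; a set of size approximately $s_cn$ is typically found. For $s\neq s_c$, $P_s$ denotes $\mathbf{P}(S_g\le sn)$ if $s<s_c$ and $\mathbf{P}(S_g\ge sn)$ if $s>s_c$. The number $a_s>0$ is the one uniquely satisfying $s=\frac1c\log\frac{b_s-1}{a_s-1}$, where $b_s=a_se^{c(1-1/a_s)}$. The right-hand side converges to $s_c$ as $a_s\to1$; otherwise $a_s\in(0,1)$ if $s<s_c$ and $a_s\in(1,\infty)$ if $s>s_c$. About the term "cost function": $\ell_s(x)=-\Gamma^*_\lambda(\xi)$ evaluated at $\lambda=c\hat y_s(x)$ and $\xi=-(1+\hat y_s'(x))$, where $\Gamma^*_\lambda(\xi)=\sup_\vartheta[\vartheta\xi-\lambda(e^\vartheta-1)]$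 is the Legendre–Fenchel transform of the cumulant-generating function of a Poisson random variable of rate $\lambda$. All logarithms are natural. *)

theory Defs
  imports "HOL-Analysis.Analysis" "HOL-Probability.Probability"
begin

definition vertex_pairs :: "nat \<Rightarrow> nat set set" where
  "vertex_pairs n = {e. e \<subseteq> {1..n} \<and> card e = 2}"

text \<open>A graph on the vertex set \<open>{1..n}\<close> is represented by its set of edges.\<close>

definition erdos_renyi :: "nat \<Rightarrow> real \<Rightarrow> nat set set pmf" where
  "erdos_renyi n p =
     map_pmf (\<lambda>f. {e \<in> vertex_pairs n. f e})
       (Pi_pmf (vertex_pairs n) False (\<lambda>_. bernoulli_pmf p))"

definition available :: "nat \<Rightarrow> nat set set \<Rightarrow> nat set \<Rightarrow> nat set" where
  "available n E I = {v \<in> {1..n}. v \<notin> I \<and> (\<forall>u\<in>I. {u, v} \<notin> E)}"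

text \<open>
  The list of vertices chosen in the first \<open>k\<close> steps, in order of selection. The list stops
  growing once no vertex is available.
\<close>

primrec greedy_choices :: "nat \<Rightarrow> nat set set \<Rightarrow> nat \<Rightarrow> nat list pmf" where
  "greedy_choices n E 0 = return_pmf []"
| "greedy_choices n E (Suc k) =
     bind_pmf (greedy_choices n E k) (\<lambda>vs.
       if available n E (set vs) = {} then return_pmf vs
       else map_pmf (\<lambda>v. vs @ [v]) (pmf_of_set (available n E (set vs))))"

text \<open>
  Joint law of the graph and of the complete list of choices. Since every step uses up a vertex,
  the algorithm has terminated after at most \<open>n\<close> steps.
\<close>

definition greedy_law :: "nat \<Rightarrow> real \<Rightarrow> (nat set set \<times> nat list) pmf" where
  "greedy_law n p =
     bind_pmf (erdos_renyi n p) (\<lambda>E. map_pmf (\<lambda>vs. (E, vs)) (greedy_choices n E n))"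

text \<open>
  The set \<open>A\<^sub>k\<close> of available vertices after \<open>k\<close> steps, where \<open>I\<^sub>k = set (take k vs)\<close>. It is empty
  for all \<open>k\<close> from termination on.
\<close>

definition avail_at :: "nat \<Rightarrow> nat set set \<times> nat list \<Rightarrow> nat \<Rightarrow> nat set" where
  "avail_at n \<omega> k = available n (fst \<omega>) (set (take k (snd \<omega>)))"

definition greedy_size :: "nat \<Rightarrow> nat set set \<times> nat list \<Rightarrow> nat" where
  "greedy_size n \<omega> = (LEAST k. avail_at n \<omega> k = {})"


definition s_crit :: "real \<Rightarrow> real" where
  "s_crit c = ln (1 + c) / c"

text \<open>
  The lower tail event if \<open>s < s_crit c\<close> and the upper tail event if \<open>s > s_crit c\<close>. The value at
  \<open>s = s_crit c\<close> is immaterial.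
\<close>

definition deviation :: "real \<Rightarrow> nat \<Rightarrow> real \<Rightarrow> (nat set set \<times> nat list) set" where
  "deviation c n s =
     {\<omega>. if s < s_crit c then real (greedy_size n \<omega>) \<le> s * real n
         else real (greedy_size n \<omega>) \<ge> s * real n}"

definition deviation_prob :: "real \<Rightarrow> nat \<Rightarrow> real \<Rightarrow> real" where
  "deviation_prob c n s = measure_pmf.prob (greedy_law n (c / real n)) (deviation c n s)"

text \<open>The rescaled process \<open>|A\<^bsub>xn\<^esub>| / n\<close> stays within \<open>\<epsilon>\<close> of \<open>y\<close> over the interval \<open>[0,s]\<close>.\<close>

definition tube :: "nat \<Rightarrow> real \<Rightarrow> (real \<Rightarrow> real) \<Rightarrow> real \<Rightarrow> (nat set set \<times> nat list) set" where
  "tube n s y \<epsilon> =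
     {\<omega>. \<forall>x\<in>{0..s}. \<bar>real (card (avail_at n \<omega> (nat \<lfloor>x * real n\<rfloor>))) / real n - y x\<bar> \<le> \<epsilon>}"


text \<open>
  Legendre-Fenchel transform of the cumulant-generating function of the Poisson distribution of
  rate \<open>lam\<close>; it can take the value \<open>\<infinity>\<close>.
\<close>

definition poisson_rate :: "real \<Rightarrow> real \<Rightarrow> ereal" where
  "poisson_rate lam \<xi> = (SUP \<theta>::real. ereal (\<theta> * \<xi> - lam * (exp \<theta> - 1)))"

text \<open>
  The local cost of moving with slope \<open>v\<close> at height \<open>y\<close>: a step of the algorithm removes the
  chosen vertex and about Poisson(\<open>c * y\<close>) many neighbours.
\<close>

definition local_cost :: "real \<Rightarrow> real \<Rightarrow> real \<Rightarrow> ereal" where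
  "local_cost c y v = poisson_rate (c * y) (- (1 + v))"

definition decreasing_trajectory :: "real \<Rightarrow> (real \<Rightarrow> real) \<Rightarrow> bool" where
  "decreasing_trajectory s y \<longleftrightarrow> antimono_on {0..s} y \<and> y 0 = 1 \<and> y s = 0"

text \<open>
  Absolute continuity of \<open>y\<close> on \<open>[0,s]\<close> with derivative \<open>g\<close> (which is unique up to null sets).
\<close>

definition has_density :: "real \<Rightarrow> (real \<Rightarrow> real) \<Rightarrow> (real \<Rightarrow> real) \<Rightarrow> bool" where
  "has_density s y g \<longleftrightarrow>
     g absolutely_integrable_on {0..s} \<and> (\<forall>x\<in>{0..s}. y x = y 0 + integral {0..x} g)"

text \<open>
  The total cost of a trajectory. It is \<open>\<infinity>\<close> (infimum of the empty set) if the trajectory is not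
  absolutely continuous, and otherwise the infimum is over the versions of the derivative, all of
  which give the same value.
\<close>

definition trajectory_cost :: "real \<Rightarrow> real \<Rightarrow> (real \<Rightarrow> real) \<Rightarrow> ennreal" where
  "trajectory_cost c s y =
     (INF g\<in>{g. has_density s y g}.
        \<integral>\<^sup>+ x\<in>{0..s}. e2ennreal (local_cost c (y x) (g x)) \<partial>lebesgue)"


definition b_fun :: "real \<Rightarrow> real \<Rightarrow> real" where
  "b_fun c a = a * exp (c * (1 - 1 / a))"

definition a_param :: "real \<Rightarrow> real \<Rightarrow> real" where
  "a_param c s = (THE a. a > 0 \<and> a \<noteq> 1 \<and> s = 1 / c * ln ((b_fun c a - 1) / (a - 1)))"

definition y_hat :: "real \<Rightarrow> real \<Rightarrow> real \<Rightarrow> real" where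
  "y_hat c s x =
     (let a = a_param c s in
      (1 + (a - 1) * exp (c * x)) / exp (c * x) *
      (1 / a - 1 / (c * (a - 1)) * ln ((1 + (a - 1) * exp (c * x)) / a)))"

text \<open>
  At the end point \<open>x = s\<close> both \<open>y_hat c s x\<close> and \<open>1 + deriv (y_hat c s) x\<close> vanish; there
  the expression evaluates to 0, which is also its limit as \<open>x\<close> tends to \<open>s\<close>.
\<close>

definition ell :: "real \<Rightarrow> real \<Rightarrow> real \<Rightarrow> real" where
  "ell c s x =
     (let y = y_hat c s x; y' = deriv (y_hat c s) x in
      - (1 + y') * (1 + c * y / (1 + y') + ln (- (c * y / (1 + y')))))"

end

theory Submission
  imports Defs "HOL-Real_Asymp.Real_Asymp"
begin

text \<open>
  Only the sizes \<open>N\<^sub>k = |A\<^sub>k|\<close> matter. The edges between the chosen vertex and the other available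
  vertices have not been looked at before, so \<open>N\<close> is a Markov chain with steps
  \<open>N\<^sub>k\<^sub>+\<^sub>1 = N\<^sub>k - 1 - Bin(N\<^sub>k - 1, p)\<close> (\<open>size_profile_law\<close>). For such a chain large deviations are
  explicit: if \<open>w\<^sub>j = p + (1 - p) w\<^sub>j\<^sub>+\<^sub>1\<close>, then weighting a step from time \<open>j\<close> by \<open>w\<^sub>j\<^sub>+\<^sub>1\<close> to the power
  of the new size turns \<open>Bin(m - 1, p)\<close> into \<open>Bin(m - 1, p / w\<^sub>j)\<close>, at the price of the factor
  \<open>w\<^sub>j ^ (m - 1)\<close>. These factors telescope. Hence the law of the chain, while it is alive, has the exact
  density \<open>w\<^sub>0 ^ n / (w\<^sub>0 \<cdots> w\<^sub>k\<^sub>-\<^sub>1) * w\<^sub>k ^ (- N\<^sub>k)\<close> with respect to a chain of the same kind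
  (\<open>nn_integral_chain_tilt\<close>). The recursion is solved by \<open>w\<^sub>j = 1 + \<alpha> (1 - p) ^ (- j)\<close>, which is close to
  \<open>1 + \<alpha> e ^ (c x)\<close> at \<open>j = x n\<close>; the parameter \<open>\<alpha>\<close> is \<open>a - 1\<close>.

  For the upper bound the weights are at most 1 if \<open>\<alpha> < 0\<close> and at least 1 if \<open>\<alpha> > 0\<close>. Therefore the
  prefactor alone bounds the probability of being extinct, respectively alive, at time \<open>k\<close>
  (\<open>chain_prob_extinct_le\<close>, \<open>chain_prob_alive_le\<close>). With \<open>\<alpha> = a\<^sub>s - 1\<close> and \<open>k \<approx> s n\<close>, a Riemann sum
  gives the exponent \<open>ln a\<^sub>s - \<integral> ln (1 + \<alpha> e ^ (c x)) dx\<close> over \<open>[0, s]\<close>, and this is \<open>\<integral> \<ell>\<^sub>s\<close>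
  by integration by parts (\<open>cost_rate_has_integral\<close>).

  For the lower bound the tilted chain has an explicit mean, whose limit is the trajectory of the theorem
  with \<open>\<alpha>\<close> in place of \<open>a\<^sub>s - 1\<close> (\<open>profile\<close>), and a second moment estimate shows that it follows this
  trajectory (\<open>tilted_chain_concentration\<close>). Since sizes decrease, finitely many times suffice to control
  the whole path (\<open>antimono_tube_grid\<close>). The parameter is taken slightly further away from the typical
  value 0 than \<open>a\<^sub>s - 1\<close>, so that extinction falls strictly on the required side of \<open>s\<close>
  (\<open>tilt_parameters_exist\<close>), and then tends to \<open>a\<^sub>s - 1\<close>.

  Optimality among trajectories is a calibration argument. The Hamiltonian \<open>\<theta> + c y (e ^ \<theta> - 1)\<close> does not
  involve time and is constant along the trajectory. Let \<open>\<theta> (y)\<close> be its level line. By the definition of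
  the Legendre transform, the local cost of moving with slope \<open>v\<close> at height \<open>y\<close> is at least
  \<open>- \<theta> (y) v - E\<close>, where \<open>E\<close> is the level. The integral of this bound is the same for all trajectories
  from 1 to 0 over \<open>[0, s]\<close>, because \<open>\<theta> (y) y'\<close> is an exact derivative (\<open>trajectory_cost_lower_bound\<close>).
  Equality forces \<open>y' = - 1 - c y e ^ \<theta> (y)\<close> almost everywhere, and this autonomous equation has only one
  solution starting at 1 (\<open>trajectory_cost_minimal_imp_ode\<close>, \<open>autonomous_ode_unique\<close>).
\<close>

section \<open>The sizes of the available sets form a Markov chain\<close>

text \<open>
  The choices by recursion from the front. In this form the first chosen vertex can be split off, and the
  rest of the run is a run on the remaining available vertices.
\<close>

primrec greedy_extend :: "nat \<Rightarrow> nat set set \<Rightarrow> nat \<Rightarrow> nat list \<Rightarrow> nat list pmf" where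
  "greedy_extend n E 0 vs = return_pmf vs"
| "greedy_extend n E (Suc k) vs =
     bind_pmf (if available n E (set vs) = {} then return_pmf vs
               else map_pmf (\<lambda>v. vs @ [v]) (pmf_of_set (available n E (set vs))))
       (greedy_extend n E k)"

lemma greedy_choices_add:
  "greedy_choices n E (j + k) = bind_pmf (greedy_choices n E j) (greedy_extend n E k)"
proof (induction k arbitrary: j)
  case 0
  show ?case by (simp add: bind_return_pmf')
next
  case (Suc k)
  from Suc[of "Suc j"] show ?case by (simp add: bind_assoc_pmf)
qed

lemma greedy_choices_eq_extend: "greedy_choices n E k = greedy_extend n E k []"
  using greedy_choices_add[of n E 0 k] by (simp add: bind_return_pmf)

lemma finite_available [simp]: "finite (available n E I)"
  by (rule finite_subset[of _ "{1..n}"]) (auto simp: available_def)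

lemma available_insert:
  "available n E (insert v I) = {u \<in> available n E I. u \<noteq> v \<and> {v, u} \<notin> E}"
  by (auto simp: available_def)

lemma available_antimono: "I \<subseteq> J \<Longrightarrow> available n E J \<subseteq> available n E I"
  by (auto simp: available_def)

lemma greedy_extend_stuck:
  "available n E (set vs) = {} \<Longrightarrow> greedy_extend n E k vs = return_pmf vs"
  by (induction k) (simp_all add: bind_return_pmf)

lemma set_greedy_extend:
  "ws \<in> set_pmf (greedy_extend n E k vs) \<Longrightarrow> take (length vs) ws = vs"
proof (induction k arbitrary: vs)
  case (Suc k)
  show ?case
  proof (cases "available n E (set vs) = {}")
    case True
    then show ?thesis using Suc.prems by (simp add: greedy_extend_stuck[of n E vs "Suc k"] del: greedy_extend.simps)
  next
    case False
    then obtain v where "ws \<in> set_pmf (greedy_extend n E k (vs @ [v]))"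
      using Suc.prems by auto
    from Suc.IH[OF this] have "take (length vs) (take (Suc (length vs)) ws) = vs"
      by simp
    then show ?thesis by (simp add: min_def)
  qed
qed simp

text \<open>
  The greedy algorithm on the available set alone. Since \<open>f\<close> is evaluated only on pairs inside the set,
  the independence of the unrevealed edges can be used by induction on the number of steps.
\<close>

primrec residual_sizes :: "nat \<Rightarrow> nat set \<Rightarrow> (nat set \<Rightarrow> bool) \<Rightarrow> nat list pmf" where
  "residual_sizes 0 A f = return_pmf [card A]"
| "residual_sizes (Suc k) A f = map_pmf ((#) (card A))
     (if A = {} then residual_sizes k {} f
      else bind_pmf (pmf_of_set A) (\<lambda>v. residual_sizes k {u \<in> A. u \<noteq> v \<and> \<not> f {v, u}} f))"

lemma residual_sizes_empty: "residual_sizes k {} f = return_pmf (replicate (Suc k) 0)"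
  by (induction k) simp_all

lemma greedy_extend_sizes:
  "map_pmf (\<lambda>ws. map (\<lambda>j. card (available n E (set (take j ws)))) [length vs..<Suc (length vs + k)])
     (greedy_extend n E k vs)
   = residual_sizes k (available n E (set vs)) (\<lambda>e. e \<in> E)"
proof (induction k arbitrary: vs)
  case (Suc k)
  let ?A = "available n E (set vs)" and ?l = "length vs"
  let ?sz = "\<lambda>l k ws. map (\<lambda>j. card (available n E (set (take j ws)))) [l..<Suc (l + k)]"
  show ?case
  proof (cases "?A = {}")
    case True
    have "map_pmf (?sz ?l (Suc k)) (greedy_extend n E (Suc k) vs) = return_pmf (?sz ?l (Suc k) vs)"
      by (simp only: greedy_extend_stuck[OF True] map_return_pmf)
    also have "?sz ?l (Suc k) vs = replicate (Suc (Suc k)) 0"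
      by (rule nth_equalityI) (auto simp: True simp del: upt_Suc replicate_Suc)
    also have "return_pmf \<dots> = residual_sizes (Suc k) ?A (\<lambda>e. e \<in> E)"
      by (simp only: True residual_sizes_empty)
    finally show ?thesis .
  next
    case False
    have hd: "?sz ?l (Suc k) ws = card ?A # ?sz (Suc ?l) k ws"
      if "ws \<in> set_pmf (greedy_extend n E k (vs @ [v]))" for ws v
    proof -
      have "take (Suc ?l) ws = vs @ [v]" using set_greedy_extend[OF that] by simp
      then have "take ?l (take (Suc ?l) ws) = vs" by simp
      then have "take ?l ws = vs" by (simp add: min_def)
      then show ?thesis by (simp add: upt_rec[of ?l] del: upt_Suc)
    qed
    have "map_pmf (?sz ?l (Suc k)) (greedy_extend n E (Suc k) vs)
        = bind_pmf (pmf_of_set ?A) (\<lambda>v. map_pmf (?sz ?l (Suc k)) (greedy_extend n E k (vs @ [v])))"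
      using False by (simp add: map_bind_pmf bind_map_pmf)
    also have "\<dots> = bind_pmf (pmf_of_set ?A) (\<lambda>v. map_pmf ((#) (card ?A))
                     (map_pmf (?sz (Suc ?l) k) (greedy_extend n E k (vs @ [v]))))"
      by (intro bind_pmf_cong refl, unfold pmf.map_comp, intro map_pmf_cong refl)
         (simp only: hd o_def)
    also have "\<dots> = bind_pmf (pmf_of_set ?A) (\<lambda>v. map_pmf ((#) (card ?A))
                     (residual_sizes k {u \<in> ?A. u \<noteq> v \<and> {v, u} \<notin> E} (\<lambda>e. e \<in> E)))"
      using Suc.IH[of "vs @ [_]"] by (simp add: available_insert)
    also have "\<dots> = residual_sizes (Suc k) ?A (\<lambda>e. e \<in> E)"
      using False by (simp add: map_bind_pmf)
    finally show ?thesis .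
  qed
qed simp

text \<open>
  The run consults only pairs inside \<open>A\<close>; this is what makes the edges outside \<open>A\<close> irrelevant.
\<close>

lemma residual_sizes_cong:
  assumes "finite A" and "\<And>e. e \<subseteq> A \<Longrightarrow> card e = 2 \<Longrightarrow> f e = g e"
  shows "residual_sizes k A f = residual_sizes k A g"
  using assms
proof (induction k arbitrary: A)
  case (Suc k)
  have "residual_sizes k {u \<in> A. u \<noteq> v \<and> \<not> f {v, u}} f
      = residual_sizes k {u \<in> A. u \<noteq> v \<and> \<not> g {v, u}} g" if "v \<in> A" for v
  proof -
    have "f {v, u} = g {v, u}" if "u \<in> A" "u \<noteq> v" for u
      using that \<open>v \<in> A\<close> by (intro Suc.prems(2)) auto
    then have "{u \<in> A. u \<noteq> v \<and> \<not> f {v, u}} = {u \<in> A. u \<noteq> v \<and> \<not> g {v, u}}"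
      by blast
    moreover have "residual_sizes k {u \<in> A. u \<noteq> v \<and> \<not> f {v, u}} f = residual_sizes k {u \<in> A. u \<noteq> v \<and> \<not> f {v, u}} g"
      by (rule Suc.IH) (use Suc.prems in auto)
    ultimately show ?thesis by simp
  qed
  moreover have "set_pmf (pmf_of_set A) = A" if "A \<noteq> {}"
    using that Suc.prems(1) by simp
  ultimately show ?case
    by (auto simp: residual_sizes_empty intro!: arg_cong[of _ _ "map_pmf _"] bind_pmf_cong
        simp del: set_pmf_of_set)
qed simp

text \<open>
  The size path, including its start \<open>m\<close> at time \<open>i\<close>. The success probability may depend on time because
  tilting produces such chains. Natural subtraction makes 0 absorbing.
\<close>

primrec thinning_chain :: "(nat \<Rightarrow> real) \<Rightarrow> nat \<Rightarrow> nat \<Rightarrow> nat \<Rightarrow> nat list pmf" where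
  "thinning_chain \<pi> i m 0 = return_pmf [m]"
| "thinning_chain \<pi> i m (Suc k) = map_pmf ((#) m)
     (bind_pmf (binomial_pmf (m - 1) (\<pi> i)) (\<lambda>x. thinning_chain \<pi> (Suc i) (m - 1 - x) k))"

definition pairs_in :: "nat set \<Rightarrow> nat set set" where
  "pairs_in A = {e. e \<subseteq> A \<and> card e = 2}"

lemma finite_pairs_in: "finite A \<Longrightarrow> finite (pairs_in A)"
  unfolding pairs_in_def by (rule finite_subset[of _ "Pow A"]) auto

text \<open>
  Deferred decisions: for a fixed chosen vertex \<open>v\<close>, the pairs inside \<open>A\<close> are those containing \<open>v\<close> and
  those inside \<open>A - {v}\<close>. The former decide how many vertices are removed, a binomial number; the latter are
  independent of them, so that the induction hypothesis applies to whatever set remains.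
\<close>

lemma residual_sizes_random_graph:
  assumes p: "0 \<le> p" "p \<le> 1" and "finite A"
  shows "bind_pmf (Pi_pmf (pairs_in A) False (\<lambda>_. bernoulli_pmf p)) (residual_sizes k A)
       = thinning_chain (\<lambda>_. p) i (card A) k"
  using \<open>finite A\<close>
proof (induction k arbitrary: A i)
  case 0
  then show ?case by simp
next
  case (Suc k)
  let ?G = "\<lambda>S. Pi_pmf S False (\<lambda>_. bernoulli_pmf p)"
  show ?case
  proof (cases "A = {}")
    case True
    have "thinning_chain (\<lambda>_. p) i 0 k = return_pmf (replicate (Suc k) 0)" for i k
      by (induction k arbitrary: i) (use p in \<open>simp_all add: binomial_pmf_0 bind_return_pmf\<close>)
    then show ?thesis unfolding True residual_sizes_empty by (simp del: replicate_Suc thinning_chain.simps)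
  next
    case False
    have one: "bind_pmf (?G (pairs_in A)) (\<lambda>f. residual_sizes k {u \<in> A. u \<noteq> v \<and> \<not> f {v, u}} f)
             = bind_pmf (binomial_pmf (card A - 1) p)
                 (\<lambda>x. thinning_chain (\<lambda>_. p) (Suc i) (card A - 1 - x) k)" if v: "v \<in> A" for v
    proof -
      define S where "S = (\<lambda>u. {v, u}) ` (A - {v})"
      let ?R = "pairs_in (A - {v})"
      let ?B = "\<lambda>h. {u \<in> A - {v}. \<not> h {v, u}}"
      have fS: "finite S" and fR: "finite ?R"
        using Suc.prems by (auto simp: S_def finite_pairs_in)
      have split: "pairs_in A = S \<union> ?R" and disj: "S \<inter> ?R = {}"
        using v by (auto simp: S_def pairs_in_def card_2_iff doubleton_eq_iff)
      have inj: "inj_on (\<lambda>u. {v, u}) (A - {v})"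
        by (auto simp: inj_on_def doubleton_eq_iff)
      have cS: "card S = card A - 1"
        using v Suc.prems by (simp add: S_def card_image inj)
      have "bind_pmf (?G (pairs_in A)) (\<lambda>f. residual_sizes k {u \<in> A. u \<noteq> v \<and> \<not> f {v, u}} f)
         = bind_pmf (?G S) (\<lambda>h. bind_pmf (?G ?R) (\<lambda>g.
             residual_sizes k {u \<in> A. u \<noteq> v \<and> \<not> (if {v, u} \<in> S then h {v, u} else g {v, u})}
               (\<lambda>e. if e \<in> S then h e else g e)))"
        unfolding split Pi_pmf_union[OF fS fR disj]
        by (simp add: bind_map_pmf pair_pmf_def bind_assoc_pmf bind_return_pmf)
      also have "\<dots> = bind_pmf (?G S) (\<lambda>h. bind_pmf (?G ?R) (\<lambda>g. residual_sizes k (?B h) g))"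
      proof (intro bind_pmf_cong refl)
        fix h g
        have "{u \<in> A. u \<noteq> v \<and> \<not> (if {v, u} \<in> S then h {v, u} else g {v, u})} = ?B h"
          by (auto simp: S_def)
        moreover have "residual_sizes k (?B h) (\<lambda>e. if e \<in> S then h e else g e) = residual_sizes k (?B h) g"
          by (rule residual_sizes_cong) (use Suc.prems in \<open>auto simp: S_def\<close>)
        ultimately show "residual_sizes k {u \<in> A. u \<noteq> v \<and> \<not> (if {v, u} \<in> S then h {v, u} else g {v, u})}
               (\<lambda>e. if e \<in> S then h e else g e) = residual_sizes k (?B h) g"
          by simp
      qed
      also have "\<dots> = bind_pmf (?G S) (\<lambda>h. thinning_chain (\<lambda>_. p) (Suc i) (card (?B h)) k)"
      proof (intro bind_pmf_cong refl)
        fix h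
        have sub: "pairs_in (?B h) \<subseteq> ?R" by (auto simp: pairs_in_def)
        have "thinning_chain (\<lambda>_. p) (Suc i) (card (?B h)) k
            = bind_pmf (?G (pairs_in (?B h))) (residual_sizes k (?B h))"
          using Suc.prems by (intro Suc.IH[symmetric]) simp
        also have "\<dots> = bind_pmf (?G ?R) (\<lambda>g. residual_sizes k (?B h) (\<lambda>e. if e \<in> pairs_in (?B h) then g e else False))"
          unfolding Pi_pmf_subset[OF fR sub] by (simp add: bind_map_pmf)
        also have "\<dots> = bind_pmf (?G ?R) (residual_sizes k (?B h))"
          by (intro bind_pmf_cong refl residual_sizes_cong) (use Suc.prems in \<open>auto simp: pairs_in_def\<close>)
        finally show "bind_pmf (?G ?R) (residual_sizes k (?B h)) = thinning_chain (\<lambda>_. p) (Suc i) (card (?B h)) k"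
          by simp
      qed
      also have "\<dots> = bind_pmf (?G S) (\<lambda>h. thinning_chain (\<lambda>_. p) (Suc i) (card A - 1 - card {e \<in> S. h e}) k)"
      proof (intro bind_pmf_cong refl)
        fix h
        have "{e \<in> S. h e} = (\<lambda>u. {v, u}) ` {u \<in> A - {v}. h {v, u}}"
          by (auto simp: S_def)
        then have "card {e \<in> S. h e} = card {u \<in> A - {v}. h {v, u}}"
          by (simp only:) (intro card_image inj_on_subset[OF inj], auto)
        moreover have "?B h = (A - {v}) - {u \<in> A - {v}. h {v, u}}" by auto
        then have "card (?B h) = card (A - {v}) - card {u \<in> A - {v}. h {v, u}}"
          using Suc.prems by (simp only:) (intro card_Diff_subset, auto)
        ultimately show "thinning_chain (\<lambda>_. p) (Suc i) (card (?B h)) k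
          = thinning_chain (\<lambda>_. p) (Suc i) (card A - 1 - card {e \<in> S. h e}) k"
          using v Suc.prems by simp
      qed
      also have "\<dots> = bind_pmf (binomial_pmf (card A - 1) p)
                 (\<lambda>x. thinning_chain (\<lambda>_. p) (Suc i) (card A - 1 - x) k)"
        using p by (subst binomial_pmf_altdef'[OF fS cS]) (simp_all add: bind_map_pmf)
      finally show ?thesis .
    qed
    have "bind_pmf (?G (pairs_in A)) (residual_sizes (Suc k) A)
        = map_pmf ((#) (card A)) (bind_pmf (pmf_of_set A) (\<lambda>v.
            bind_pmf (?G (pairs_in A)) (\<lambda>f. residual_sizes k {u \<in> A. u \<noteq> v \<and> \<not> f {v, u}} f)))"
      unfolding bind_commute_pmf[of "pmf_of_set A"] map_bind_pmf
      by (intro bind_pmf_cong refl) (use False in \<open>simp add: map_bind_pmf\<close>)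
    also have "\<dots> = map_pmf ((#) (card A)) (bind_pmf (pmf_of_set A) (\<lambda>v.
            bind_pmf (binomial_pmf (card A - 1) p)
                 (\<lambda>x. thinning_chain (\<lambda>_. p) (Suc i) (card A - 1 - x) k)))"
      using False Suc.prems one by (intro arg_cong[of _ _ "map_pmf _"] bind_pmf_cong refl) auto
    also have "\<dots> = thinning_chain (\<lambda>_. p) i (card A) (Suc k)"
      by simp
    finally show ?thesis .
  qed
qed

definition size_profile :: "nat \<Rightarrow> nat set set \<times> nat list \<Rightarrow> nat list" where
  "size_profile n \<omega> = map (\<lambda>k. card (avail_at n \<omega> k)) [0..<Suc n]"

text \<open>
  All events about the greedy algorithm below are read off this path.
\<close>

theorem size_profile_law:
  assumes "0 \<le> p" "p \<le> 1"
  shows "map_pmf (size_profile n) (greedy_law n p) = thinning_chain (\<lambda>_. p) 0 n n"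
proof -
  have A: "available n E {} = {1..n}" for E
    by (auto simp: available_def)
  have V: "vertex_pairs n = pairs_in {1..n}"
    by (simp add: vertex_pairs_def pairs_in_def)
  have "map_pmf (size_profile n) (greedy_law n p)
      = bind_pmf (erdos_renyi n p) (\<lambda>E. residual_sizes n {1..n} (\<lambda>e. e \<in> E))"
    using greedy_extend_sizes[of n _ "[]" n]
    by (simp add: greedy_law_def map_bind_pmf pmf.map_comp o_def size_profile_def avail_at_def
        greedy_choices_eq_extend A del: upt_Suc)
  also have "\<dots> = bind_pmf (Pi_pmf (pairs_in {1..n}) False (\<lambda>_. bernoulli_pmf p)) (residual_sizes n {1..n})"
    unfolding erdos_renyi_def bind_map_pmf V
    by (intro bind_pmf_cong refl residual_sizes_cong) (auto simp: pairs_in_def)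
  also have "\<dots> = thinning_chain (\<lambda>_. p) 0 n n"
    using residual_sizes_random_graph[OF assms, of "{1..n}" n 0] by simp
  finally show ?thesis .
qed

section \<open>Exponential tilting of the chain\<close>

lemma set_thinning_chain:
  assumes "xs \<in> set_pmf (thinning_chain \<pi> i m k)"
  shows "length xs = Suc k \<and> xs ! 0 = m \<and> (\<forall>j<k. xs ! Suc j \<le> xs ! j - 1)"
  using assms
proof (induction k arbitrary: i m xs)
  case (Suc k)
  then obtain x ys where xs: "xs = m # ys"
    and ys: "ys \<in> set_pmf (thinning_chain \<pi> (Suc i) (m - 1 - x) k)"
    by auto
  from Suc.IH[OF ys] show ?case
    unfolding xs by (auto simp: nth_Cons split: nat.splits)
qed simp

lemma thinning_chain_decreasing:
  assumes "xs \<in> set_pmf (thinning_chain \<pi> i m k)" "a \<le> b" "b \<le> k"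
  shows "xs ! b \<le> xs ! a - (b - a)"
  using assms(2,3)
proof (induction b rule: dec_induct)
  case (step b)
  have "xs ! Suc b \<le> xs ! b - 1" using set_thinning_chain[OF assms(1)] step by simp
  with step show ?case by simp
qed simp

lemma thinning_chain_take:
  "map_pmf (take (Suc k)) (thinning_chain \<pi> i m (k + l)) = thinning_chain \<pi> i m k"
proof (induction k arbitrary: i m)
  case 0
  have "map_pmf (take 1) (thinning_chain \<pi> i m l) = map_pmf (\<lambda>_. [m]) (thinning_chain \<pi> i m l)"
  proof (rule map_pmf_cong[OF refl])
    fix xs assume "xs \<in> set_pmf (thinning_chain \<pi> i m l)"
    from set_thinning_chain[OF this] show "take 1 xs = [m]" by (cases xs) auto
  qed
  then show ?case by simp
next
  case (Suc k)
  have "map_pmf (take (Suc (Suc k))) (thinning_chain \<pi> i m (Suc k + l))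
      = map_pmf ((#) m) (bind_pmf (binomial_pmf (m - 1) (\<pi> i))
          (\<lambda>x. map_pmf (take (Suc k)) (thinning_chain \<pi> (Suc i) (m - 1 - x) (k + l))))"
    by (simp add: pmf.map_comp o_def map_bind_pmf)
  then show ?case by (simp add: Suc.IH)
qed

text \<open>
  Weighting each survivor by \<open>w'\<close> reweights each of the \<open>N\<close> independent trials, whose total weight is
  \<open>p + (1 - p) * w'\<close>. So the result is again binomial.
\<close>

lemma nn_integral_binomial_tilt:
  assumes p: "0 \<le> p" "p \<le> 1" and w: "w = p + (1 - p) * w'" "0 \<le> w'" "0 < w"
  shows "(\<integral>\<^sup>+x. F x * ennreal (w' ^ (N - x)) \<partial>binomial_pmf N p)
       = ennreal (w ^ N) * (\<integral>\<^sup>+x. F x \<partial>binomial_pmf N (p / w))"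
proof -
  have "0 \<le> (1 - p) * w'" using p w by simp
  then have "p \<le> w" using w(1) by linarith
  then have pw: "0 \<le> p / w" "p / w \<le> 1"
    using p w(3) by simp_all
  have eq: "pmf (binomial_pmf N p) x * w' ^ (N - x) = w ^ N * pmf (binomial_pmf N (p / w)) x" for x
  proof (cases "x \<le> N")
    case True
    have "1 - p / w = (1 - p) * w' / w" using w by (simp add: field_simps)
    moreover have "w ^ N = w ^ x * w ^ (N - x)" using True by (simp flip: power_add)
    ultimately show ?thesis
      using p pw w(3) by (simp add: power_divide power_mult_distrib)
  qed (use p pw in simp)
  show ?thesis
    unfolding nn_integral_measure_pmf
  proof (subst nn_integral_cmult[symmetric], simp, intro nn_integral_cong)
    fix x
    have "ennreal (pmf (binomial_pmf N p) x) * (F x * ennreal (w' ^ (N - x)))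
        = ennreal (pmf (binomial_pmf N p) x * w' ^ (N - x)) * F x"
      using w by (simp add: ennreal_mult' ac_simps)
    also have "\<dots> = ennreal (w ^ N) * (ennreal (pmf (binomial_pmf N (p / w)) x) * F x)"
      unfolding eq using w by (simp add: ennreal_mult' ac_simps)
    finally show "ennreal (pmf (binomial_pmf N p) x) * (F x * ennreal (w' ^ (N - x)))
        = ennreal (w ^ N) * (ennreal (pmf (binomial_pmf N (p / w)) x) * F x)" .
  qed
qed

definition alive_before :: "nat \<Rightarrow> nat list set" where
  "alive_before k = {xs. \<forall>j<k. xs ! j > 0}"

lemma alive_before_0 [simp]: "alive_before 0 = UNIV"
  by (simp add: alive_before_def)

lemma Cons_alive_before [simp]: "m # xs \<in> alive_before (Suc k) \<longleftrightarrow> m > 0 \<and> xs \<in> alive_before k"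
  unfolding alive_before_def mem_Collect_eq by (subst All_less_Suc2) simp

text \<open>
  The factors \<open>w j ^ (m - 1)\<close> of successive steps telescope up to one factor \<open>w j\<close> per step. The
  restriction to paths that are alive before time \<open>k\<close> is needed since for \<open>m = 0\<close> the exponent \<open>m - 1\<close> would
  be negative.
\<close>

lemma nn_integral_chain_tilt:
  assumes p: "0 \<le> p" "p \<le> 1"
    and pos: "\<And>j. j \<le> i + k \<Longrightarrow> w j > 0"
    and rec: "\<And>j. j < i + k \<Longrightarrow> w j = p + (1 - p) * w (Suc j)"
  shows "(\<integral>\<^sup>+xs. F xs * indicator (alive_before k) xs * ennreal (w (i + k) ^ (xs ! k))
            \<partial>thinning_chain (\<lambda>_. p) i m k) * ennreal (\<Prod>j<k. w (i + j))
       = ennreal (w i ^ m) * (\<integral>\<^sup>+xs. F xs * indicator (alive_before k) xs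
            \<partial>thinning_chain (\<lambda>j. p / w j) i m k)"
  using pos rec
proof (induction k arbitrary: i m F)
  case 0
  show ?case by (simp add: mult.commute)
next
  case (Suc k)
  have wpos: "w j > 0" if "j \<le> Suc (i + k)" for j using Suc.prems(1) that by simp
  show ?case
  proof (cases "m = 0")
    case True
    have z: "indicator (alive_before (Suc k)) (m # xs) = (0::ennreal)" for xs
      using True by simp
    show ?thesis by (simp add: z)
  next
    case False
    have alive: "indicator (alive_before (Suc k)) (m # xs) = (indicator (alive_before k) xs :: ennreal)" for xs
      using False by (simp add: indicator_def)
    define I where "I = (\<lambda>x. \<integral>\<^sup>+xs. F (m # xs) * indicator (alive_before k) xs
        * ennreal (w (Suc i + k) ^ (xs ! k)) \<partial>thinning_chain (\<lambda>_. p) (Suc i) (m - 1 - x) k)"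
    define J where "J = (\<lambda>x. \<integral>\<^sup>+xs. F (m # xs) * indicator (alive_before k) xs
        \<partial>thinning_chain (\<lambda>j. p / w j) (Suc i) (m - 1 - x) k)"
    define P where "P = ennreal (\<Prod>j<k. w (Suc i + j))"
    have IH: "I x * P = ennreal (w (Suc i) ^ (m - 1 - x)) * J x" for x
      unfolding I_def J_def P_def using Suc.prems by (intro Suc.IH) auto
    have prod: "ennreal (\<Prod>j<Suc k. w (i + j)) = ennreal (w i) * P"
      unfolding P_def by (subst prod.lessThan_Suc_shift)
        (simp add: ennreal_mult' wpos less_imp_le)
    have "(\<integral>\<^sup>+x. I x \<partial>binomial_pmf (m - 1) p) * (ennreal (w i) * P)
        = ennreal (w i) * (\<integral>\<^sup>+x. I x * P \<partial>binomial_pmf (m - 1) p)"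
      by (subst nn_integral_multc) (simp_all add: ac_simps)
    also have "\<dots> = ennreal (w i) * (\<integral>\<^sup>+x. J x * ennreal (w (Suc i) ^ (m - 1 - x)) \<partial>binomial_pmf (m - 1) p)"
      unfolding IH by (simp only: mult.commute)
    also have "\<dots> = ennreal (w i) * (ennreal (w i ^ (m - 1)) * (\<integral>\<^sup>+x. J x \<partial>binomial_pmf (m - 1) (p / w i)))"
      using p wpos[of i] wpos[of "Suc i"] Suc.prems(2)[of i]
      by (subst nn_integral_binomial_tilt[where w = "w i"]) auto
    also have "\<dots> = ennreal (w i ^ m) * (\<integral>\<^sup>+x. J x \<partial>binomial_pmf (m - 1) (p / w i))"
    proof -
      have "w i ^ m = w i * w i ^ (m - 1)" using False by (cases m) auto
      then have "ennreal (w i ^ m) = ennreal (w i) * ennreal (w i ^ (m - 1))"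
        using wpos[of i] by (simp add: ennreal_mult')
      then show ?thesis by (simp add: mult.assoc)
    qed
    finally show ?thesis
      unfolding prod by (simp add: alive I_def J_def)
  qed
qed

text \<open>
  The counterpart for weights at most 1, where extinct paths may be included: a step from \<open>m = 0\<close> leaves
  over a factor \<open>w j\<close>, which is at most 1.
\<close>

lemma nn_integral_chain_discount:
  assumes p: "0 \<le> p" "p \<le> 1"
    and pos: "\<And>j. j \<le> i + k \<Longrightarrow> w j > 0" and le: "\<And>j. j \<le> i + k \<Longrightarrow> w j \<le> 1"
    and rec: "\<And>j. j < i + k \<Longrightarrow> w j = p + (1 - p) * w (Suc j)"
  shows "(\<integral>\<^sup>+xs. ennreal (w (i + k) ^ (xs ! k)) \<partial>thinning_chain (\<lambda>_. p) i m k)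
           * ennreal (\<Prod>j<k. w (i + j)) \<le> ennreal (w i ^ m)"
  using pos le rec
proof (induction k arbitrary: i m)
  case 0
  show ?case by simp
next
  case (Suc k)
  have wpos: "w j > 0" if "j \<le> Suc (i + k)" for j using Suc.prems(1) that by simp
  define I where "I = (\<lambda>x. \<integral>\<^sup>+xs. ennreal (w (Suc i + k) ^ (xs ! k))
      \<partial>thinning_chain (\<lambda>_. p) (Suc i) (m - 1 - x) k)"
  define P where "P = ennreal (\<Prod>j<k. w (Suc i + j))"
  have IH: "I x * P \<le> ennreal (w (Suc i) ^ (m - 1 - x))" for x
    unfolding I_def P_def using Suc.prems by (intro Suc.IH) auto
  have prod: "ennreal (\<Prod>j<Suc k. w (i + j)) = ennreal (w i) * P"
    unfolding P_def by (subst prod.lessThan_Suc_shift)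
      (simp add: ennreal_mult' wpos less_imp_le)
  have "(\<integral>\<^sup>+x. I x \<partial>binomial_pmf (m - 1) p) * (ennreal (w i) * P)
      = ennreal (w i) * (\<integral>\<^sup>+x. I x * P \<partial>binomial_pmf (m - 1) p)"
    by (subst nn_integral_multc) (simp_all add: ac_simps)
  also have "\<dots> \<le> ennreal (w i) * (\<integral>\<^sup>+x. 1 * ennreal (w (Suc i) ^ (m - 1 - x)) \<partial>binomial_pmf (m - 1) p)"
    using IH by (intro mult_left_mono nn_integral_mono) auto
  also have "\<dots> = ennreal (w i) * ennreal (w i ^ (m - 1))"
    using p wpos[of i] wpos[of "Suc i"] Suc.prems(3)[of i]
    by (subst nn_integral_binomial_tilt[where w = "w i"]) auto
  also have "\<dots> = ennreal (w i * w i ^ (m - 1))"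
    using wpos[of i] by (simp add: ennreal_mult')
  also have "\<dots> \<le> ennreal (w i ^ m)"
    using Suc.prems(2)[of i] wpos[of i] by (cases m) (auto intro!: ennreal_leI)
  finally show ?case
    unfolding prod by (simp add: I_def)
qed

lemma emeasure_pmf_eq_nn_integral: "emeasure (measure_pmf M) A = (\<integral>\<^sup>+x. indicator A x \<partial>measure_pmf M)"
  by simp

text \<open>
  Markov's inequality for \<open>w k ^ N\<^sub>k\<close>, which is 1 on extinction.
\<close>

lemma chain_prob_extinct_le:
  assumes p: "0 \<le> p" "p \<le> 1"
    and pos: "\<And>j. j \<le> k \<Longrightarrow> w j > 0" and le: "\<And>j. j \<le> k \<Longrightarrow> w j \<le> 1"
    and rec: "\<And>j. j < k \<Longrightarrow> w j = p + (1 - p) * w (Suc j)"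
  shows "measure_pmf.prob (thinning_chain (\<lambda>_. p) 0 m k) {xs. xs ! k = 0} \<le> w 0 ^ m / (\<Prod>j<k. w j)"
proof -
  let ?M = "thinning_chain (\<lambda>_. p) 0 m k"
  have P: "(\<Prod>j<k. w j) > 0" using pos by (intro prod_pos) auto
  have "emeasure ?M {xs. xs ! k = 0} \<le> (\<integral>\<^sup>+xs. ennreal (w k ^ (xs ! k)) \<partial>?M)"
    unfolding emeasure_pmf_eq_nn_integral by (intro nn_integral_mono) (auto simp: indicator_def)
  then have "emeasure ?M {xs. xs ! k = 0} * ennreal (\<Prod>j<k. w j)
      \<le> (\<integral>\<^sup>+xs. ennreal (w k ^ (xs ! k)) \<partial>?M) * ennreal (\<Prod>j<k. w j)"
    by (intro mult_right_mono) auto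
  also have "\<dots> \<le> ennreal (w 0 ^ m)"
    using nn_integral_chain_discount[OF p, where i = 0 and k = k and w = w and m = m] assms by simp
  finally have "ennreal (measure_pmf.prob ?M {xs. xs ! k = 0} * (\<Prod>j<k. w j)) \<le> ennreal (w 0 ^ m)"
    using P by (simp add: measure_pmf.emeasure_eq_measure ennreal_mult)
  then have "measure_pmf.prob ?M {xs. xs ! k = 0} * (\<Prod>j<k. w j) \<le> w 0 ^ m"
    using pos[of 0] by (subst (asm) ennreal_le_iff) auto
  then show ?thesis using P by (simp add: field_simps)
qed

lemma chain_alive_before:
  assumes "xs \<in> set_pmf (thinning_chain \<pi> i m k)" "xs ! k > 0" "j < k"
  shows "xs ! j > 0"
  using thinning_chain_decreasing[OF assms(1), of j k] assms(2,3) by simp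

lemma chain_tilt_event:
  assumes p: "0 \<le> p" "p \<le> 1"
    and pos: "\<And>j. j \<le> k \<Longrightarrow> w j > 0"
    and rec: "\<And>j. j < k \<Longrightarrow> w j = p + (1 - p) * w (Suc j)"
    and alive: "\<And>xs. xs \<in> A \<Longrightarrow> xs ! k > 0"
  shows "(\<integral>\<^sup>+xs. indicator A xs * ennreal (w k ^ (xs ! k)) \<partial>thinning_chain (\<lambda>_. p) 0 m k) * ennreal (\<Prod>j<k. w j)
       = ennreal (w 0 ^ m * measure_pmf.prob (thinning_chain (\<lambda>j. p / w j) 0 m k) A)"
proof -
  have ind: "indicator A xs * indicator (alive_before k) xs = (indicator A xs :: ennreal)"
    if "xs \<in> set_pmf (thinning_chain \<pi> 0 m k)" for xs \<pi>
    using chain_alive_before[OF that] alive[of xs] by (auto simp: indicator_def alive_before_def)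
  have "(\<integral>\<^sup>+xs. indicator A xs * ennreal (w k ^ (xs ! k)) \<partial>thinning_chain (\<lambda>_. p) 0 m k)
      = (\<integral>\<^sup>+xs. indicator A xs * indicator (alive_before k) xs * ennreal (w (0 + k) ^ (xs ! k))
            \<partial>thinning_chain (\<lambda>_. p) 0 m k)"
    by (intro nn_integral_cong_AE) (auto simp: AE_measure_pmf_iff ind)
  moreover have "(\<integral>\<^sup>+xs. indicator A xs * indicator (alive_before k) xs
            \<partial>thinning_chain (\<lambda>j. p / w j) 0 m k) = (\<integral>\<^sup>+xs. indicator A xs \<partial>thinning_chain (\<lambda>j. p / w j) 0 m k)"
    by (intro nn_integral_cong_AE) (auto simp: AE_measure_pmf_iff ind)
  moreover have "\<dots> = ennreal (measure_pmf.prob (thinning_chain (\<lambda>j. p / w j) 0 m k) A)"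
    by (simp add: measure_pmf.emeasure_eq_measure)
  ultimately show ?thesis
    using nn_integral_chain_tilt[OF p, where i = 0 and k = k and w = w and m = m and F = "indicator A"] pos rec
    by (simp add: ennreal_mult'')
qed

lemma chain_prob_alive_le:
  assumes p: "0 \<le> p" "p \<le> 1"
    and ge: "\<And>j. j \<le> k \<Longrightarrow> w j \<ge> 1"
    and rec: "\<And>j. j < k \<Longrightarrow> w j = p + (1 - p) * w (Suc j)"
  shows "measure_pmf.prob (thinning_chain (\<lambda>_. p) 0 m k) {xs. xs ! k > 0} \<le> w 0 ^ m / (\<Prod>j<k. w j)"
proof -
  let ?M = "thinning_chain (\<lambda>_. p) 0 m k" and ?A = "{xs. xs ! k > 0} :: nat list set"
  have pos: "w j > 0" if "j \<le> k" for j using ge[OF that] by linarith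
  have P: "(\<Prod>j<k. w j) > 0" using pos by (intro prod_pos) auto
  have "emeasure ?M ?A \<le> (\<integral>\<^sup>+xs. indicator ?A xs * ennreal (w k ^ (xs ! k)) \<partial>?M)"
    unfolding emeasure_pmf_eq_nn_integral using ge[of k]
    by (intro nn_integral_mono) (auto simp: indicator_def one_le_power)
  then have "emeasure ?M ?A * ennreal (\<Prod>j<k. w j)
      \<le> (\<integral>\<^sup>+xs. indicator ?A xs * ennreal (w k ^ (xs ! k)) \<partial>?M) * ennreal (\<Prod>j<k. w j)"
    by (intro mult_right_mono) auto
  also have "\<dots> = ennreal (w 0 ^ m * measure_pmf.prob (thinning_chain (\<lambda>j. p / w j) 0 m k) ?A)"
    using pos rec by (intro chain_tilt_event[OF p]) auto
  also have "\<dots> \<le> ennreal (w 0 ^ m)"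
    using pos[of 0] by (intro ennreal_leI mult_left_le measure_pmf.prob_le_1) simp
  finally have "ennreal (measure_pmf.prob ?M ?A * (\<Prod>j<k. w j)) \<le> ennreal (w 0 ^ m)"
    using P by (simp add: measure_pmf.emeasure_eq_measure ennreal_mult)
  then have "measure_pmf.prob ?M ?A * (\<Prod>j<k. w j) \<le> w 0 ^ m"
    using pos[of 0] by (subst (asm) ennreal_le_iff) auto
  then show ?thesis using P by (simp add: field_simps)
qed

text \<open>
  On the event the density \<open>w k ^ (- N\<^sub>k)\<close> is bounded below; only weights above 1 cost anything.
\<close>

lemma chain_prob_ge_tilted:
  assumes p: "0 \<le> p" "p \<le> 1"
    and pos: "\<And>j. j \<le> k \<Longrightarrow> w j > 0"
    and rec: "\<And>j. j < k \<Longrightarrow> w j = p + (1 - p) * w (Suc j)"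
    and A: "\<And>xs. xs \<in> A \<Longrightarrow> xs ! k > 0 \<and> real (xs ! k) \<le> M"
  shows "measure_pmf.prob (thinning_chain (\<lambda>_. p) 0 m k) A
       \<ge> w 0 ^ m / (\<Prod>j<k. w j) / max 1 (w k) powr M
           * measure_pmf.prob (thinning_chain (\<lambda>j. p / w j) 0 m k) A"
proof -
  let ?M = "thinning_chain (\<lambda>_. p) 0 m k"
  let ?W = "max 1 (w k) powr M"
  have P: "(\<Prod>j<k. w j) > 0" using pos by (intro prod_pos) auto
  have W: "?W > 0" by simp
  have "(\<integral>\<^sup>+xs. indicator A xs * ennreal (w k ^ (xs ! k)) \<partial>?M) \<le> (\<integral>\<^sup>+xs. indicator A xs * ennreal ?W \<partial>?M)"
  proof (intro nn_integral_mono)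
    fix xs
    have "w k ^ (xs ! k) \<le> ?W" if "xs \<in> A"
    proof -
      have "w k ^ (xs ! k) \<le> max 1 (w k) ^ (xs ! k)"
        using pos[of k] by (intro power_mono) auto
      also have "\<dots> = max 1 (w k) powr real (xs ! k)"
        by (simp add: powr_realpow)
      also have "\<dots> \<le> ?W" using A[OF that] by (intro powr_mono) auto
      finally show ?thesis .
    qed
    then show "indicator A xs * ennreal (w k ^ (xs ! k)) \<le> indicator A xs * ennreal ?W"
      by (auto simp: indicator_def intro!: ennreal_leI)
  qed
  also have "\<dots> = ennreal (measure_pmf.prob ?M A * ?W)"
    by (subst nn_integral_multc) (simp_all add: measure_pmf.emeasure_eq_measure ennreal_mult)
  finally have "(\<integral>\<^sup>+xs. indicator A xs * ennreal (w k ^ (xs ! k)) \<partial>?M) * ennreal (\<Prod>j<k. w j)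
       \<le> ennreal (measure_pmf.prob ?M A * ?W) * ennreal (\<Prod>j<k. w j)"
    by (intro mult_right_mono) auto
  then have "ennreal (w 0 ^ m * measure_pmf.prob (thinning_chain (\<lambda>j. p / w j) 0 m k) A)
       \<le> ennreal (measure_pmf.prob ?M A * ?W * (\<Prod>j<k. w j))"
    using chain_tilt_event[OF p, where k = k and w = w and m = m and A = A] pos rec A P by (simp add: ennreal_mult')
  then have "w 0 ^ m * measure_pmf.prob (thinning_chain (\<lambda>j. p / w j) 0 m k) A
       \<le> measure_pmf.prob ?M A * ?W * (\<Prod>j<k. w j)"
    using P by (subst (asm) ennreal_le_iff) (auto intro!: mult_nonneg_nonneg)
  then show ?thesis using P W by (simp add: field_simps)
qed

text \<open>
  The affine form lets the induction on \<open>N\<close> pass a shift of \<open>\<beta>\<close> to the hypothesis.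
\<close>

lemma binomial_second_moment:
  assumes p: "0 \<le> p" "p \<le> 1"
  shows "(\<integral>\<^sup>+x. ennreal ((\<alpha> * real (N - x) - \<beta>)\<^sup>2) \<partial>binomial_pmf N p)
       = ennreal ((\<alpha> * (real N * (1 - p)) - \<beta>)\<^sup>2 + \<alpha>\<^sup>2 * (real N * p * (1 - p)))"
proof (induction N arbitrary: \<beta>)
  case 0
  then show ?case using p by (simp add: binomial_pmf_0)
next
  case (Suc N)
  let ?A = "\<alpha> * (real N * (1 - p))" and ?V = "\<alpha>\<^sup>2 * (real N * p * (1 - p))"
  have V: "?V \<ge> 0" using p by simp
  have F: "(\<integral>\<^sup>+x. ennreal ((\<alpha> * real (Suc N - x) - \<beta>)\<^sup>2) \<partial>binomial_pmf N p) = ennreal ((?A - (\<beta> - \<alpha>))\<^sup>2 + ?V)"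
  proof -
    have "(\<integral>\<^sup>+x. ennreal ((\<alpha> * real (Suc N - x) - \<beta>)\<^sup>2) \<partial>binomial_pmf N p)
        = (\<integral>\<^sup>+x. ennreal ((\<alpha> * real (N - x) - (\<beta> - \<alpha>))\<^sup>2) \<partial>binomial_pmf N p)"
      using p by (intro nn_integral_cong_AE)
        (auto simp: AE_measure_pmf_iff set_pmf_binomial_eq Suc_diff_le algebra_simps split: if_splits)
    then show ?thesis by (simp add: Suc.IH)
  qed
  have "(\<integral>\<^sup>+x. ennreal ((\<alpha> * real (Suc N - x) - \<beta>)\<^sup>2) \<partial>binomial_pmf (Suc N) p)
      = (\<integral>\<^sup>+b. \<integral>\<^sup>+x. ennreal ((\<alpha> * real (Suc N - ((if b then 1 else 0) + x)) - \<beta>)\<^sup>2) \<partial>binomial_pmf N p \<partial>bernoulli_pmf p)"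
    using p by (simp add: binomial_pmf_Suc)
  also have "\<dots> = ennreal ((?A - \<beta>)\<^sup>2 + ?V) * ennreal p + ennreal ((?A - (\<beta> - \<alpha>))\<^sup>2 + ?V) * ennreal (1 - p)"
    using p by (simp add: F Suc.IH nn_integral_bernoulli_pmf)
  also have "\<dots> = ennreal (((?A - \<beta>)\<^sup>2 + ?V) * p + ((?A - (\<beta> - \<alpha>))\<^sup>2 + ?V) * (1 - p))"
    using p V by (simp only: ennreal_mult[symmetric] ennreal_plus[symmetric] add_nonneg_nonneg
        mult_nonneg_nonneg zero_le_power2 diff_ge_0_iff_ge)
  also have "((?A - \<beta>)\<^sup>2 + ?V) * p + ((?A - (\<beta> - \<alpha>))\<^sup>2 + ?V) * (1 - p)
      = (\<alpha> * (real (Suc N) * (1 - p)) - \<beta>)\<^sup>2 + \<alpha>\<^sup>2 * (real (Suc N) * p * (1 - p))"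
    by (simp add: power2_eq_square algebra_simps)
  finally show ?case .
qed

text \<open>
  By \<open>\<rho>\<close> and \<open>r\<close> the process \<open>\<rho> k * N\<^sub>k - r k\<close> is a martingale as long as the chain is alive. After
  extinction it equals \<open>- r k\<close>, which moves towards 0 because \<open>r\<close> decreases but stays nonnegative. So
  each step adds at most its variance, which is at most \<open>B\<close>.
\<close>

lemma chain_second_moment:
  assumes \<pi>: "\<And>j. j < i + k \<Longrightarrow> 0 \<le> \<pi> j \<and> \<pi> j \<le> 1"
    and \<rho>: "\<And>j. j < i + k \<Longrightarrow> \<rho> (Suc j) * (1 - \<pi> j) = \<rho> j" "\<And>j. j \<le> i + k \<Longrightarrow> 0 \<le> \<rho> j"
    and r: "\<And>j. j < i + k \<Longrightarrow> r (Suc j) = r j - \<rho> j" "\<And>j. j \<le> i + k \<Longrightarrow> 0 \<le> r j"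
    and B: "\<And>j. j < i + k \<Longrightarrow> real M * (\<rho> (Suc j))\<^sup>2 * \<pi> j \<le> B" "0 \<le> B" and m: "m \<le> M"
  shows "(\<integral>\<^sup>+xs. ennreal ((\<rho> (i + k) * real (xs ! k) - r (i + k))\<^sup>2) \<partial>thinning_chain \<pi> i m k)
       \<le> ennreal ((\<rho> i * real m - r i)\<^sup>2 + real k * B)"
  using \<pi> \<rho> r B(1) m
proof (induction k arbitrary: i m)
  case (Suc k)
  have "(\<integral>\<^sup>+xs. ennreal ((\<rho> (i + Suc k) * real (xs ! Suc k) - r (i + Suc k))\<^sup>2) \<partial>thinning_chain \<pi> i m (Suc k))
      = (\<integral>\<^sup>+x. \<integral>\<^sup>+xs. ennreal ((\<rho> (Suc i + k) * real (xs ! k) - r (Suc i + k))\<^sup>2)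
           \<partial>thinning_chain \<pi> (Suc i) (m - 1 - x) k \<partial>binomial_pmf (m - 1) (\<pi> i))"
    by simp
  also have "\<dots> \<le> (\<integral>\<^sup>+x. ennreal ((\<rho> (Suc i) * real (m - 1 - x) - r (Suc i))\<^sup>2 + real k * B) \<partial>binomial_pmf (m - 1) (\<pi> i))"
    by (intro nn_integral_mono Suc.IH) (use Suc.prems in auto)
  also have "\<dots> = (\<integral>\<^sup>+x. ennreal ((\<rho> (Suc i) * real (m - 1 - x) - r (Suc i))\<^sup>2) \<partial>binomial_pmf (m - 1) (\<pi> i)) + ennreal (real k * B)"
    using B(2) by (simp add: ennreal_plus nn_integral_add)
  also have "\<dots> = ennreal ((\<rho> (Suc i) * (real (m - 1) * (1 - \<pi> i)) - r (Suc i))\<^sup>2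
      + (\<rho> (Suc i))\<^sup>2 * (real (m - 1) * \<pi> i * (1 - \<pi> i))) + ennreal (real k * B)"
    using Suc.prems(1)[of i] by (subst binomial_second_moment) auto
  also have "\<dots> \<le> ennreal ((\<rho> i * real m - r i)\<^sup>2 + real (Suc k) * B)"
  proof -
    have pi: "0 \<le> \<pi> i" "\<pi> i \<le> 1" using Suc.prems(1)[of i] by auto
    have "(\<rho> (Suc i))\<^sup>2 * (real (m - 1) * \<pi> i * (1 - \<pi> i)) \<le> (\<rho> (Suc i))\<^sup>2 * (real M * \<pi> i * 1)"
      using pi Suc.prems(7) by (intro mult_left_mono mult_mono) auto
    also have "\<dots> \<le> B" using Suc.prems(6)[of i] by (simp add: ac_simps)
    finally have V: "(\<rho> (Suc i))\<^sup>2 * (real (m - 1) * \<pi> i * (1 - \<pi> i)) \<le> B" .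
    have "\<rho> (Suc i) * (real (m - 1) * (1 - \<pi> i)) = \<rho> i * real (m - 1)"
      using Suc.prems(2)[of i] by (simp add: ac_simps flip: Suc.prems(2)[of i])
    then have "\<rho> (Suc i) * (real (m - 1) * (1 - \<pi> i)) - r (Suc i) = \<rho> i * (real (m - 1) + 1) - r i"
      using Suc.prems(4)[of i] by (simp add: algebra_simps)
    moreover have "(\<rho> i * (real (m - 1) + 1) - r i)\<^sup>2 \<le> (\<rho> i * real m - r i)\<^sup>2"
    proof (cases "m = 0")
      case True
      have "0 \<le> r i - \<rho> i" "0 \<le> \<rho> i" using Suc.prems(4)[of i] Suc.prems(5)[of "Suc i"] Suc.prems(3)[of i] by auto
      then have "(r i - \<rho> i)\<^sup>2 \<le> (r i)\<^sup>2" by (intro power_mono) auto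
      then show ?thesis using True by (simp add: power2_commute)
    qed simp
    ultimately have "(\<rho> (Suc i) * (real (m - 1) * (1 - \<pi> i)) - r (Suc i))\<^sup>2 \<le> (\<rho> i * real m - r i)\<^sup>2" by simp
    with V have "(\<rho> (Suc i) * (real (m - 1) * (1 - \<pi> i)) - r (Suc i))\<^sup>2
        + (\<rho> (Suc i))\<^sup>2 * (real (m - 1) * \<pi> i * (1 - \<pi> i)) + real k * B
        \<le> (\<rho> i * real m - r i)\<^sup>2 + real (Suc k) * B"
      by (simp add: algebra_simps)
    then show ?thesis using B(2) pi
      by (subst ennreal_plus[symmetric]) (auto intro!: ennreal_leI add_nonneg_nonneg mult_nonneg_nonneg simp del: ennreal_plus)
  qed
  finally show ?case .
qed simp

lemma chain_deviation_le:
  assumes "j \<le> k"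
    and \<pi>: "\<And>j. j < k \<Longrightarrow> 0 \<le> \<pi> j \<and> \<pi> j \<le> 1"
    and \<rho>: "\<And>j. j < k \<Longrightarrow> \<rho> (Suc j) * (1 - \<pi> j) = \<rho> j" "\<And>j. j \<le> k \<Longrightarrow> 0 \<le> \<rho> j"
    and r: "\<And>j. j < k \<Longrightarrow> r (Suc j) = r j - \<rho> j" "\<And>j. j \<le> k \<Longrightarrow> 0 \<le> r j" "r 0 = \<rho> 0 * real m"
    and B: "\<And>j. j < k \<Longrightarrow> real m * (\<rho> (Suc j))\<^sup>2 * \<pi> j \<le> B" "0 \<le> B" and t: "t > 0"
  shows "measure_pmf.prob (thinning_chain \<pi> 0 m k) {xs. \<bar>\<rho> j * real (xs ! j) - r j\<bar> \<ge> t} \<le> real k * B / t\<^sup>2"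
proof -
  let ?M = "thinning_chain \<pi> 0 m j"
  have "measure_pmf.prob (thinning_chain \<pi> 0 m k) {xs. \<bar>\<rho> j * real (xs ! j) - r j\<bar> \<ge> t}
      = measure_pmf.prob (map_pmf (take (Suc j)) (thinning_chain \<pi> 0 m (j + (k - j)))) {xs. \<bar>\<rho> j * real (xs ! j) - r j\<bar> \<ge> t}"
    using \<open>j \<le> k\<close> by (simp add: vimage_def)
  also have "\<dots> = measure_pmf.prob ?M {xs. \<bar>\<rho> j * real (xs ! j) - r j\<bar> \<ge> t}" (is "_ = measure_pmf.prob _ ?S")
    by (simp only: thinning_chain_take)
  also have "\<dots> \<le> real k * B / t\<^sup>2"
  proof -
    have "ennreal (measure_pmf.prob ?M ?S * t\<^sup>2) = (\<integral>\<^sup>+xs. indicator ?S xs * ennreal (t\<^sup>2) \<partial>?M)"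
      by (subst nn_integral_multc) (simp_all add: measure_pmf.emeasure_eq_measure ennreal_mult)
    also have "\<dots> \<le> (\<integral>\<^sup>+xs. ennreal ((\<rho> (0 + j) * real (xs ! j) - r (0 + j))\<^sup>2) \<partial>?M)"
    proof (intro nn_integral_mono)
      fix xs
      have "t\<^sup>2 \<le> (\<rho> j * real (xs ! j) - r j)\<^sup>2" if "xs \<in> ?S"
        using that t by (subst abs_le_square_iff[symmetric]) simp
      then show "indicator ?S xs * ennreal (t\<^sup>2) \<le> ennreal ((\<rho> (0 + j) * real (xs ! j) - r (0 + j))\<^sup>2)"
        by (cases "xs \<in> ?S") (simp_all add: ennreal_leI)
    qed
    also have "\<dots> \<le> ennreal ((\<rho> 0 * real m - r 0)\<^sup>2 + real j * B)"
      by (rule chain_second_moment[where M = m]) (use assms in auto)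
    also have "\<dots> \<le> ennreal (real k * B)"
      using assms by (intro ennreal_leI) (auto intro: mult_right_mono)
    finally have "measure_pmf.prob ?M ?S * t\<^sup>2 \<le> real k * B"
      using B(2) by (subst (asm) ennreal_le_iff) auto
    then show ?thesis using t by (simp add: field_simps)
  qed
  finally show ?thesis .
qed

section \<open>Scaling limits of the tilted chain\<close>

text \<open>
  An antiderivative \<open>H\<close> turns the comparison on each subinterval into the mean value theorem.
\<close>

lemma left_riemann_sum_error:
  fixes h H :: "real \<Rightarrow> real"
  assumes H: "\<And>x. x \<in> {0..L} \<Longrightarrow> (H has_real_derivative h x) (at x within {0..L})"
    and osc: "\<And>x y. x \<in> {0..L} \<Longrightarrow> y \<in> {0..L} \<Longrightarrow> \<bar>x - y\<bar> < d \<Longrightarrow> \<bar>h x - h y\<bar> < e"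
    and \<delta>: "0 < \<delta>" "\<delta> < d" and k: "\<delta> * real k \<le> L"
  shows "\<bar>\<delta> * (\<Sum>j<k. h (\<delta> * real j)) - (H (\<delta> * real k) - H 0)\<bar> \<le> e * (\<delta> * real k)"
  using k
proof (induction k)
  case (Suc k)
  let ?a = "\<delta> * real k" and ?b = "\<delta> * real (Suc k)"
  have ab: "?a < ?b" "0 \<le> ?a" "?b - ?a = \<delta>" using \<delta> by (simp_all add: algebra_simps)
  have "\<exists>x\<in>{?a<..<?b}. H ?b - H ?a = (?b - ?a) * h x"
  proof -
    have "\<exists>x\<in>{?a<..<?b}. H ?b - H ?a = (\<lambda>t. h x * t) (?b - ?a)"
    proof (rule mvt_simple[OF ab(1)])
      fix x assume "?a \<le> x" "x \<le> ?b"
      then have "0 \<le> x" "x \<le> L" using ab(2) Suc.prems by linarith+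
      then have "x \<in> {0..L}" "{?a..?b} \<subseteq> {0..L}" using ab(2) Suc.prems by simp_all
      from has_field_derivative_subset[OF H[OF this(1)] this(2)]
      show "(H has_derivative (\<lambda>t. h x * t)) (at x within {?a..?b})"
        by (simp add: has_field_derivative_def)
    qed
    then show ?thesis by (simp add: mult.commute)
  qed
  then obtain x where x: "?a < x" "x < ?b" "H ?b - H ?a = \<delta> * h x"
    using ab by auto
  have "0 \<le> x" "x \<le> L" "\<bar>?a - x\<bar> < d" using x ab \<delta> Suc.prems by linarith+
  then have "\<bar>h ?a - h x\<bar> < e"
    using x(1) ab(2) by (intro osc) auto
  then have "\<bar>\<delta> * h ?a - (H ?b - H ?a)\<bar> \<le> e * \<delta>"
    using \<delta> unfolding x(3) right_diff_distrib[symmetric] abs_mult by (simp add: mult.commute)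
  moreover have "\<bar>\<delta> * (\<Sum>j<k. h (\<delta> * real j)) - (H ?a - H 0)\<bar> \<le> e * ?a"
    using Suc ab by auto
  ultimately show ?case
    by (simp add: algebra_simps)
qed simp

lemma left_riemann_sum_tendsto:
  fixes h H :: "real \<Rightarrow> real" and k :: "nat \<Rightarrow> nat"
  assumes h: "continuous_on {0..L} h"
    and H: "\<And>x. x \<in> {0..L} \<Longrightarrow> (H has_real_derivative h x) (at x within {0..L})"
    and \<delta>: "eventually (\<lambda>n. \<delta> n > 0) sequentially" "\<delta> \<longlonglongrightarrow> 0"
    and k: "(\<lambda>n. \<delta> n * real (k n)) \<longlonglongrightarrow> v" and v: "0 \<le> v" "v < L"
  shows "(\<lambda>n. \<delta> n * (\<Sum>j<k n. h (\<delta> n * real j))) \<longlonglongrightarrow> H v - H 0"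
proof -
  have le: "eventually (\<lambda>n. \<delta> n * real (k n) \<le> L) sequentially"
    using order_tendstoD(2)[OF k v(2)] by eventually_elim simp
  have mem: "eventually (\<lambda>n. \<delta> n * real (k n) \<in> {0..L}) sequentially"
    using le \<delta>(1) by eventually_elim simp
  have "continuous_on {0..L} H"
    unfolding continuous_on_eq_continuous_within using H by (blast intro: DERIV_continuous)
  from continuous_on_tendsto_compose[OF this k _ mem] v
  have lim: "(\<lambda>n. H (\<delta> n * real (k n)) - H 0) \<longlonglongrightarrow> H v - H 0"
    by (intro tendsto_intros) auto
  have "(\<lambda>n. \<delta> n * (\<Sum>j<k n. h (\<delta> n * real j)) - (H (\<delta> n * real (k n)) - H 0)) \<longlonglongrightarrow> 0"
  proof (rule tendstoI)
    fix e :: real assume e: "e > 0"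
    define e' where "e' = e / (L + 1)"
    have L: "L + 1 > 0" and e': "e' > 0" using v e by (auto simp: e'_def)
    have "uniformly_continuous_on {0..L} h"
      using h by (intro compact_uniformly_continuous) auto
    then obtain d where d: "d > 0"
      "\<And>x y. x \<in> {0..L} \<Longrightarrow> y \<in> {0..L} \<Longrightarrow> \<bar>x - y\<bar> < d \<Longrightarrow> \<bar>h x - h y\<bar> < e'"
      using e' unfolding uniformly_continuous_on_def dist_real_def
      by (metis abs_minus_commute)
    show "eventually (\<lambda>n. dist (\<delta> n * (\<Sum>j<k n. h (\<delta> n * real j)) - (H (\<delta> n * real (k n)) - H 0)) 0 < e) sequentially"
      using \<delta>(1) le order_tendstoD(2)[OF \<delta>(2) d(1)]
    proof eventually_elim
      case (elim n)
      have "\<bar>\<delta> n * (\<Sum>j<k n. h (\<delta> n * real j)) - (H (\<delta> n * real (k n)) - H 0)\<bar> \<le> e' * (\<delta> n * real (k n))"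
        using elim by (intro left_riemann_sum_error[OF H d(2)]) auto
      also have "\<dots> \<le> e' * L" using elim e' by (intro mult_left_mono) auto
      also have "\<dots> < e' * (L + 1)" using e' by simp
      also have "\<dots> = e" using L by (simp add: e'_def)
      finally show ?case by (simp add: dist_real_def)
    qed
  qed
  from tendsto_add[OF this lim] show ?thesis by simp
qed

text \<open>
  The solutions of the weight recursion: with \<open>lam = - ln (1 - p)\<close> the deviation from the fixed point 1
  grows by the factor \<open>1 / (1 - p)\<close> in each step.
\<close>

definition tilt_weight :: "real \<Rightarrow> real \<Rightarrow> nat \<Rightarrow> real" where
  "tilt_weight \<alpha> lam j = 1 + \<alpha> * exp (lam * real j)"

definition log_weight_integral :: "real \<Rightarrow> real \<Rightarrow> real" where
  "log_weight_integral \<alpha> v = integral {0..v} (\<lambda>u. ln (1 + \<alpha> * exp u))"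

lemma tilt_weight_rec:
  "tilt_weight \<alpha> lam j = (1 - exp (- lam)) + (1 - (1 - exp (- lam))) * tilt_weight \<alpha> lam (Suc j)"
proof -
  have "exp (- lam) * exp (lam * real (Suc j)) = exp (lam * real j)"
    unfolding exp_add[symmetric] by (simp add: algebra_simps)
  then have "exp (- lam) * (\<alpha> * exp (lam * real (Suc j))) = \<alpha> * exp (lam * real j)"
    by (metis mult.left_commute)
  moreover have "1 + x = (1 - y) + (1 - (1 - y)) * (1 + z)" if "y * z = x" for x y z :: real
    using that by (simp add: algebra_simps)
  ultimately show ?thesis unfolding tilt_weight_def by blast
qed

text \<open>
  The weight is monotone in \<open>u\<close>, with direction depending on the sign of \<open>\<alpha>\<close>.
\<close>

lemma weight_lower_bound:
  fixes \<alpha> u L :: real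
  assumes "u \<in> {0..L}"
  shows "min (1 + \<alpha>) (1 + \<alpha> * exp L) \<le> 1 + \<alpha> * exp u"
proof (cases "\<alpha> \<ge> 0")
  case True
  have "\<alpha> * 1 \<le> \<alpha> * exp u" using assms True by (intro mult_left_mono) auto
  then show ?thesis by simp
next
  case False
  have "\<alpha> * exp L \<le> \<alpha> * exp u" using assms False by (intro mult_left_mono_neg) auto
  then show ?thesis by simp
qed

lemma weight_pos:
  fixes \<alpha> u L :: real
  assumes "\<alpha> > -1" "1 + \<alpha> * exp L > 0" "u \<in> {0..L}"
  shows "1 + \<alpha> * exp u > 0"
  using weight_lower_bound[OF assms(3), of \<alpha>] assms(1,2) by linarith

lemma weight_pos_extend:
  fixes \<alpha> v :: real
  assumes "1 + \<alpha> * exp v > (0::real)"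
  obtains L where "v < L" "1 + \<alpha> * exp L > 0"
proof -
  have "isCont (\<lambda>L. 1 + \<alpha> * exp L) v" by (intro continuous_intros)
  then have "((\<lambda>L. 1 + \<alpha> * exp L) \<longlongrightarrow> 1 + \<alpha> * exp v) (at_right v)"
    by (simp add: isCont_def filterlim_at_split)
  from order_tendstoD(1)[OF this assms]
  have "eventually (\<lambda>L. 1 + \<alpha> * exp L > 0 \<and> v < L) (at_right v)"
    using eventually_at_right_less[of v] by eventually_elim simp
  then have "\<exists>L. 1 + \<alpha> * exp L > 0 \<and> v < L"
    using eventually_happens by force
  then show ?thesis using that by blast
qed

text \<open>
  The rate for which \<open>exp (- log_rate c n)\<close> is the probability \<open>1 - c / n\<close> of a missing edge.
\<close>

definition log_rate :: "real \<Rightarrow> nat \<Rightarrow> real" where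
  "log_rate c n = - ln (1 - c / real n)"

lemma eventually_real_gt: "eventually (\<lambda>n. real n > c) sequentially"
  by (rule eventually_compose_filterlim[OF eventually_gt_at_top filterlim_real_sequentially])

lemma exp_log_rate:
  assumes "real n > c" "c > 0"
  shows "1 - exp (- log_rate c n) = c / real n" "log_rate c n > 0"
proof -
  have "0 < 1 - c / real n" "1 - c / real n < 1" using assms by (simp_all add: field_simps)
  then show "1 - exp (- log_rate c n) = c / real n" "log_rate c n > 0"
    by (simp_all add: log_rate_def)
qed

lemma log_rate_scaled_tendsto:
  fixes c :: real
  assumes "c > 0"
  shows "(\<lambda>n. log_rate c n * real n) \<longlonglongrightarrow> c"
proof -
  have "((\<lambda>x::real. - ln (1 - c / x) * x) \<longlongrightarrow> c) at_top"
    by real_asymp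
  from filterlim_compose[OF this filterlim_real_sequentially] show ?thesis
    by (simp add: log_rate_def)
qed

lemma log_rate_tendsto: 
  fixes c :: real
  assumes "c > 0"
  shows "log_rate c \<longlonglongrightarrow> 0"
proof -
  have "((\<lambda>x::real. - ln (1 - c / x)) \<longlongrightarrow> 0) at_top"
    by real_asymp
  from filterlim_compose[OF this filterlim_real_sequentially] show ?thesis
    by (simp add: log_rate_def[abs_def])
qed

lemma log_rate_mult_tendsto:
  assumes c: "c > 0" and k: "(\<lambda>n. real (k n) / real n) \<longlonglongrightarrow> x"
  shows "(\<lambda>n. log_rate c n * real (k n)) \<longlonglongrightarrow> c * x"
proof (rule Lim_transform_eventually)
  show "(\<lambda>n. (log_rate c n * real n) * (real (k n) / real n)) \<longlonglongrightarrow> c * x"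
    by (intro tendsto_mult log_rate_scaled_tendsto c k)
  show "eventually (\<lambda>n. (log_rate c n * real n) * (real (k n) / real n) = log_rate c n * real (k n)) sequentially"
    using eventually_gt_at_top[of 0] by eventually_elim simp
qed

lemma scaled_sum_tendsto:
  fixes h H :: "real \<Rightarrow> real" and k :: "nat \<Rightarrow> nat"
  assumes c: "c > 0" and k: "(\<lambda>n. real (k n) / real n) \<longlonglongrightarrow> x"
    and x: "0 \<le> x" "c * x < L" and h: "continuous_on {0..L} h"
    and H: "\<And>x. x \<in> {0..L} \<Longrightarrow> (H has_real_derivative h x) (at x within {0..L})"
  shows "(\<lambda>n. (\<Sum>j<k n. h (log_rate c n * real j)) / real n) \<longlonglongrightarrow> (H (c * x) - H 0) / c"
proof (rule Lim_transform_eventually)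
  have pos: "eventually (\<lambda>n. log_rate c n > 0) sequentially"
    using eventually_real_gt[of c] by eventually_elim (use c in \<open>auto intro: exp_log_rate\<close>)
  show "(\<lambda>n. log_rate c n * (\<Sum>j<k n. h (log_rate c n * real j)) / (log_rate c n * real n))
          \<longlonglongrightarrow> (H (c * x) - H 0) / c"
    using c x by (intro tendsto_divide log_rate_scaled_tendsto left_riemann_sum_tendsto[OF h H pos]
        log_rate_tendsto log_rate_mult_tendsto k) auto
  show "eventually (\<lambda>n. log_rate c n * (\<Sum>j<k n. h (log_rate c n * real j)) / (log_rate c n * real n)
      = (\<Sum>j<k n. h (log_rate c n * real j)) / real n) sequentially"
    using pos by eventually_elim simp
qed

lemma continuous_on_ln_weight:
  fixes \<alpha> L :: real
  assumes "\<alpha> > -1" "1 + \<alpha> * exp L > 0"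
  shows "continuous_on {0..L} (\<lambda>u. ln (1 + \<alpha> * exp u))"
  using weight_pos[OF assms] by (intro continuous_intros) force

lemma log_weight_integral_derivative:
  assumes "\<alpha> > -1" "1 + \<alpha> * exp L > 0" "u \<in> {0..L}"
  shows "(log_weight_integral \<alpha> has_real_derivative ln (1 + \<alpha> * exp u)) (at u within {0..L})"
  using integral_has_real_derivative[OF continuous_on_ln_weight[OF assms(1,2)] assms(3)]
  unfolding log_weight_integral_def[abs_def] .

lemma log_weight_integral_0 [simp]: "log_weight_integral \<alpha> 0 = 0"
  by (simp add: log_weight_integral_def)

lemma sum_ln_tilt_weight_tendsto:
  assumes c: "c > 0" and k: "(\<lambda>n. real (k n) / real n) \<longlonglongrightarrow> x" and x: "0 \<le> x"
    and \<alpha>: "\<alpha> > -1" "1 + \<alpha> * exp (c * x) > 0"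
  shows "(\<lambda>n. (\<Sum>j<k n. ln (tilt_weight \<alpha> (log_rate c n) j)) / real n) \<longlonglongrightarrow> log_weight_integral \<alpha> (c * x) / c"
proof -
  obtain L where L: "c * x < L" "1 + \<alpha> * exp L > 0" using weight_pos_extend[OF \<alpha>(2)] .
  from scaled_sum_tendsto[OF c k x L(1) continuous_on_ln_weight[OF \<alpha>(1) L(2)]
      log_weight_integral_derivative[OF \<alpha>(1) L(2)]]
  show ?thesis by (simp add: tilt_weight_def)
qed

text \<open>
  Limit of \<open>r k / n\<close> for the centering sequence \<open>r\<close> of the tilted chain; it vanishes at the time of
  extinction.
\<close>

definition profile_gap :: "real \<Rightarrow> real \<Rightarrow> real \<Rightarrow> real" where
  "profile_gap c \<alpha> x = 1 / (1 + \<alpha>) - ln ((1 + \<alpha> * exp (c * x)) / (1 + \<alpha>)) / (c * \<alpha>)"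

text \<open>
  Limit of \<open>r k / (\<rho> k * n)\<close>, the typical trajectory of the tilted chain.
\<close>

definition profile :: "real \<Rightarrow> real \<Rightarrow> real \<Rightarrow> real" where
  "profile c \<alpha> x = (1 + \<alpha> * exp (c * x)) / exp (c * x) * profile_gap c \<alpha> x"

lemma drift_sum_tendsto:
  assumes c: "c > 0" and k: "(\<lambda>n. real (k n) / real n) \<longlonglongrightarrow> x" and x: "0 \<le> x"
    and \<alpha>: "\<alpha> > -1" "\<alpha> \<noteq> 0" "1 + \<alpha> * exp (c * x) > 0"
  shows "(\<lambda>n. (real n / (1 + \<alpha>) - (\<Sum>j<k n. exp (log_rate c n * real j) / tilt_weight \<alpha> (log_rate c n) j)) / real n)
           \<longlonglongrightarrow> profile_gap c \<alpha> x"
proof (rule Lim_transform_eventually)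
  obtain L where L: "c * x < L" "1 + \<alpha> * exp L > 0" using weight_pos_extend[OF \<alpha>(3)] .
  note pos = weight_pos[OF \<alpha>(1) L(2)]
  define H where "H = (\<lambda>u. ln (1 + \<alpha> * exp u) / \<alpha>)"
  have H: "(H has_real_derivative exp u / (1 + \<alpha> * exp u)) (at u within {0..L})" if "u \<in> {0..L}" for u
    unfolding H_def using pos[OF that] \<alpha>(2) by (auto intro!: derivative_eq_intros)
  have h: "continuous_on {0..L} (\<lambda>u. exp u / (1 + \<alpha> * exp u))"
    using pos by (intro continuous_intros) force
  have "profile_gap c \<alpha> x = 1 / (1 + \<alpha>) - (H (c * x) - H 0) / c"
    unfolding profile_gap_def H_def using \<alpha> c by (simp add: ln_div diff_divide_distrib mult.commute)
  moreover have "(\<lambda>n. 1 / (1 + \<alpha>) - (\<Sum>j<k n. exp (log_rate c n * real j) / (1 + \<alpha> * exp (log_rate c n * real j))) / real n)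
      \<longlonglongrightarrow> 1 / (1 + \<alpha>) - (H (c * x) - H 0) / c"
    by (intro tendsto_diff tendsto_const scaled_sum_tendsto[OF c k x L(1) h H])
  ultimately show "(\<lambda>n. 1 / (1 + \<alpha>) - (\<Sum>j<k n. exp (log_rate c n * real j) / tilt_weight \<alpha> (log_rate c n) j) / real n)
      \<longlonglongrightarrow> profile_gap c \<alpha> x"
    by (simp add: tilt_weight_def)
  show "eventually (\<lambda>n. 1 / (1 + \<alpha>) - (\<Sum>j<k n. exp (log_rate c n * real j) / tilt_weight \<alpha> (log_rate c n) j) / real n
      = (real n / (1 + \<alpha>) - (\<Sum>j<k n. exp (log_rate c n * real j) / tilt_weight \<alpha> (log_rate c n) j)) / real n) sequentially"
    using eventually_gt_at_top[of 0] by eventually_elim (simp add: diff_divide_distrib)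
qed

lemma weight_ratio_eq_exp:
  fixes w :: "nat \<Rightarrow> real"
  assumes "\<And>j. j < k \<Longrightarrow> w j > 0" "w0 > 0" "n > 0"
  shows "w0 ^ n / (\<Prod>j<k. w j) = exp (real n * (ln w0 - (\<Sum>j<k. ln (w j)) / real n))"
proof -
  have "(\<Prod>j<k. w j) = exp (\<Sum>j<k. ln (w j))"
    unfolding exp_sum[OF finite_lessThan] using assms(1) by (intro prod.cong) auto
  moreover have "w0 ^ n = exp (real n * ln w0)"
    using assms(2) by (simp add: exp_of_nat_mult)
  ultimately show ?thesis
    using assms(3) by (simp add: right_diff_distrib exp_diff)
qed

lemma eventually_log_rate_range:
  assumes c: "c > 0" and k: "(\<lambda>n. real (k n) / real n) \<longlonglongrightarrow> x" and L: "c * x < L"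
  shows "eventually (\<lambda>n. \<forall>j\<le>k n. log_rate c n * real j \<in> {0..L}) sequentially"
  using eventually_real_gt[of c] order_tendstoD(2)[OF log_rate_mult_tendsto[OF c k] L]
proof eventually_elim
  case (elim n)
  show ?case
  proof (intro allI impI)
    fix j assume "j \<le> k n"
    then have "log_rate c n * real j \<le> log_rate c n * real (k n)"
      using exp_log_rate(2)[OF elim(1) c] by (intro mult_left_mono) auto
    also have "\<dots> \<le> L" using elim(2) by simp
    finally show "log_rate c n * real j \<in> {0..L}"
      using exp_log_rate(2)[OF elim(1) c] by simp
  qed
qed

text \<open>
  The sign of \<open>\<alpha>\<close> decides which tail the weights control.
\<close>

lemma tail_prob_upper_bound:
  assumes c: "c > 0" and k: "(\<lambda>n. real (k n) / real n) \<longlonglongrightarrow> x" and x: "0 \<le> x"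
    and \<alpha>: "\<alpha> > -1" "\<alpha> \<noteq> 0" "1 + \<alpha> * exp (c * x) > 0" and e: "e > 0"
  shows "eventually (\<lambda>n. measure_pmf.prob (thinning_chain (\<lambda>_. c / real n) 0 n (k n))
            {xs. if \<alpha> < 0 then xs ! k n = 0 else xs ! k n > 0}
          \<le> exp (real n * (ln (1 + \<alpha>) - log_weight_integral \<alpha> (c * x) / c + e))) sequentially"
proof -
  obtain L where L: "c * x < L" "1 + \<alpha> * exp L > 0" using weight_pos_extend[OF \<alpha>(3)] .
  have "(\<lambda>n. ln (1 + \<alpha>) - (\<Sum>j<k n. ln (tilt_weight \<alpha> (log_rate c n) j)) / real n)
      \<longlonglongrightarrow> ln (1 + \<alpha>) - log_weight_integral \<alpha> (c * x) / c"
    by (intro tendsto_intros sum_ln_tilt_weight_tendsto c k x \<alpha>)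
  then have "eventually (\<lambda>n. ln (1 + \<alpha>) - (\<Sum>j<k n. ln (tilt_weight \<alpha> (log_rate c n) j)) / real n
      < ln (1 + \<alpha>) - log_weight_integral \<alpha> (c * x) / c + e) sequentially"
    using e by (intro order_tendstoD(2)) auto
  with eventually_log_rate_range[OF c k L(1)] eventually_real_gt[of c] show ?thesis
  proof eventually_elim
    case (elim n)
    define w where "w = tilt_weight \<alpha> (log_rate c n)"
    have n: "n > 0" "0 \<le> c / real n" "c / real n \<le> 1" using elim c by (auto intro: Nat.gr0I)
    have pos: "w j > 0" if "j \<le> k n" for j
      unfolding w_def tilt_weight_def using elim(1) that by (intro weight_pos[OF \<alpha>(1) L(2)]) auto
    have rec: "w j = c / real n + (1 - c / real n) * w (Suc j)" for j
      unfolding w_def using tilt_weight_rec[of \<alpha> "log_rate c n" j] exp_log_rate(1)[OF elim(2) c] by simp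
    have w0: "w 0 = 1 + \<alpha>" by (simp add: w_def tilt_weight_def)
    have "measure_pmf.prob (thinning_chain (\<lambda>_. c / real n) 0 n (k n))
            {xs. if \<alpha> < 0 then xs ! k n = 0 else xs ! k n > 0} \<le> w 0 ^ n / (\<Prod>j<k n. w j)"
    proof (cases "\<alpha> < 0")
      case True
      have "w j \<le> 1" for j using True by (simp add: w_def tilt_weight_def mult_nonpos_nonneg)
      then show ?thesis
        using chain_prob_extinct_le[OF n(2,3), where k = "k n" and w = w, OF pos _ rec] by (simp only: True if_True)
    next
      case False
      have "w j \<ge> 1" for j using False by (simp add: w_def tilt_weight_def)
      then show ?thesis
        using chain_prob_alive_le[OF n(2,3), where k = "k n" and w = w, OF _ rec] by (simp only: False if_False)
    qed
    also have "\<dots> = exp (real n * (ln (1 + \<alpha>) - (\<Sum>j<k n. ln (w j)) / real n))"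
      unfolding w0 using pos \<alpha> n by (intro weight_ratio_eq_exp) auto
    also have "\<dots> \<le> exp (real n * (ln (1 + \<alpha>) - log_weight_integral \<alpha> (c * x) / c + e))"
      using elim(3) unfolding exp_le_cancel_iff w_def[symmetric] by (intro mult_left_mono) auto
    finally show ?case .
  qed
qed

lemma nat_floor_div_tendsto:
  assumes "t \<longlonglongrightarrow> x" "0 \<le> (x::real)"
  shows "(\<lambda>n. real (nat \<lfloor>t n * real n\<rfloor>) / real n) \<longlonglongrightarrow> x"
proof (rule tendsto_sandwich)
  have inv: "(\<lambda>n. 1 / real n) \<longlonglongrightarrow> 0" by (rule lim_1_over_n)
  show "(\<lambda>n. t n - 1 / real n) \<longlonglongrightarrow> x" using tendsto_diff[OF assms(1) inv] by simp
  show "(\<lambda>n. max 0 (t n)) \<longlonglongrightarrow> x" using tendsto_max[OF tendsto_const[of 0] assms(1)] assms(2) by simp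
  show "eventually (\<lambda>n. t n - 1 / real n \<le> real (nat \<lfloor>t n * real n\<rfloor>) / real n) sequentially"
    using eventually_gt_at_top[of 0]
  proof eventually_elim
    case (elim n)
    have "t n * real n - 1 \<le> real (nat \<lfloor>t n * real n\<rfloor>)" by linarith
    then have "(t n * real n - 1) / real n \<le> real (nat \<lfloor>t n * real n\<rfloor>) / real n"
      by (intro divide_right_mono) auto
    then show ?case using elim by (simp add: diff_divide_distrib)
  qed
  show "eventually (\<lambda>n. real (nat \<lfloor>t n * real n\<rfloor>) / real n \<le> max 0 (t n)) sequentially"
    using eventually_gt_at_top[of 0]
  proof eventually_elim
    case (elim n)
    have "real (nat \<lfloor>t n * real n\<rfloor>) \<le> max 0 (t n * real n)" by linarith
    also have "\<dots> = max 0 (t n) * real n" using elim by (simp add: max_def mult_le_0_iff zero_le_mult_iff)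
    finally show ?case using elim by (simp add: field_simps)
  qed
qed

text \<open>
  With \<open>\<rho> j = exp (lam * j) / w j\<close>, the centered process is at most of order \<open>sqrt n\<close>, by Chebyshev's
  inequality. The constants \<open>\<omega>\<close> and \<open>W\<close> are bounds for the weights, uniform in \<open>n\<close>.
\<close>

lemma tilted_chain_concentration:
  assumes c: "c > 0" and x1: "0 \<le> x1"
    and \<alpha>: "\<alpha> > -1" "\<alpha> \<noteq> 0" "1 + \<alpha> * exp (c * x1) > 0" and gap: "profile_gap c \<alpha> x1 > 0"
    and x: "0 \<le> x" "x \<le> x1" and e: "e > 0" and d: "d > 0"
  shows "eventually (\<lambda>n. measure_pmf.prob
           (thinning_chain (\<lambda>j. c / real n / tilt_weight \<alpha> (log_rate c n) j) 0 n (nat \<lfloor>x1 * real n\<rfloor>))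
           {xs. \<bar>real (xs ! nat \<lfloor>x * real n\<rfloor>) / real n - profile c \<alpha> x\<bar> > e} \<le> d) sequentially"
proof -
  obtain L where L: "c * x1 < L" "1 + \<alpha> * exp L > 0" using weight_pos_extend[OF \<alpha>(3)] .
  define k where "k = (\<lambda>n. nat \<lfloor>x1 * real n\<rfloor>)"
  define i where "i = (\<lambda>n. nat \<lfloor>x * real n\<rfloor>)"
  have k: "(\<lambda>n. real (k n) / real n) \<longlonglongrightarrow> x1" and i: "(\<lambda>n. real (i n) / real n) \<longlonglongrightarrow> x"
    unfolding k_def i_def by (rule nat_floor_div_tendsto[OF tendsto_const], use x1 x in linarith)+
  have ik: "i n \<le> k n" for n
    unfolding i_def k_def using x by (intro nat_mono floor_mono mult_right_mono) auto
  have wx: "1 + \<alpha> * exp (c * x) > 0"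
    using c x by (intro weight_pos[OF \<alpha>(1,3)]) auto
  define \<omega> where "\<omega> = min (1 + \<alpha>) (1 + \<alpha> * exp L)"
  define W where "W = 1 + \<bar>\<alpha>\<bar> * exp L"
  define B where "B = (exp L / \<omega>)\<^sup>2 * c / \<omega>"
  define e' where "e' = e / 2 / W"
  have \<omega>: "\<omega> > 0" using \<alpha> L by (simp add: \<omega>_def)
  have W: "W > 0" unfolding W_def by (intro add_pos_nonneg) auto
  have B: "B \<ge> 0" using c \<omega> by (simp add: B_def)
  have e': "e' > 0" using e W by (simp add: e'_def)
  define r where "r = (\<lambda>n j. real n / (1 + \<alpha>) - (\<Sum>j<j. exp (log_rate c n * real j) / tilt_weight \<alpha> (log_rate c n) j))"
  have rk: "eventually (\<lambda>n. r n (k n) / real n > 0) sequentially"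
    unfolding r_def by (rule order_tendstoD(1)[OF drift_sum_tendsto[OF c k x1 \<alpha>] gap])
  have "(\<lambda>n. tilt_weight \<alpha> (log_rate c n) (i n) / exp (log_rate c n * real (i n)) * (r n (i n) / real n)) \<longlonglongrightarrow> profile c \<alpha> x"
    unfolding profile_def r_def tilt_weight_def[of _ _ "i _"]
    by (intro tendsto_mult tendsto_divide tendsto_add tendsto_const tendsto_exp log_rate_mult_tendsto c i
        drift_sum_tendsto x \<alpha> wx) simp
  then have mean: "eventually (\<lambda>n. \<bar>tilt_weight \<alpha> (log_rate c n) (i n) / exp (log_rate c n * real (i n)) * (r n (i n) / real n) - profile c \<alpha> x\<bar> < e / 2) sequentially"
    using e unfolding tendsto_iff dist_real_def by (meson half_gt_zero)
  have small: "eventually (\<lambda>n. (x1 * B / e'\<^sup>2) * (1 / real n) \<le> d) sequentially"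
  proof -
    have "(\<lambda>n. (x1 * B / e'\<^sup>2) * (1 / real n)) \<longlonglongrightarrow> (x1 * B / e'\<^sup>2) * 0"
      by (intro tendsto_mult tendsto_const lim_1_over_n)
    then have "eventually (\<lambda>n. (x1 * B / e'\<^sup>2) * (1 / real n) < d) sequentially"
      using d by (intro order_tendstoD(2)) auto
    then show ?thesis by eventually_elim simp
  qed
  show ?thesis
    using eventually_log_rate_range[OF c k L(1)] eventually_real_gt[of c] rk mean small
  proof eventually_elim
    case (elim n)
    define lam where "lam = log_rate c n"
    define w where "w = tilt_weight \<alpha> lam"
    define \<rho> where "\<rho> = (\<lambda>j. exp (lam * real j) / w j)"
    have n: "real n > 0" "0 \<le> c / real n" "c / real n \<le> 1" using elim c by auto
    have rng: "lam * real j \<in> {0..L}" if "j \<le> k n" for j using elim(1) that by (simp add: lam_def)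
    have w\<omega>: "w j \<ge> \<omega>" if "j \<le> k n" for j
      unfolding w_def tilt_weight_def \<omega>_def using rng[OF that] by (rule weight_lower_bound)
    have pos: "w j > 0" if "j \<le> k n" for j using w\<omega>[OF that] \<omega> by linarith
    have wW: "w j \<le> W" if "j \<le> k n" for j
    proof -
      have "\<alpha> * exp (lam * real j) \<le> \<bar>\<alpha>\<bar> * exp L" using rng[OF that] by (intro mult_mono) auto
      then show ?thesis by (simp add: w_def tilt_weight_def W_def)
    qed
    have rec: "w j = c / real n + (1 - c / real n) * w (Suc j)" for j
      unfolding w_def lam_def using tilt_weight_rec[of \<alpha> "log_rate c n" j] exp_log_rate(1)[OF elim(2) c] by simp
    have el: "exp (- lam) = 1 - c / real n"
      unfolding lam_def using exp_log_rate(1)[OF elim(2) c] by linarith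
    have \<rho>pos: "\<rho> j > 0" if "j \<le> k n" for j using pos[OF that] by (simp add: \<rho>_def)
    have \<rho>le: "\<rho> j \<le> exp L / \<omega>" if "j \<le> k n" for j
      unfolding \<rho>_def using rng[OF that] w\<omega>[OF that] \<omega> by (intro frac_le) auto
    have \<rho>ge: "1 / W \<le> \<rho> j" if "j \<le> k n" for j
      unfolding \<rho>_def using rng[OF that] wW[OF that] pos[OF that] by (intro frac_le) auto
    have r_eq: "r n j = real n / (1 + \<alpha>) - (\<Sum>j<j. \<rho> j)" for j
      by (simp add: r_def \<rho>_def w_def lam_def)
    have rpos: "r n j \<ge> 0" if "j \<le> k n" for j
    proof -
      have "(\<Sum>j<j. \<rho> j) \<le> (\<Sum>j<k n. \<rho> j)"
        using that \<rho>pos by (intro sum_mono2) (auto intro: less_imp_le)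
      moreover have "r n (k n) > 0" using elim(3) n(1) by (simp add: zero_less_divide_iff)
      ultimately show ?thesis by (simp add: r_eq)
    qed
    define M where "M = thinning_chain (\<lambda>j. c / real n / w j) 0 n (k n)"
    have dev: "measure_pmf.prob M {xs. \<bar>\<rho> (i n) * real (xs ! i n) - r n (i n)\<bar> \<ge> e' * real n}
        \<le> real (k n) * B / (e' * real n)\<^sup>2"
      unfolding M_def
    proof (rule chain_deviation_le)
      show "i n \<le> k n" by (rule ik)
    next
      fix j assume j: "j < k n"
      have "c / real n \<le> w j"
        using rec[of j] pos[of "Suc j"] n(3) j by (simp add: mult_nonneg_nonneg)
      moreover have "w j > 0" using pos[of j] j by simp
      ultimately show "0 \<le> c / real n / w j \<and> c / real n / w j \<le> 1"
        using n(2) by (simp add: divide_le_eq_1_pos divide_nonneg_pos del: divide_divide_eq_left)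
      have "(1 - c / real n / w j) = (1 - c / real n) * w (Suc j) / w j"
        using pos[of j] j rec[of j] by (simp add: field_simps)
      moreover have "exp (lam * real (Suc j)) * (1 - c / real n) = exp (lam * real j)"
        unfolding el[symmetric] exp_add[symmetric] by (simp add: algebra_simps)
      ultimately show "\<rho> (Suc j) * (1 - c / real n / w j) = \<rho> j"
        using pos[of "Suc j"] j by (simp add: \<rho>_def ac_simps)
      show "r n (Suc j) = r n j - \<rho> j" by (simp add: r_eq)
      have "(\<rho> (Suc j))\<^sup>2 \<le> (exp L / \<omega>)\<^sup>2"
        using \<rho>le[of "Suc j"] \<rho>pos[of "Suc j"] j by (intro power_mono) auto
      moreover have "c / w j \<le> c / \<omega>" using w\<omega>[of j] j \<omega> c by (intro divide_left_mono) auto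
      ultimately have "(\<rho> (Suc j))\<^sup>2 * (c / w j) \<le> (exp L / \<omega>)\<^sup>2 * (c / \<omega>)"
        using c pos[of j] j by (intro mult_mono) auto
      then show "real n * (\<rho> (Suc j))\<^sup>2 * (c / real n / w j) \<le> B"
        using n(1) by (simp add: B_def)
    next
      fix j assume "j \<le> k n"
      then show "0 \<le> \<rho> j" "0 \<le> r n j" using \<rho>pos rpos by (auto intro: less_imp_le)
    next
      show "r n 0 = \<rho> 0 * real n" by (simp add: r_eq \<rho>_def w_def tilt_weight_def)
      show "0 \<le> B" by (rule B)
      show "0 < e' * real n" using e' n by simp
    qed
    have "measure_pmf.prob M {xs. \<bar>real (xs ! i n) / real n - profile c \<alpha> x\<bar> > e}
        \<le> measure_pmf.prob M {xs. \<bar>\<rho> (i n) * real (xs ! i n) - r n (i n)\<bar> \<ge> e' * real n}"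
    proof (intro measure_pmf.finite_measure_mono subsetI)
      fix xs assume "xs \<in> {xs. \<bar>real (xs ! i n) / real n - profile c \<alpha> x\<bar> > e}"
      then have "\<bar>real (xs ! i n) / real n - profile c \<alpha> x\<bar> > e" by simp
      moreover have "\<bar>r n (i n) / (\<rho> (i n) * real n) - profile c \<alpha> x\<bar> < e / 2"
        using elim(4) by (simp add: \<rho>_def w_def lam_def mult.commute)
      ultimately have "\<bar>real (xs ! i n) / real n - r n (i n) / (\<rho> (i n) * real n)\<bar> \<ge> e / 2"
        by linarith
      moreover have "real (xs ! i n) / real n - r n (i n) / (\<rho> (i n) * real n)
          = (\<rho> (i n) * real (xs ! i n) - r n (i n)) / (\<rho> (i n) * real n)"
        using \<rho>pos[OF ik] n(1) by (simp add: field_simps)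
      ultimately have "e / 2 * (\<rho> (i n) * real n) \<le> \<bar>\<rho> (i n) * real (xs ! i n) - r n (i n)\<bar>"
        using \<rho>pos[OF ik] n(1) by (simp add: abs_mult pos_le_divide_eq)
      moreover have "e' * real n \<le> e / 2 * (\<rho> (i n) * real n)"
      proof -
        have "e / 2 * (1 / W) \<le> e / 2 * \<rho> (i n)" using \<rho>ge[OF ik] e by (intro mult_left_mono) auto
        then have "e / 2 * (1 / W) * real n \<le> e / 2 * \<rho> (i n) * real n"
          by (rule mult_right_mono) simp
        then show ?thesis by (simp add: e'_def mult.assoc)
      qed
      ultimately show "xs \<in> {xs. \<bar>\<rho> (i n) * real (xs ! i n) - r n (i n)\<bar> \<ge> e' * real n}" by simp
    qed auto
    also note dev
    also have "real (k n) * B / (e' * real n)\<^sup>2 \<le> (x1 * real n) * B / (e' * real n)\<^sup>2"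
    proof -
      have "real (k n) \<le> x1 * real n" unfolding k_def using x1 n(1) by simp
      then show ?thesis using B by (intro divide_right_mono mult_right_mono) auto
    qed
    also have "\<dots> = (x1 * B / e'\<^sup>2) * (1 / real n)"
      using n(1) e' by (simp add: power2_eq_square)
    also note elim(5)
    finally show ?case by (simp only: M_def w_def lam_def i_def k_def)
  qed
qed

text \<open>
  The tilted chain is in the event with probability at least 1/2, a factor that does not affect the
  exponential rate. So the rate is that of the density, evaluated at the end of the time window.
\<close>

lemma chain_tube_lower_bound:
  assumes c: "c > 0" and x1: "0 \<le> x1"
    and \<alpha>: "\<alpha> > -1" "\<alpha> \<noteq> 0" "1 + \<alpha> * exp (c * x1) > 0" and gap: "profile_gap c \<alpha> x1 > 0"
    and G: "finite G" "G \<subseteq> {0..x1}" and e: "e > 0"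
  shows "eventually (\<lambda>n. measure_pmf.prob (thinning_chain (\<lambda>_. c / real n) 0 n (nat \<lfloor>x1 * real n\<rfloor>))
            {xs. (\<forall>x\<in>insert x1 G. \<bar>real (xs ! nat \<lfloor>x * real n\<rfloor>) / real n - profile c \<alpha> x\<bar> \<le> e)
               \<and> xs ! nat \<lfloor>x1 * real n\<rfloor> > 0}
          \<ge> exp (real n * (ln (1 + \<alpha>) - log_weight_integral \<alpha> (c * x1) / c
                 - max 0 (ln (1 + \<alpha> * exp (c * x1))) * (profile c \<alpha> x1 + e) - e))) sequentially"
proof -
  obtain L where L: "c * x1 < L" "1 + \<alpha> * exp L > 0" using weight_pos_extend[OF \<alpha>(3)] .
  define k where "k = (\<lambda>n. nat \<lfloor>x1 * real n\<rfloor>)"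
  define G' where "G' = insert x1 G"
  have G': "finite G'" "G' \<subseteq> {0..x1}" "card G' > 0" using G x1 by (auto simp: G'_def card_gt_0_iff)
  have k: "(\<lambda>n. real (k n) / real n) \<longlonglongrightarrow> x1"
    unfolding k_def by (rule nat_floor_div_tendsto[OF tendsto_const x1])
  have prof: "profile c \<alpha> x1 > 0" using \<alpha>(3) gap by (simp add: profile_def)
  define e' where "e' = min e (profile c \<alpha> x1 / 2)"
  have e': "e' > 0" using e prof by (simp add: e'_def)
  \<comment> \<open>chosen so that the union bound over \<open>G'\<close> leaves probability 1/2\<close>
  define d where "d = 1 / (2 * real (card G'))"
  have d: "d > 0" using G' by (simp add: d_def)
  have conc: "eventually (\<lambda>n. \<forall>x\<in>G'. measure_pmf.prob
           (thinning_chain (\<lambda>j. c / real n / tilt_weight \<alpha> (log_rate c n) j) 0 n (k n))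
           {xs. \<bar>real (xs ! nat \<lfloor>x * real n\<rfloor>) / real n - profile c \<alpha> x\<bar> > e'} \<le> d) sequentially"
    unfolding k_def using G' by (intro eventually_ball_finite ballI tilted_chain_concentration[OF c x1 \<alpha> gap _ _ e' d]) auto
  have wlim: "(\<lambda>n. tilt_weight \<alpha> (log_rate c n) (k n)) \<longlonglongrightarrow> 1 + \<alpha> * exp (c * x1)"
    unfolding tilt_weight_def by (intro tendsto_intros log_rate_mult_tendsto c k)
  define f where "f = (\<lambda>n. ln (1 + \<alpha>) - (\<Sum>j<k n. ln (tilt_weight \<alpha> (log_rate c n) j)) / real n
      - max 0 (ln (tilt_weight \<alpha> (log_rate c n) (k n))) * (profile c \<alpha> x1 + e) - ln 2 * (1 / real n))"
  have "f \<longlonglongrightarrow> ln (1 + \<alpha>) - log_weight_integral \<alpha> (c * x1) / c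
      - max 0 (ln (1 + \<alpha> * exp (c * x1))) * (profile c \<alpha> x1 + e) - ln 2 * 0"
    unfolding f_def using \<alpha>(3)
    by (intro tendsto_intros sum_ln_tilt_weight_tendsto c k x1 \<alpha> wlim lim_1_over_n) auto
  then have f: "eventually (\<lambda>n. f n > ln (1 + \<alpha>) - log_weight_integral \<alpha> (c * x1) / c
      - max 0 (ln (1 + \<alpha> * exp (c * x1))) * (profile c \<alpha> x1 + e) - e) sequentially"
    using e by (intro order_tendstoD(1)) auto
  show ?thesis
    using eventually_log_rate_range[OF c k L(1)] eventually_real_gt[of c] conc f
  proof eventually_elim
    case (elim n)
    define w where "w = tilt_weight \<alpha> (log_rate c n)"
    define A where "A = {xs. (\<forall>x\<in>G'. \<bar>real (xs ! nat \<lfloor>x * real n\<rfloor>) / real n - profile c \<alpha> x\<bar> \<le> e) \<and> xs ! k n > 0}"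
    define M where "M = thinning_chain (\<lambda>j. c / real n / w j) 0 n (k n)"
    have n: "n > 0" "0 \<le> c / real n" "c / real n \<le> 1" using elim c by (auto intro: Nat.gr0I)
    have pos: "w j > 0" if "j \<le> k n" for j
      unfolding w_def tilt_weight_def using elim(1) that by (intro weight_pos[OF \<alpha>(1) L(2)]) auto
    have rec: "w j = c / real n + (1 - c / real n) * w (Suc j)" for j
      unfolding w_def using tilt_weight_rec[of \<alpha> "log_rate c n" j] exp_log_rate(1)[OF elim(2) c] by simp
    have w0: "w 0 = 1 + \<alpha>" by (simp add: w_def tilt_weight_def)
    define Bad where "Bad = (\<lambda>x. {xs. \<bar>real (xs ! nat \<lfloor>x * real n\<rfloor>) / real n - profile c \<alpha> x\<bar> > e'})"
    \<comment> \<open>\<open>e'\<close> is at most half of the profile at \<open>x1\<close>, which keeps the chain alive\<close>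
    have good: "- (\<Union>x\<in>G'. Bad x) \<subseteq> A"
    proof
      fix xs assume "xs \<in> - (\<Union>x\<in>G'. Bad x)"
      then have *: "\<bar>real (xs ! nat \<lfloor>x * real n\<rfloor>) / real n - profile c \<alpha> x\<bar> \<le> e'" if "x \<in> G'" for x
        using that by (auto simp: Bad_def)
      have "\<bar>real (xs ! k n) / real n - profile c \<alpha> x1\<bar> \<le> profile c \<alpha> x1 / 2"
        using *[of x1] by (simp add: G'_def k_def e'_def)
      then have "real (xs ! k n) / real n > 0" using prof by linarith
      then have "xs ! k n > 0" by (cases "xs ! k n = 0") auto
      then show "xs \<in> A" unfolding A_def using * by (fastforce simp: e'_def)
    qed
    have "measure_pmf.prob M (\<Union>x\<in>G'. Bad x) \<le> (\<Sum>x\<in>G'. measure_pmf.prob M (Bad x))"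
      using G' by (intro measure_pmf.finite_measure_subadditive_finite) auto
    also have "\<dots> \<le> (\<Sum>x\<in>G'. d)"
      using elim(3) by (intro sum_mono) (simp add: M_def w_def Bad_def)
    also have "\<dots> = 1 / 2" using G'(3) by (simp add: d_def)
    finally have "measure_pmf.prob M (- (\<Union>x\<in>G'. Bad x)) \<ge> 1 / 2"
      using measure_pmf.prob_compl[of "\<Union>x\<in>G'. Bad x" M] by (simp add: Compl_eq_Diff_UNIV)
    then have half: "measure_pmf.prob M A \<ge> 1 / 2"
      using measure_pmf.finite_measure_mono[OF good, of M] by simp
    have "exp (real n * (ln (1 + \<alpha>) - log_weight_integral \<alpha> (c * x1) / c
                 - max 0 (ln (1 + \<alpha> * exp (c * x1))) * (profile c \<alpha> x1 + e) - e)) \<le> exp (real n * f n)"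
      using elim(4) by (simp add: mult_left_mono)
    also have "exp (real n * f n) = w 0 ^ n / (\<Prod>j<k n. w j) / max 1 (w (k n)) powr ((profile c \<alpha> x1 + e) * real n) * (1 / 2)"
    proof -
      have mx: "max 1 (w (k n)) powr y = exp (y * max 0 (ln (w (k n))))" for y
        using pos[of "k n"] by (auto simp: powr_def max_def)
      have "w 0 ^ n / (\<Prod>j<k n. w j) = exp (real n * (ln (1 + \<alpha>) - (\<Sum>j<k n. ln (w j)) / real n))"
        unfolding w0 using pos \<alpha> n by (intro weight_ratio_eq_exp) auto
      moreover have "1 / 2 = exp (- ln (2::real))" by (simp add: exp_minus inverse_eq_divide)
      ultimately have "w 0 ^ n / (\<Prod>j<k n. w j) / max 1 (w (k n)) powr ((profile c \<alpha> x1 + e) * real n) * (1 / 2)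
         = exp (real n * (ln (1 + \<alpha>) - (\<Sum>j<k n. ln (w j)) / real n)
             - (profile c \<alpha> x1 + e) * real n * max 0 (ln (w (k n))) + - ln 2)"
        unfolding mx exp_add exp_diff by (simp only: times_divide_eq_left)
      also have "\<dots> = exp (real n * f n)"
        using n(1) by (simp add: f_def w_def algebra_simps)
      finally show ?thesis by simp
    qed
    also have "\<dots> \<le> w 0 ^ n / (\<Prod>j<k n. w j) / max 1 (w (k n)) powr ((profile c \<alpha> x1 + e) * real n) * measure_pmf.prob M A"
    proof -
      have "(\<Prod>j<k n. w j) \<ge> 0" using pos by (intro prod_nonneg ballI less_imp_le) auto
      then show ?thesis using half \<alpha>(1)
        by (intro mult_left_mono) (auto simp: w0 intro!: divide_nonneg_nonneg)
    qed
    also have "\<dots> \<le> measure_pmf.prob (thinning_chain (\<lambda>_. c / real n) 0 n (k n)) A"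
      unfolding M_def
    proof (rule chain_prob_ge_tilted[OF n(2,3), where k = "k n" and w = w, OF pos rec])
      fix xs assume xs: "xs \<in> A"
      then have "\<bar>real (xs ! k n) / real n - profile c \<alpha> x1\<bar> \<le> e" by (simp add: A_def G'_def k_def)
      then have "real (xs ! k n) / real n \<le> profile c \<alpha> x1 + e" by linarith
      with xs show "xs ! k n > 0 \<and> real (xs ! k n) \<le> (profile c \<alpha> x1 + e) * real n"
        using n(1) by (simp add: A_def pos_divide_le_eq)
    qed
    finally show ?case by (simp add: A_def k_def G'_def)
  qed
qed

section \<open>The parameter \<open>a\<^sub>s\<close> and the profiles\<close>

definition b_slope :: "real \<Rightarrow> real \<Rightarrow> real" where
  "b_slope c a = exp (c * (1 - 1 / a)) * (1 + c / a)"

lemma b_fun_derivative: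
  assumes "a > 0"
  shows "(b_fun c has_real_derivative b_slope c a) (at a)"
  unfolding b_fun_def b_slope_def using assms
  by (auto intro!: derivative_eq_intros simp: field_simps power2_eq_square)

text \<open>
  Equivalently, \<open>b_fun c\<close> is strictly convex. All properties of \<open>a_param\<close> rest on this.
\<close>

lemma b_slope_strict_mono:
  assumes "c > 0" "0 < x" "x < y"
  shows "b_slope c x < b_slope c y"
proof (rule DERIV_pos_imp_increasing[OF assms(3)])
  fix a assume "x \<le> a" "a \<le> y"
  then have a: "a > 0" using assms by simp
  have "(b_slope c has_real_derivative exp (c * (1 - 1 / a)) * (c\<^sup>2 / a ^ 3)) (at a)"
    unfolding b_slope_def using a
    by (auto intro!: derivative_eq_intros simp: field_simps power2_eq_square power3_eq_cube)
  moreover have "exp (c * (1 - 1 / a)) * (c\<^sup>2 / a ^ 3) > 0" using a assms by simp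
  ultimately show "\<exists>z. (b_slope c has_real_derivative z) (at a) \<and> 0 < z" by blast
qed

text \<open>
  Slope of the chord of \<open>b_fun c\<close> from 1 to \<open>a\<close>. It is the expression under the logarithm in the
  definition of \<open>a_param\<close>.
\<close>

definition b_chord :: "real \<Rightarrow> real \<Rightarrow> real" where
  "b_chord c a = (b_fun c a - 1) / (a - 1)"

lemma b_fun_1 [simp]: "b_fun c 1 = 1"
  by (simp add: b_fun_def)

lemma b_fun_mvt:
  assumes "0 < x" "x < y"
  obtains z where "x < z" "z < y" "b_fun c y - b_fun c x = (y - x) * b_slope c z"
  using MVT2[OF assms(2), of "b_fun c" "b_slope c"] b_fun_derivative assms by force

lemma b_slope_1: "b_slope c 1 = 1 + c"
  by (simp add: b_slope_def)

text \<open>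
  The slope at 1 is \<open>1 + c\<close>, which corresponds to \<open>s_crit c\<close>.
\<close>

lemma b_chord_bounds:
  assumes c: "c > 0" and a: "a > 0"
  shows "a < 1 \<Longrightarrow> b_slope c a < b_chord c a \<and> b_chord c a < 1 + c"
    and "a > 1 \<Longrightarrow> 1 + c < b_chord c a \<and> b_chord c a < b_slope c a"
proof -
  assume "a < 1"
  then obtain z where z: "a < z" "z < 1" "b_fun c 1 - b_fun c a = (1 - a) * b_slope c z"
    using b_fun_mvt[OF a, of 1] by blast
  have "b_chord c a = (b_fun c 1 - b_fun c a) / (1 - a)"
    unfolding b_chord_def b_fun_1 by (metis minus_diff_eq minus_divide_divide)
  then have "b_chord c a = b_slope c z" using z(3) \<open>a < 1\<close> by simp
  then show "b_slope c a < b_chord c a \<and> b_chord c a < 1 + c"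
    using b_slope_strict_mono[OF c, of z 1] b_slope_strict_mono[OF c, of a z] z a b_slope_1 by simp
next
  assume "a > 1"
  then obtain z where z: "1 < z" "z < a" "b_fun c a - b_fun c 1 = (a - 1) * b_slope c z"
    using b_fun_mvt[of 1 a] by auto
  then have "b_chord c a = b_slope c z" using \<open>a > 1\<close> by (simp add: b_chord_def)
  then show "1 + c < b_chord c a \<and> b_chord c a < b_slope c a"
    using b_slope_strict_mono[OF c, of 1 z] b_slope_strict_mono[OF c, of z a] z a b_slope_1 by simp
qed

lemma b_fun_eq_chord: "a \<noteq> 1 \<Longrightarrow> b_fun c a = 1 + b_chord c a * (a - 1)"
  by (simp add: b_chord_def)

lemma b_chord_derivative:
  assumes "a > 0" "a \<noteq> 1"
  shows "(b_chord c has_real_derivative (b_slope c a - b_chord c a) / (a - 1)) (at a)"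
proof -
  have "((\<lambda>a. (b_fun c a - 1) / (a - 1)) has_real_derivative
      (b_slope c a * (a - 1) - (b_fun c a - 1)) / ((a - 1) * (a - 1))) (at a)"
    using assms by (auto intro!: derivative_eq_intros b_fun_derivative)
  moreover have "(b_slope c a * (a - 1) - (b_fun c a - 1)) / ((a - 1) * (a - 1)) = (b_slope c a - b_chord c a) / (a - 1)"
    using assms(2) by (simp add: b_fun_eq_chord flip: left_diff_distrib)
  ultimately show ?thesis unfolding b_chord_def[abs_def] by simp
qed

lemma b_chord_strict_mono:
  assumes c: "c > 0" and "0 < x" "x < y" "x \<noteq> 1" "y \<noteq> 1"
  shows "b_chord c x < b_chord c y"
proof (cases "x < 1 \<and> 1 < y")
  case True
  then show ?thesis using b_chord_bounds[OF c, of x] b_chord_bounds[OF c, of y] assms by force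
next
  case False
  show ?thesis
  proof (rule DERIV_pos_imp_increasing[OF assms(3)])
    fix a assume a: "x \<le> a" "a \<le> y"
    then have "a > 0" "a \<noteq> 1" using False assms by auto
    moreover have "(b_slope c a - b_chord c a) / (a - 1) > 0"
      using b_chord_bounds[OF c \<open>a > 0\<close>] \<open>a \<noteq> 1\<close> by (cases "a < 1") (auto simp: zero_less_divide_iff)
    ultimately show "\<exists>z. (b_chord c has_real_derivative z) (at a) \<and> 0 < z"
      using b_chord_derivative by blast
  qed
qed

lemma b_chord_gt_1:
  assumes c: "c > 0" and a: "a > 0" "a \<noteq> 1"
  shows "b_chord c a > 1"
proof (cases "a < 1")
  case True
  have "c * (1 - 1 / a) < 0" using True a c by (simp add: mult_pos_neg)
  then have "b_fun c a < a" unfolding b_fun_def using a by simp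
  then show ?thesis using True by (simp add: b_chord_def neg_less_divide_eq)
next
  case False
  then show ?thesis using b_chord_bounds(2)[OF c a(1)] a c by force
qed

text \<open>
  The slope has the limits 1, \<open>1 + c\<close> and \<open>exp c\<close> at 0, 1 and infinity, and is continuous in between.
\<close>

lemma b_chord_attains:
  assumes c: "c > 0" and T: "1 < T" "T < exp c" "T \<noteq> 1 + c"
  obtains a where "a > 0" "a \<noteq> 1" "b_chord c a = T"
proof -
  have cont: "continuous_on S (b_chord c)" if "S \<subseteq> {0<..} - {1}" for S
    using that by (intro continuous_at_imp_continuous_on ballI DERIV_isCont[OF b_chord_derivative]) auto
  have lim1: "((\<lambda>a. (b_fun c a - b_fun c 1) / (a - 1)) \<longlongrightarrow> 1 + c) (at 1)"
    using b_fun_derivative[of 1 c] unfolding has_field_derivative_iff b_slope_1 by simp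
  then have L1: "(b_chord c \<longlongrightarrow> 1 + c) (at_left 1)" and R1: "(b_chord c \<longlongrightarrow> 1 + c) (at_right 1)"
    by (simp_all add: b_chord_def[abs_def] filterlim_at_split)
  show ?thesis
  proof (cases "T < 1 + c")
    case True
    have "((\<lambda>a. (a * exp (c * (1 - 1 / a)) - 1) / (a - 1)) \<longlongrightarrow> 1) (at_right 0)"
      using c by real_asymp
    from order_tendstoD(2)[OF this T(1)] have "eventually (\<lambda>a. b_chord c a < T) (at_right 0)"
      unfolding b_chord_def b_fun_def .
    then have "eventually (\<lambda>a. b_chord c a < T \<and> 0 < a \<and> a < 1) (at_right 0)"
      using eventually_at_right_less[of "0::real"] eventually_at_right_real[of 0 1]
      by (auto elim: eventually_elim2)
    then obtain a0 where a0: "b_chord c a0 < T" "0 < a0" "a0 < 1"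
      using eventually_happens[of _ "at_right (0::real)"] by (auto simp: trivial_limit_at_right_real)
    have "eventually (\<lambda>a. b_chord c a > T \<and> a \<in> {a0<..<1}) (at_left 1)"
      using order_tendstoD(1)[OF L1 True] eventually_at_left_real[OF a0(3)] by eventually_elim simp
    then obtain a1 where a1: "b_chord c a1 > T" "a0 < a1" "a1 < 1"
      using eventually_happens[of _ "at_left (1::real)"] by (auto simp: trivial_limit_at_left_real)
    obtain a where "a0 \<le> a" "a \<le> a1" "b_chord c a = T"
      using IVT'[of "b_chord c" a0 T a1] a0 a1 cont[of "{a0..a1}"] by fastforce
    with that[of a] a0 a1 show ?thesis by simp
  next
    case False
    have "((\<lambda>a. (a * exp (c * (1 - 1 / a)) - 1) / (a - 1)) \<longlongrightarrow> exp c) at_top"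
      using c by real_asymp
    from order_tendstoD(1)[OF this T(2)] have "eventually (\<lambda>a. b_chord c a > T) at_top"
      unfolding b_chord_def b_fun_def .
    then have "eventually (\<lambda>a. b_chord c a > T \<and> a > 1) at_top"
      using eventually_gt_at_top[of "1::real"] by eventually_elim simp
    then obtain a1 where a1: "b_chord c a1 > T" "a1 > 1"
      using eventually_happens[of _ "at_top :: real filter"] by auto
    have "eventually (\<lambda>a. b_chord c a < T \<and> a \<in> {1<..<a1}) (at_right 1)"
      using order_tendstoD(2)[OF R1, of T] False T(3) eventually_at_right_real[OF a1(2)]
      by (auto elim: eventually_elim2)
    then obtain a0 where a0: "b_chord c a0 < T" "1 < a0" "a0 < a1"
      using eventually_happens[of _ "at_right (1::real)"] by (auto simp: trivial_limit_at_right_real)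
    obtain a where "a0 \<le> a" "a \<le> a1" "b_chord c a = T"
      using IVT'[of "b_chord c" a0 T a1] a0 a1 cont[of "{a0..a1}"] by fastforce
    with that[of a] a0 a1 show ?thesis by simp
  qed
qed

text \<open>
  The time at which the profile with parameter \<open>\<alpha>\<close> reaches 0. It inverts \<open>s \<mapsto> a_param c s - 1\<close>.
\<close>

definition end_time :: "real \<Rightarrow> real \<Rightarrow> real" where
  "end_time c \<alpha> = ln (b_chord c (1 + \<alpha>)) / c"

lemma exp_end_time:
  assumes "c > 0" "\<alpha> > -1" "\<alpha> \<noteq> 0"
  shows "exp (c * end_time c \<alpha>) = b_chord c (1 + \<alpha>)" "end_time c \<alpha> > 0"
    "1 + \<alpha> * exp (c * end_time c \<alpha>) = b_fun c (1 + \<alpha>)"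
proof -
  have "b_chord c (1 + \<alpha>) > 1" using assms by (intro b_chord_gt_1) auto
  then show "exp (c * end_time c \<alpha>) = b_chord c (1 + \<alpha>)" "end_time c \<alpha> > 0"
    using assms(1) by (simp_all add: end_time_def)
  then show "1 + \<alpha> * exp (c * end_time c \<alpha>) = b_fun c (1 + \<alpha>)"
    using assms(3) b_fun_eq_chord[of "1 + \<alpha>" c] by simp
qed

lemma end_time_strict_mono:
  assumes "c > 0" "-1 < \<alpha>" "\<alpha> < \<beta>" "\<alpha> \<noteq> 0" "\<beta> \<noteq> 0"
  shows "end_time c \<alpha> < end_time c \<beta>"
proof -
  have "b_chord c (1 + \<alpha>) < b_chord c (1 + \<beta>)" using assms by (intro b_chord_strict_mono) auto
  moreover have "b_chord c (1 + \<alpha>) > 1" using assms by (intro b_chord_gt_1) auto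
  ultimately show ?thesis using assms(1) by (simp add: end_time_def divide_strict_right_mono)
qed

lemma isCont_end_time:
  assumes "c > 0" "\<alpha> > -1" "\<alpha> \<noteq> 0"
  shows "isCont (end_time c) \<alpha>"
proof -
  have "b_chord c (1 + \<alpha>) > 1" using assms by (intro b_chord_gt_1) auto
  moreover have "isCont (\<lambda>\<alpha>. b_chord c (1 + \<alpha>)) \<alpha>"
    using assms DERIV_isCont[OF b_chord_derivative[of "1 + \<alpha>" c]]
    by (intro isCont_o2[of _ "\<lambda>\<alpha>. 1 + \<alpha>" "b_chord c"]) (auto intro!: continuous_intros)
  ultimately show ?thesis
    using assms(1) unfolding end_time_def[abs_def] by (intro continuous_intros) auto
qed

lemma a_param_properties:
  assumes c: "c > 0" and s: "0 < s" "s < 1" "s \<noteq> s_crit c"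
  shows "a_param c s > 0" "a_param c s \<noteq> 1" "end_time c (a_param c s - 1) = s"
    "a_param c s < 1 \<longleftrightarrow> s < s_crit c"
proof -
  let ?P = "\<lambda>a. a > 0 \<and> a \<noteq> 1 \<and> s = 1 / c * ln ((b_fun c a - 1) / (a - 1))"
  have eq: "?P a \<longleftrightarrow> a > 0 \<and> a \<noteq> 1 \<and> b_chord c a = exp (c * s)" for a
  proof -
    have "s = 1 / c * ln (b_chord c a) \<longleftrightarrow> b_chord c a = exp (c * s)" if "a > 0" "a \<noteq> 1"
      using b_chord_gt_1[OF c that] c by (auto simp: field_simps)
    then show ?thesis unfolding b_chord_def by blast
  qed
  have ne: "exp (c * s) \<noteq> 1 + c"
  proof
    assume "exp (c * s) = 1 + c"
    then have "c * s = ln (1 + c)" by (metis ln_exp)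
    then show False using s(3) c by (simp add: s_crit_def field_simps)
  qed
  have "\<exists>!a. ?P a"
    unfolding eq
  proof (rule ex_ex1I)
    show "\<exists>a>0. a \<noteq> 1 \<and> b_chord c a = exp (c * s)"
      using b_chord_attains[OF c, of "exp (c * s)"] c s ne by auto
    fix a a' assume "a > 0 \<and> a \<noteq> 1 \<and> b_chord c a = exp (c * s)" "a' > 0 \<and> a' \<noteq> 1 \<and> b_chord c a' = exp (c * s)"
    then show "a = a'"
      using b_chord_strict_mono[OF c, of a a'] b_chord_strict_mono[OF c, of a' a] by (cases a a' rule: linorder_cases) auto
  qed
  from theI'[OF this] have P: "?P (a_param c s)" unfolding a_param_def .
  then show a: "a_param c s > 0" "a_param c s \<noteq> 1" by auto
  show "end_time c (a_param c s - 1) = s" using P by (simp add: end_time_def b_chord_def)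
  have "exp (c * s) < 1 + c \<longleftrightarrow> s < s_crit c"
  proof -
    have "exp (c * s) < 1 + c \<longleftrightarrow> c * s < ln (1 + c)" using c by (metis add_pos_pos exp_ln_iff exp_less_cancel_iff zero_less_one)
    then show ?thesis using c by (simp add: s_crit_def field_simps)
  qed
  moreover have "b_chord c (a_param c s) = exp (c * s)" using P eq by blast
  ultimately show "a_param c s < 1 \<longleftrightarrow> s < s_crit c"
    using b_chord_bounds[OF c a(1)] a by force
qed

lemma profile_domain:
  assumes "c > 0" "\<alpha> > -1" "\<alpha> \<noteq> 0" "x \<in> {0..end_time c \<alpha>}"
  shows "1 + \<alpha> * exp (c * x) > 0"
proof -
  have "b_fun c (1 + \<alpha>) > 0" using assms(2) by (simp add: b_fun_def)
  then have "1 + \<alpha> * exp (c * end_time c \<alpha>) > 0" using exp_end_time(3)[OF assms(1-3)] by simp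
  then show ?thesis by (rule weight_pos[OF assms(2)]) (use assms in auto)
qed

lemma profile_gap_end: 
  assumes "c > 0" "\<alpha> > -1" "\<alpha> \<noteq> 0"
  shows "profile_gap c \<alpha> (end_time c \<alpha>) = 0"
proof -
  have "b_fun c (1 + \<alpha>) / (1 + \<alpha>) = exp (c * (1 - 1 / (1 + \<alpha>)))"
    using assms(2) by (simp add: b_fun_def)
  moreover have "1 - 1 / (1 + \<alpha>) = \<alpha> / (1 + \<alpha>)" using assms(2) by (simp add: field_simps)
  ultimately show ?thesis
    unfolding profile_gap_def exp_end_time(3)[OF assms] using assms by simp
qed

lemma profile_gap_derivative:
  assumes "c > 0" "\<alpha> > -1" "\<alpha> \<noteq> 0" "1 + \<alpha> * exp (c * x) > 0"
  shows "(profile_gap c \<alpha> has_real_derivative - (exp (c * x) / (1 + \<alpha> * exp (c * x)))) (at x)"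
proof -
  let ?E = "exp (c * x)" and ?A = "1 + \<alpha>"
  have "((\<lambda>x. (1 + \<alpha> * exp (c * x)) / ?A) has_real_derivative \<alpha> * (c * ?E) / ?A) (at x)"
    using assms by (auto intro!: derivative_eq_intros)
  then have "((\<lambda>x. ln ((1 + \<alpha> * exp (c * x)) / ?A)) has_real_derivative
      1 / ((1 + \<alpha> * ?E) / ?A) * (\<alpha> * (c * ?E) / ?A)) (at x)"
    using assms by (intro DERIV_chain2[OF DERIV_ln_divide]) simp_all
  then have deriv: "(profile_gap c \<alpha> has_real_derivative
      0 - 1 / ((1 + \<alpha> * ?E) / ?A) * (\<alpha> * (c * ?E) / ?A) / (c * \<alpha>)) (at x)"
    unfolding profile_gap_def[abs_def] by (intro DERIV_diff DERIV_const DERIV_cdivide)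
  have "0 - 1 / (D / A) * (\<alpha> * (c * E) / A) / (c * \<alpha>) = - (E / D)"
    if "A \<noteq> 0" "D \<noteq> 0" for A D E
    using that assms by simp
  from this[of ?A "1 + \<alpha> * ?E" ?E] show ?thesis using deriv assms by (simp only:)
qed

lemma profile_gap_strict_antimono:
  assumes c: "c > 0" "\<alpha> > -1" "\<alpha> \<noteq> 0" and "0 \<le> x" "x < y" "y \<le> end_time c \<alpha>"
  shows "profile_gap c \<alpha> y < profile_gap c \<alpha> x"
proof (rule DERIV_neg_imp_decreasing[OF assms(5)])
  fix z assume "x \<le> z" "z \<le> y"
  then have "1 + \<alpha> * exp (c * z) > 0" using assms by (intro profile_domain) auto
  with profile_gap_derivative[OF c this]
  show "\<exists>d. (profile_gap c \<alpha> has_real_derivative d) (at z) \<and> d < 0"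
    by (intro exI[of _ "- (exp (c * z) / (1 + \<alpha> * exp (c * z)))"]) simp
qed

lemma profile_gap_pos:
  assumes "c > 0" "\<alpha> > -1" "\<alpha> \<noteq> 0" "0 \<le> x" "x < end_time c \<alpha>"
  shows "profile_gap c \<alpha> x > 0"
  using profile_gap_strict_antimono[OF assms order_refl] profile_gap_end[OF assms(1-3)] by simp

lemma profile_gap_nonneg:
  assumes "c > 0" "\<alpha> > -1" "\<alpha> \<noteq> 0" "x \<in> {0..end_time c \<alpha>}"
  shows "profile_gap c \<alpha> x \<ge> 0"
  using profile_gap_pos[of c \<alpha> x] profile_gap_end[of c \<alpha>] assms by (cases "x = end_time c \<alpha>") (auto simp: less_imp_le)

text \<open>
  Writing the profile as \<open>(exp (- c x) + \<alpha>) * profile_gap\<close>, the derivative of the second factor contributes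
  exactly \<open>- 1\<close>.
\<close>

lemma profile_derivative:
  assumes "c > 0" "\<alpha> > -1" "\<alpha> \<noteq> 0" "1 + \<alpha> * exp (c * x) > 0"
  shows "(profile c \<alpha> has_real_derivative - 1 - c * profile_gap c \<alpha> x / exp (c * x)) (at x)"
proof -
  let ?E = "exp (c * x)" and ?g = "profile_gap c \<alpha> x"
  have eq: "profile c \<alpha> = (\<lambda>x. (exp (- (c * x)) + \<alpha>) * profile_gap c \<alpha> x)"
    by (simp add: fun_eq_iff profile_def exp_minus field_simps)
  have deriv: "(profile c \<alpha> has_real_derivative - c * exp (- (c * x)) * ?g
      + - (?E / (1 + \<alpha> * ?E)) * (exp (- (c * x)) + \<alpha>)) (at x)"
    unfolding eq by (rule DERIV_mult[OF _ profile_gap_derivative[OF assms]])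
      (auto intro!: derivative_eq_intros)
  have alg: "- c * e * g + - (E / D) * (e + \<alpha>) = - 1 - c * g / E"
    if "E \<noteq> 0" "D \<noteq> 0" "e = 1 / E" "D = 1 + \<alpha> * E" for e E D g
  proof -
    have "(E / D) * (e + \<alpha>) = (E * e + \<alpha> * E) / D" by (simp add: algebra_simps add_divide_distrib)
    also have "E * e = 1" using that(1,3) by simp
    also have "(1 + \<alpha> * E) / D = 1" unfolding that(4)[symmetric] using that(2) by simp
    finally have one: "E / D * (e + \<alpha>) = 1" .
    show ?thesis by (simp only: mult_minus_left one) (simp add: that(3))
  qed
  have "- c * exp (- (c * x)) * ?g + - (?E / (1 + \<alpha> * ?E)) * (exp (- (c * x)) + \<alpha>) = - 1 - c * ?g / ?E"
    by (rule alg) (use assms(4) in \<open>auto simp: exp_minus inverse_eq_divide\<close>)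
  with deriv show ?thesis by (simp only:)
qed

lemma profile_strict_antimono:
  assumes c: "c > 0" "\<alpha> > -1" "\<alpha> \<noteq> 0"
  shows "strict_antimono_on {0..end_time c \<alpha>} (profile c \<alpha>)"
proof (rule monotone_onI)
  fix x y assume xy: "x \<in> {0..end_time c \<alpha>}" "y \<in> {0..end_time c \<alpha>}" "x < y"
  show "profile c \<alpha> y < profile c \<alpha> x"
  proof (rule DERIV_neg_imp_decreasing[OF xy(3)])
    fix z assume "x \<le> z" "z \<le> y"
    then have z: "z \<in> {0..end_time c \<alpha>}" using xy by auto
    have "c * profile_gap c \<alpha> z / exp (c * z) \<ge> 0" using profile_gap_nonneg[OF c z] c by simp
    then show "\<exists>d. (profile c \<alpha> has_real_derivative d) (at z) \<and> d < 0"
      by (intro exI[of _ "- 1 - c * profile_gap c \<alpha> z / exp (c * z)"] conjI profile_derivative c profile_domain z) linarith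
  qed
qed

lemma profile_0 [simp]: "\<alpha> > -1 \<Longrightarrow> profile c \<alpha> 0 = 1"
  by (simp add: profile_def profile_gap_def)

lemma profile_end: "c > 0 \<Longrightarrow> \<alpha> > -1 \<Longrightarrow> \<alpha> \<noteq> 0 \<Longrightarrow> profile c \<alpha> (end_time c \<alpha>) = 0"
  by (simp add: profile_def profile_gap_end)

lemma profile_continuous_on:
  assumes c: "c > 0" "\<alpha> > -1" "\<alpha> \<noteq> 0"
  shows "continuous_on {0..end_time c \<alpha>} (profile c \<alpha>)"
  by (intro continuous_at_imp_continuous_on ballI DERIV_isCont[OF profile_derivative] c profile_domain)

lemma y_hat_eq_profile: "y_hat c s = profile c (a_param c s - 1)"
  by (simp add: fun_eq_iff y_hat_def profile_def profile_gap_def Let_def)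

text \<open>
  The function \<open>\<ell>\<close>, with \<open>\<alpha>\<close> as parameter.
\<close>

definition cost_rate :: "real \<Rightarrow> real \<Rightarrow> real \<Rightarrow> real" where
  "cost_rate c \<alpha> x = c * profile_gap c \<alpha> x / exp (c * x) * (ln (1 + \<alpha> * exp (c * x)) - \<alpha> * exp (c * x))"

lemma poisson_rate_ge: "ereal (\<theta> * \<xi> - lam * (exp \<theta> - 1)) \<le> poisson_rate lam \<xi>"
  unfolding poisson_rate_def by (rule SUP_upper) simp

text \<open>
  By convexity of the exponential function, \<open>\<theta>\<close> itself maximises at the value \<open>lam * exp \<theta>\<close>. This form
  covers \<open>lam = 0\<close>, which occurs at the end point.
\<close>

lemma poisson_rate_eq:
  assumes "lam \<ge> 0"
  shows "poisson_rate lam (lam * exp \<theta>) = ereal (\<theta> * (lam * exp \<theta>) - lam * (exp \<theta> - 1))"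
proof (rule antisym[OF _ poisson_rate_ge])
  show "poisson_rate lam (lam * exp \<theta>) \<le> ereal (\<theta> * (lam * exp \<theta>) - lam * (exp \<theta> - 1))"
    unfolding poisson_rate_def
  proof (rule SUP_least)
    fix \<eta> :: real
    have "lam * exp \<theta> * (1 + (\<eta> - \<theta>)) \<le> lam * exp \<theta> * exp (\<eta> - \<theta>)"
      using assms by (intro mult_left_mono exp_ge_add_one_self) auto
    also have "\<dots> = lam * exp \<eta>" by (simp add: exp_diff)
    finally show "ereal (\<eta> * (lam * exp \<theta>) - lam * (exp \<eta> - 1)) \<le> ereal (\<theta> * (lam * exp \<theta>) - lam * (exp \<theta> - 1))"
      by (simp add: algebra_simps)
  qed
qed

text \<open>
  The dual variable along the profile is \<open>- ln (1 + \<alpha> * exp (c * x))\<close>.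
\<close>

lemma local_cost_profile:
  assumes c: "c > 0" "\<alpha> > -1" "\<alpha> \<noteq> 0" and x: "x \<in> {0..end_time c \<alpha>}"
  shows "local_cost c (profile c \<alpha> x) (- 1 - c * profile_gap c \<alpha> x / exp (c * x)) = ereal (- cost_rate c \<alpha> x)"
proof -
  define D where "D = 1 + \<alpha> * exp (c * x)"
  define z where "z = c * profile_gap c \<alpha> x / exp (c * x)"
  have D: "D > 0" unfolding D_def by (rule profile_domain[OF c x])
  have z: "z \<ge> 0" using profile_gap_nonneg[OF c x] c by (simp add: z_def)
  have y: "c * profile c \<alpha> x = z * D" by (simp add: profile_def z_def D_def)
  have eD: "exp (- ln D) = 1 / D" using D by (simp add: exp_minus inverse_eq_divide)
  have "local_cost c (profile c \<alpha> x) (- 1 - z) = poisson_rate (z * D) (z * D * exp (- ln D))"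
    using D by (simp add: local_cost_def y eD)
  also have "\<dots> = ereal (- ln D * (z * D * exp (- ln D)) - z * D * (exp (- ln D) - 1))"
    using z D by (intro poisson_rate_eq) simp
  also have "- ln D * (z * D * exp (- ln D)) - z * D * (exp (- ln D) - 1) = - (z * (ln D - (D - 1)))"
    unfolding eD using D by (simp add: field_simps)
  also have "z * (ln D - (D - 1)) = cost_rate c \<alpha> x"
    by (simp add: cost_rate_def z_def D_def)
  finally show ?thesis by (simp add: z_def)
qed

lemma cost_rate_nonpos:
  assumes c: "c > 0" "\<alpha> > -1" "\<alpha> \<noteq> 0" and x: "x \<in> {0..end_time c \<alpha>}"
  shows "cost_rate c \<alpha> x \<le> 0"
proof -
  have "ln (1 + \<alpha> * exp (c * x)) \<le> \<alpha> * exp (c * x)"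
    using ln_le_minus_one[OF profile_domain[OF c x]] by simp
  then show ?thesis unfolding cost_rate_def
    using profile_gap_nonneg[OF c x] c by (intro mult_nonneg_nonpos) auto
qed

lemma ell_eq_cost_rate:
  assumes c: "c > 0" "a_param c s > 0" "a_param c s \<noteq> 1" and s: "end_time c (a_param c s - 1) = s" and x: "x \<in> {0..s}"
  shows "ell c s x = cost_rate c (a_param c s - 1) x"
proof -
  define \<alpha> where "\<alpha> = a_param c s - 1"
  have \<alpha>: "\<alpha> > -1" "\<alpha> \<noteq> 0" "end_time c \<alpha> = s" using c s by (auto simp: \<alpha>_def)
  have x': "x \<in> {0..end_time c \<alpha>}" using x \<alpha>(3) by simp
  define D where "D = 1 + \<alpha> * exp (c * x)"
  define z where "z = c * profile_gap c \<alpha> x / exp (c * x)"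
  have D: "D > 0" unfolding D_def by (rule profile_domain[OF c(1) \<alpha>(1,2) x'])
  have y': "1 + deriv (y_hat c s) x = - z"
    using DERIV_imp_deriv[OF profile_derivative[OF c(1) \<alpha>(1,2) profile_domain[OF c(1) \<alpha>(1,2) x']]]
    unfolding y_hat_eq_profile \<alpha>_def[symmetric] z_def by simp
  have y: "c * y_hat c s x = z * D"
    unfolding y_hat_eq_profile \<alpha>_def[symmetric] by (simp add: profile_def z_def D_def)
  have "ell c s x = z * (ln D - (D - 1))"
    unfolding ell_def Let_def y y' by (cases "z = 0") (simp_all add: algebra_simps)
  also have "\<dots> = cost_rate c \<alpha> x" by (simp add: cost_rate_def z_def D_def)
  finally show ?thesis by (simp add: \<alpha>_def)
qed

lemma cost_rate_alt:
  assumes "c > 0" "a > 0" "a \<noteq> 1"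
  shows "cost_rate c (a - 1) x = (ln ((1 + (a - 1) * exp (c * x)) / a) - c * (a - 1) / a) *
         (1 - ln (1 + (a - 1) * exp (c * x)) / ((a - 1) * exp (c * x)))"
  unfolding cost_rate_def profile_gap_def using assms by (simp add: field_simps)

text \<open>
  Integration by parts: \<open>- cost_rate\<close> is the derivative of \<open>ln W * profile\<close> plus \<open>ln W\<close>, where
  \<open>W = 1 + \<alpha> * exp (c * x)\<close>. The boundary term at the end vanishes with the profile.
\<close>

lemma cost_rate_has_integral:
  assumes c: "c > 0" "\<alpha> > -1" "\<alpha> \<noteq> 0"
  shows "(cost_rate c \<alpha> has_integral ln (1 + \<alpha>) - log_weight_integral \<alpha> (c * end_time c \<alpha>) / c) {0..end_time c \<alpha>}"
proof -
  let ?s = "end_time c \<alpha>"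
  \<comment> \<open>the antiderivative found by parts\<close>
  define F where "F = (\<lambda>x. - (ln (1 + \<alpha> * exp (c * x)) * profile c \<alpha> x) - log_weight_integral \<alpha> (c * x) / c)"
  have s: "?s > 0" by (rule exp_end_time(2)[OF c])
  have F: "(F has_real_derivative cost_rate c \<alpha> x) (at x within {0..?s})" if x: "x \<in> {0..?s}" for x
  proof -
    note D = profile_domain[OF c x]
    have L: "1 + \<alpha> * exp (c * ?s) > 0" using s by (intro profile_domain c) auto
    have im: "(*) c ` {0..?s} = {0..c * ?s}" using c(1) by (simp add: image_mult_atLeastAtMost)
    have "(log_weight_integral \<alpha> has_real_derivative ln (1 + \<alpha> * exp (c * x))) (at (c * x) within (*) c ` {0..?s})"
      unfolding im by (rule log_weight_integral_derivative[OF c(2) L]) (use x c in auto)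
    from DERIV_image_chain[OF this, of c]
    have 1: "((\<lambda>x. log_weight_integral \<alpha> (c * x)) has_real_derivative ln (1 + \<alpha> * exp (c * x)) * c) (at x within {0..?s})"
      by (simp add: o_def)
    have 2: "((\<lambda>x. ln (1 + \<alpha> * exp (c * x)) * profile c \<alpha> x) has_real_derivative
        \<alpha> * (c * exp (c * x)) / (1 + \<alpha> * exp (c * x)) * profile c \<alpha> x
        + ln (1 + \<alpha> * exp (c * x)) * (- 1 - c * profile_gap c \<alpha> x / exp (c * x))) (at x within {0..?s})"
      using D by (auto intro!: derivative_eq_intros has_field_derivative_at_within[OF profile_derivative[OF c D]])
    have "(F has_real_derivative - (\<alpha> * (c * exp (c * x)) / (1 + \<alpha> * exp (c * x)) * profile c \<alpha> x
        + ln (1 + \<alpha> * exp (c * x)) * (- 1 - c * profile_gap c \<alpha> x / exp (c * x)))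
        - ln (1 + \<alpha> * exp (c * x)) * c / c) (at x within {0..?s})"
      unfolding F_def by (intro DERIV_diff DERIV_minus DERIV_cdivide 1 2)
    moreover have "- (\<alpha> * (c * exp (c * x)) / (1 + \<alpha> * exp (c * x)) * profile c \<alpha> x
        + ln (1 + \<alpha> * exp (c * x)) * (- 1 - c * profile_gap c \<alpha> x / exp (c * x)))
        - ln (1 + \<alpha> * exp (c * x)) * c / c = cost_rate c \<alpha> x"
    proof -
      have "- (\<alpha> * (c * E) / W * (W / E * g) + l * (- 1 - c * g / E)) - l * c / c = c * g / E * (l - \<alpha> * E)"
        if "E > 0" "W > 0" for E W g l
        using that c(1) by (simp add: field_simps)
      from this[OF exp_gt_zero D] show ?thesis
        unfolding profile_def cost_rate_def .
    qed
    ultimately show ?thesis by simp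
  qed
  have "(cost_rate c \<alpha> has_integral F ?s - F 0) {0..?s}"
    using F s by (intro fundamental_theorem_of_calculus)
      (auto simp: has_real_derivative_iff_has_vector_derivative[symmetric])
  moreover have "F ?s - F 0 = ln (1 + \<alpha>) - log_weight_integral \<alpha> (c * ?s) / c"
    using c by (simp add: F_def profile_end)
  ultimately show ?thesis by simp
qed

section \<open>The cost of a trajectory\<close>

lemmas absolutely_integrable_imp_integrable = set_lebesgue_integral_eq_integral(1)

lemma has_densityD:
  assumes "has_density s y g" "0 \<le> a" "a \<le> b" "b \<le> s"
  shows "g absolutely_integrable_on {a..b}" "integral {a..b} g = y b - y a"
proof -
  have g: "g absolutely_integrable_on {0..s}" using assms(1) by (simp add: has_density_def)
  show ga: "g absolutely_integrable_on {a..b}"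
    by (rule absolutely_integrable_on_subinterval[OF g]) (use assms in auto)
  have "g absolutely_integrable_on {0..b}"
    by (rule absolutely_integrable_on_subinterval[OF g]) (use assms in auto)
  from absolutely_integrable_imp_integrable[OF this]
  have "integral {0..a} g + integral {a..b} g = integral {0..b} g"
    using assms by (intro Henstock_Kurzweil_Integration.integral_combine)
  moreover have "\<forall>x\<in>{0..s}. y x = y 0 + integral {0..x} g"
    using assms(1) by (rule conjunct2[OF has_density_def[THEN iffD1]])
  then have "y a = y 0 + integral {0..a} g" "y b = y 0 + integral {0..b} g"
    by (rule bspec, use assms in simp)+
  ultimately show "integral {a..b} g = y b - y a" by linarith
qed

lemma has_density_integrable: "has_density s y g \<Longrightarrow> g absolutely_integrable_on {0..s}"
  unfolding has_density_def by blast

lemma has_density_continuous: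
  assumes "has_density s y g"
  shows "continuous_on {0..s} y"
proof -
  have "g absolutely_integrable_on {0..s}" using assms by (simp add: has_density_def)
  from absolutely_integrable_imp_integrable[OF this]
  have "continuous_on {0..s} (\<lambda>x. y 0 + integral {0..x} g)"
    by (intro continuous_intros indefinite_integral_continuous_1)
  then show ?thesis
    by (rule continuous_on_eq) (use assms in \<open>unfold has_density_def, metis\<close>)
qed

lemma continuous_times_density:
  fixes f :: "real \<Rightarrow> real"
  assumes "continuous_on {a..b} f" "g absolutely_integrable_on {a..b}"
  shows "(\<lambda>x. f x * g x) absolutely_integrable_on {a..b}"
  using assms
  by (intro absolutely_integrable_bounded_measurable_product_real
      continuous_imp_measurable_on_sets_lebesgue)
    (auto intro: compact_imp_bounded compact_continuous_image)

text \<open>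
  On a short interval \<open>[a, b]\<close> both sides differ from \<open>\<phi> (y a) * (y b - y a)\<close> by at most a small multiple
  of the integral of \<open>\<bar>g\<bar>\<close>. Adding up over a partition gives the claim, without any almost everywhere
  differentiation.
\<close>

lemma absolutely_continuous_chain_rule:
  assumes s: "0 \<le> s" and y: "has_density s y g" and im: "y ` {0..s} \<subseteq> {l..u}"
    and \<phi>: "continuous_on {l..u} \<phi>"
    and \<Phi>: "\<And>v. v \<in> {l..u} \<Longrightarrow> (\<Phi> has_real_derivative \<phi> v) (at v within {l..u})"
  shows "(\<lambda>x. \<phi> (y x) * g x) absolutely_integrable_on {0..s}"
    and "integral {0..s} (\<lambda>x. \<phi> (y x) * g x) = \<Phi> (y s) - \<Phi> (y 0)"
proof -
  have g: "g absolutely_integrable_on {0..s}" using y by (simp add: has_density_def)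
  have yc: "continuous_on {0..s} y" by (rule has_density_continuous[OF y])
  have \<phi>y: "continuous_on {0..s} (\<lambda>x. \<phi> (y x))"
    by (rule continuous_on_compose2[OF \<phi> yc im])
  show int: "(\<lambda>x. \<phi> (y x) * g x) absolutely_integrable_on {0..s}"
    by (rule continuous_times_density[OF \<phi>y g])
  define F where "F = (\<lambda>x. integral {0..x} (\<lambda>x. \<phi> (y x) * g x) - \<Phi> (y x))"
  define G where "G = (\<lambda>x. integral {0..x} (\<lambda>x. \<bar>g x\<bar>))"
  have local: "\<exists>d>0. \<forall>a b. 0 \<le> a \<and> a \<le> b \<and> b \<le> s \<and> b - a < d \<longrightarrow> \<bar>F b - F a\<bar> \<le> e * (G b - G a)"
    if e: "e > 0" for e
  proof -
    have "uniformly_continuous_on {l..u} \<phi>" by (rule compact_uniformly_continuous[OF \<phi>]) simp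
    then obtain d1 where d1: "d1 > 0"
      "\<And>v w. v \<in> {l..u} \<Longrightarrow> w \<in> {l..u} \<Longrightarrow> \<bar>v - w\<bar> < d1 \<Longrightarrow> \<bar>\<phi> v - \<phi> w\<bar> < e / 2"
      using e unfolding uniformly_continuous_on_def dist_real_def by (metis half_gt_zero abs_minus_commute)
    have "uniformly_continuous_on {0..s} y" by (rule compact_uniformly_continuous[OF yc]) simp
    then obtain d where d: "d > 0"
      "\<And>v w. v \<in> {0..s} \<Longrightarrow> w \<in> {0..s} \<Longrightarrow> \<bar>v - w\<bar> < d \<Longrightarrow> \<bar>y v - y w\<bar> < d1"
      using d1(1) unfolding uniformly_continuous_on_def dist_real_def by (metis abs_minus_commute)
    have "\<bar>F b - F a\<bar> \<le> e * (G b - G a)" if ab: "0 \<le> a" "a \<le> b" "b \<le> s" "b - a < d" for a b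
    proof -
      have gab: "g absolutely_integrable_on {a..b}" and dy: "integral {a..b} g = y b - y a"
        using has_densityD[OF y ab(1-3)] by auto
      have gi: "g integrable_on {a..b}" and gn: "(\<lambda>x. \<bar>g x\<bar>) integrable_on {a..b}"
        using gab unfolding absolutely_integrable_on_def by simp_all
      have sub: "{a..b} \<subseteq> {0..s}" using ab by auto
      have pi: "(\<lambda>x. \<phi> (y x) * g x) integrable_on {a..b}"
        using continuous_times_density[OF continuous_on_subset[OF \<phi>y sub] gab]
        by (rule absolutely_integrable_imp_integrable)
      have comb: "integral {0..b} f = integral {0..a} f + integral {a..b} f"
        if "f absolutely_integrable_on {0..s}" for f :: "real \<Rightarrow> real"
      proof -
        have "f absolutely_integrable_on {0..b}"
          by (rule absolutely_integrable_on_subinterval[OF that]) (use ab in auto)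
        from absolutely_integrable_imp_integrable[OF this] show ?thesis
          using ab by (intro Henstock_Kurzweil_Integration.integral_combine[symmetric])
      qed
      have Gab: "G b - G a = integral {a..b} (\<lambda>x. \<bar>g x\<bar>)"
        unfolding G_def using comb[of "\<lambda>x. \<bar>g x\<bar>"] absolutely_integrable_norm[OF g] by (simp add: o_def)
      have Fab: "F b - F a = integral {a..b} (\<lambda>x. \<phi> (y x) * g x) - (\<Phi> (y b) - \<Phi> (y a))"
        unfolding F_def using comb[OF int] by simp
      have ya: "y a \<in> {l..u}" and yb: "y b \<in> {l..u}"
        by (rule subsetD[OF im imageI], use ab in simp)+
      have "norm (integral {a..b} (\<lambda>x. \<phi> (y x) * g x - \<phi> (y a) * g x)) \<le> integral {a..b} (\<lambda>x. e / 2 * \<bar>g x\<bar>)"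
      proof (rule Henstock_Kurzweil_Integration.integral_norm_bound_integral)
        show "(\<lambda>x. \<phi> (y x) * g x - \<phi> (y a) * g x) integrable_on {a..b}"
          using pi gi by (intro integrable_diff integrable_on_mult_right)
        show "(\<lambda>x. e / 2 * \<bar>g x\<bar>) integrable_on {a..b}" using gn by (intro integrable_on_mult_right)
        fix x assume x: "x \<in> {a..b}"
        have "\<bar>y x - y a\<bar> < d1" using x ab by (intro d(2)) auto
        moreover have "y x \<in> {l..u}" by (rule subsetD[OF im imageI]) (use x sub in blast)
        ultimately have "\<bar>\<phi> (y x) - \<phi> (y a)\<bar> < e / 2" using ya by (intro d1(2))
        then show "norm (\<phi> (y x) * g x - \<phi> (y a) * g x) \<le> e / 2 * \<bar>g x\<bar>"
          unfolding left_diff_distrib[symmetric] real_norm_def abs_mult by (intro mult_right_mono) auto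
      qed
      also have "integral {a..b} (\<lambda>x. \<phi> (y x) * g x - \<phi> (y a) * g x)
          = integral {a..b} (\<lambda>x. \<phi> (y x) * g x) - \<phi> (y a) * (y b - y a)"
        using pi gi by (subst Henstock_Kurzweil_Integration.integral_diff) (auto simp: dy intro!: integrable_on_mult_right)
      finally have A: "\<bar>integral {a..b} (\<lambda>x. \<phi> (y x) * g x) - \<phi> (y a) * (y b - y a)\<bar> \<le> e / 2 * (G b - G a)"
        by (simp add: Gab)
      have "\<bar>(\<Phi> (y b) - \<phi> (y a) * y b) - (\<Phi> (y a) - \<phi> (y a) * y a)\<bar> \<le> e / 2 * \<bar>y b - y a\<bar>"
      proof -
        \<comment> \<open>on \<open>?J\<close> the derivative of \<open>\<Phi> v - \<phi> (y a) * v\<close> is at most \<open>e / 2\<close>\<close>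
        let ?J = "{l..u} \<inter> {v. \<bar>v - y a\<bar> < d1}"
        have "convex ?J"
        proof -
          have "{v. \<bar>v - y a\<bar> < d1} = {y a - d1<..<y a + d1}" by auto
          then show ?thesis by (simp add: convex_Int)
        qed
        moreover have "((\<lambda>v. \<Phi> v - \<phi> (y a) * v) has_real_derivative (\<phi> v - \<phi> (y a))) (at v within ?J)"
          if "v \<in> ?J" for v
          using that has_field_derivative_subset[OF \<Phi>, of v ?J]
          by (auto intro!: derivative_eq_intros)
        moreover have "norm (\<phi> v - \<phi> (y a)) \<le> e / 2" if "v \<in> ?J" for v
          using d1(2)[of v "y a"] that ya by simp
        moreover have "\<bar>y b - y a\<bar> < d1" using ab by (intro d(2)) auto
        ultimately show ?thesis
          using field_differentiable_bound[of ?J "\<lambda>v. \<Phi> v - \<phi> (y a) * v" "\<lambda>v. \<phi> v - \<phi> (y a)" "e / 2" "y b" "y a"]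
            ya yb d1(1) by simp
      qed
      also have "\<dots> \<le> e / 2 * (G b - G a)"
      proof -
        have "norm (integral {a..b} g) \<le> integral {a..b} (\<lambda>x. \<bar>g x\<bar>)"
          by (rule Henstock_Kurzweil_Integration.integral_norm_bound_integral[OF gi gn]) simp
        then show ?thesis using e by (intro mult_left_mono) (auto simp: Gab dy)
      qed
      finally have B: "\<bar>\<Phi> (y b) - \<Phi> (y a) - \<phi> (y a) * (y b - y a)\<bar> \<le> e / 2 * (G b - G a)"
        by (simp add: algebra_simps)
      have "e / 2 * (G b - G a) = e * (G b - G a) / 2" by simp
      then show ?thesis using A B unfolding Fab by linarith
    qed
    then show ?thesis using d(1) by blast
  qed
  have small: "\<bar>F s - F 0\<bar> \<le> e * (G s - G 0)" if e: "e > 0" for e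
  proof -
    obtain d where d: "d > 0"
      "\<And>a b. 0 \<le> a \<Longrightarrow> a \<le> b \<Longrightarrow> b \<le> s \<Longrightarrow> b - a < d \<Longrightarrow> \<bar>F b - F a\<bar> \<le> e * (G b - G a)"
      using local[OF e] by blast
    obtain N :: nat where N: "N > 0" "s / real N < d"
      using reals_Archimedean2[of "s / d"] d(1) s
      by (metis divide_nonneg_pos gr0I linorder_not_less of_nat_0 of_nat_0_less_iff pos_divide_less_eq mult.commute)
    have "\<bar>F (real i * (s / real N)) - F 0\<bar> \<le> e * (G (real i * (s / real N)) - G 0)" if "i \<le> N" for i
      using that
    proof (induction i)
      case (Suc i)
      let ?a = "real i * (s / real N)" and ?b = "real (Suc i) * (s / real N)"
      have "?b \<le> real N * (s / real N)" using Suc.prems s by (intro mult_right_mono) auto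
      then have "?b \<le> s" using N by simp
      moreover have ba: "?b - ?a = s / real N" by (simp add: algebra_simps add_divide_distrib)
      moreover have "s / real N \<ge> 0" "0 \<le> ?a" using s by simp_all
      then have "?a \<le> ?b" "0 \<le> ?a" using ba by linarith+
      ultimately have "\<bar>F ?b - F ?a\<bar> \<le> e * (G ?b - G ?a)" using N(2) by (intro d(2)) auto
      moreover have "\<bar>F ?a - F 0\<bar> \<le> e * (G ?a - G 0)" using Suc by simp
      ultimately show ?case unfolding right_diff_distrib by linarith
    qed simp
    from this[of N] show ?thesis using N(1) by simp
  qed
  have "(\<lambda>x. \<bar>g x\<bar>) integrable_on {0..s}"
    using g unfolding absolutely_integrable_on_def by simp
  then have "G s - G 0 \<ge> 0"
    by (simp add: G_def Henstock_Kurzweil_Integration.integral_nonneg)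
  have "\<bar>F s - F 0\<bar> \<le> 0 + e" if "e > 0" for e
  proof -
    have "\<bar>F s - F 0\<bar> \<le> e / (G s - G 0 + 1) * (G s - G 0)"
      using \<open>e > 0\<close> \<open>G s - G 0 \<ge> 0\<close> by (intro small) simp
    also have "\<dots> \<le> e" using that \<open>G s - G 0 \<ge> 0\<close> by (simp add: field_simps)
    finally show ?thesis by simp
  qed
  then have "\<bar>F s - F 0\<bar> \<le> 0" by (rule field_le_epsilon)
  then show "integral {0..s} (\<lambda>x. \<phi> (y x) * g x) = \<Phi> (y s) - \<Phi> (y 0)"
    by (simp add: F_def)
qed

text \<open>
  By Lebesgue differentiation, a function whose integrals over all intervals vanish is zero almost
  everywhere.
\<close>

lemma density_unique:
  assumes g: "has_density s y g" and g': "has_density s y g'"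
  shows "AE x in lebesgue. x \<in> {0..s} \<longrightarrow> g x = g' x"
proof -
  define h where "h = (\<lambda>x. if x \<in> {0..s} then g x - g' x else 0)"
  have zero: "(h has_integral 0) {a..b}" for a b
  proof (cases "max 0 a \<le> min s b")
    case True
    have i: "g integrable_on {max 0 a..min s b}" "g' integrable_on {max 0 a..min s b}"
      using True by (intro absolutely_integrable_imp_integrable has_densityD(1)[OF g] has_densityD(1)[OF g']; simp)+
    have "((\<lambda>x. g x - g' x) has_integral (y (min s b) - y (max 0 a)) - (y (min s b) - y (max 0 a))) {max 0 a..min s b}"
      using has_densityD(2)[OF g, of "max 0 a" "min s b"] has_densityD(2)[OF g', of "max 0 a" "min s b"] True
        integrable_integral[OF i(1)] integrable_integral[OF i(2)]
      by (intro has_integral_diff) simp_all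
    moreover have "{max 0 a..min s b} = {0..s} \<inter> {a..b}" by auto
    ultimately have "((\<lambda>x. g x - g' x) has_integral 0) ({0..s} \<inter> {a..b})"
      by (simp only: diff_self)
    then show ?thesis
      unfolding h_def has_integral_restrict_Int .
  next
    case False
    have "(h has_integral 0) {a..b} \<longleftrightarrow> ((\<lambda>_. 0::real) has_integral 0) {a..b}"
      by (rule has_integral_cong) (use False in \<open>auto simp: h_def\<close>)
    then show ?thesis by simp
  qed
  then have "h integrable_on cbox a b" for a b by (auto simp: cbox_interval integrable_on_def)
  from integrable_ccontinuous_explicit[OF this] obtain N where N: "negligible N"
    "\<And>x e. x \<notin> N \<Longrightarrow> 0 < e \<Longrightarrow> \<exists>d>0. \<forall>r. 0 < r \<and> r < d \<longrightarrow>
        norm (integral (cbox x (x + r *\<^sub>R One)) h /\<^sub>R r ^ DIM(real) - h x) < e"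
    by blast
  have "h x = 0" if "x \<notin> N" for x
  proof (rule ccontr)
    assume "h x \<noteq> 0"
    then have "\<bar>h x\<bar> > 0" by simp
    from N(2)[OF that this] obtain d where d: "d > 0"
      "\<And>r. 0 < r \<and> r < d \<Longrightarrow> norm (integral (cbox x (x + r *\<^sub>R One)) h /\<^sub>R r ^ DIM(real) - h x) < \<bar>h x\<bar>"
      by blast
    from d(2)[of "d / 2"] d(1) show False
      using integral_unique[OF zero] by (simp add: cbox_interval)
  qed
  moreover have "AE x in lebesgue. x \<notin> N"
    using N(1) by (intro AE_not_in) (simp add: negligible_iff_null_sets)
  ultimately have "AE x in lebesgue. h x = 0" by (auto elim!: eventually_mono)
  then show ?thesis
    by eventually_elim (auto simp: h_def split: if_splits)
qed

text \<open>
  Densities of the same trajectory agree almost everywhere, hence so do the integrands.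
\<close>

lemma trajectory_cost_eq:
  assumes g: "has_density s y g"
  shows "trajectory_cost c s y = (\<integral>\<^sup>+ x\<in>{0..s}. e2ennreal (local_cost c (y x) (g x)) \<partial>lebesgue)"
proof -
  define I where "I = (\<lambda>g. \<integral>\<^sup>+ x\<in>{0..s}. e2ennreal (local_cost c (y x) (g x)) \<partial>lebesgue)"
  have eq: "I g' = I g" if "has_density s y g'" for g'
    unfolding I_def using density_unique[OF that g]
    by (intro nn_integral_cong_AE) (auto elim!: eventually_mono simp: indicator_def)
  have "(INF g\<in>{g. has_density s y g}. I g) = I g"
  proof (rule antisym)
    show "(INF g\<in>{g. has_density s y g}. I g) \<le> I g" using g by (intro INF_lower CollectI)
    show "I g \<le> (INF g\<in>{g. has_density s y g}. I g)"
      by (rule INF_greatest) (simp add: eq)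
  qed
  then show ?thesis unfolding trajectory_cost_def I_def .
qed

lemma ennreal_integral_le_nn_integral:
  assumes "integrable M f"
  shows "ennreal (\<integral>x. f x \<partial>M) \<le> (\<integral>\<^sup>+x. ennreal (f x) \<partial>M)"
proof -
  have "(\<integral>x. f x \<partial>M) \<le> (\<integral>x. max 0 (f x) \<partial>M)"
    using assms by (intro integral_mono) auto
  then have "ennreal (\<integral>x. f x \<partial>M) \<le> ennreal (\<integral>x. max 0 (f x) \<partial>M)" by (rule ennreal_leI)
  also have "\<dots> = (\<integral>\<^sup>+x. ennreal (max 0 (f x)) \<partial>M)"
    using assms by (intro nn_integral_eq_integral[symmetric]) auto
  also have "\<dots> = (\<integral>\<^sup>+x. ennreal (f x) \<partial>M)"
    by (intro nn_integral_cong) (auto simp: max_def ennreal_neg)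
  finally show ?thesis .
qed

text \<open>
  If \<open>f\<close> exceeded \<open>h\<close> on a set of positive measure, then \<open>max f h\<close> would be a lower bound of \<open>F\<close> with a
  larger integral than \<open>h\<close>. The lemma is meant for the local cost as \<open>F\<close>, a supremum over uncountably many
  functions.
\<close>

lemma AE_le_of_nn_integral_le:
  fixes f h :: "'a \<Rightarrow> real"
  assumes f: "integrable M f" and h: "integrable M h" and nonneg: "(\<integral>x. h x \<partial>M) \<ge> 0"
    and F: "\<And>x. ennreal (f x) \<le> F x" "\<And>x. ennreal (h x) \<le> F x"
    and le: "(\<integral>\<^sup>+x. F x \<partial>M) \<le> ennreal (\<integral>x. h x \<partial>M)"
  shows "AE x in M. f x \<le> h x"
proof -
  have m: "integrable M (\<lambda>x. max (f x) (h x))" using f h by auto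
  have "ennreal (\<integral>x. max (f x) (h x) \<partial>M) \<le> (\<integral>\<^sup>+x. ennreal (max (f x) (h x)) \<partial>M)"
    by (rule ennreal_integral_le_nn_integral[OF m])
  also have "\<dots> \<le> (\<integral>\<^sup>+x. F x \<partial>M)"
    using F by (intro nn_integral_mono) (auto simp: max_def)
  also note le
  finally have "(\<integral>x. max (f x) (h x) \<partial>M) \<le> (\<integral>x. h x \<partial>M)"
    using nonneg by (subst (asm) ennreal_le_iff)
  then have "(\<integral>x. max (f x) (h x) - h x \<partial>M) \<le> 0"
    using m h by simp
  moreover have "(\<integral>x. max (f x) (h x) - h x \<partial>M) \<ge> 0" by (intro integral_nonneg_AE) auto
  ultimately have "(\<integral>x. max (f x) (h x) - h x \<partial>M) = 0" by simp
  then have "AE x in M. max (f x) (h x) - h x = 0"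
    using m h by (subst (asm) integral_nonneg_eq_0_iff_AE) auto
  then show ?thesis by (auto elim!: eventually_mono)
qed

text \<open>
  A stationary point condition, tested only along two sequences so that it can be obtained almost
  everywhere at once for all of them.
\<close>

lemma poisson_maximiser:
  assumes "\<And>n. (\<theta> + 1 / real (Suc n)) * \<xi> - lam * (exp (\<theta> + 1 / real (Suc n)) - 1) \<le> \<theta> * \<xi> - lam * (exp \<theta> - 1)"
    and "\<And>n. (\<theta> + - 1 / real (Suc n)) * \<xi> - lam * (exp (\<theta> + - 1 / real (Suc n)) - 1) \<le> \<theta> * \<xi> - lam * (exp \<theta> - 1)"
  shows "\<xi> = lam * exp \<theta>"
proof -
  define f where "f = (\<lambda>t. t * \<xi> - lam * (exp t - 1))"
  have "(f has_real_derivative \<xi> - lam * exp \<theta>) (at \<theta>)"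
    unfolding f_def by (auto intro!: derivative_eq_intros)
  then have D: "((\<lambda>t. (f (\<theta> + t) - f \<theta>) / t) \<longlongrightarrow> \<xi> - lam * exp \<theta>) (at 0)"
    by (simp add: DERIV_def)
  have inv: "(\<lambda>n. d / real (Suc n)) \<longlonglongrightarrow> 0" for d
    using tendsto_mult[OF tendsto_const[of d] LIMSEQ_inverse_real_of_nat] by (simp add: divide_inverse)
  have seq: "(\<lambda>n. (f (\<theta> + d / real (Suc n)) - f \<theta>) / (d / real (Suc n))) \<longlonglongrightarrow> \<xi> - lam * exp \<theta>" if "d \<noteq> 0" for d
    using that inv[of d] by (intro filterlim_compose[OF D]) (auto simp: filterlim_at)
  have "(f (\<theta> + 1 / real (Suc n)) - f \<theta>) / (1 / real (Suc n)) \<le> 0" for n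
    using assms(1)[of n] by (intro divide_nonpos_pos) (simp_all add: f_def)
  with seq[of 1] have "\<xi> - lam * exp \<theta> \<le> 0" by (intro LIMSEQ_le_const2) auto
  moreover have "(f (\<theta> + - 1 / real (Suc n)) - f \<theta>) / (- 1 / real (Suc n)) \<ge> 0" for n
    using assms(2)[of n] by (intro divide_nonpos_neg) (simp_all add: f_def)
  with seq[of "- 1"] have "\<xi> - lam * exp \<theta> \<ge> 0" by (intro LIMSEQ_le_const) auto
  ultimately show ?thesis by simp
qed

lemma decreasing_trajectory_range:
  assumes "decreasing_trajectory s y" "0 \<le> s"
  shows "y ` {0..s} \<subseteq> {0..1}"
proof
  fix v assume "v \<in> y ` {0..s}"
  then obtain x where x: "x \<in> {0..s}" "v = y x" by blast
  have "y s \<le> y x" "y x \<le> y 0"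
    using monotone_onD[of "{0..s}" "(\<le>)" "\<lambda>x y. x \<ge> y" y x s]
      monotone_onD[of "{0..s}" "(\<le>)" "\<lambda>x y. x \<ge> y" y 0 x] assms x
    by (auto simp: decreasing_trajectory_def)
  then show "v \<in> {0..1}" using assms x by (simp add: decreasing_trajectory_def)
qed

text \<open>
  The expression under the supremum that defines the local cost.
\<close>

definition dual_cost :: "real \<Rightarrow> real \<Rightarrow> real \<Rightarrow> real \<Rightarrow> real" where
  "dual_cost c \<theta> y v = \<theta> * (- (1 + v)) - c * y * (exp \<theta> - 1)"

lemma dual_cost_le: "ereal (dual_cost c \<theta> y v) \<le> local_cost c y v"
  unfolding dual_cost_def local_cost_def poisson_rate_def by (rule SUP_upper) simp

lemma ennreal_dual_cost_le: "ennreal (dual_cost c \<theta> y v) \<le> e2ennreal (local_cost c y v)"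
  using e2ennreal_mono[OF dual_cost_le[of c \<theta> y v]] by (simp add: e2ennreal_ereal)

lemma dual_cost_absolutely_integrable:
  fixes \<theta> y g :: "real \<Rightarrow> real"
  assumes "continuous_on {0..s} \<theta>" "continuous_on {0..s} y" "g absolutely_integrable_on {0..s}"
  shows "(\<lambda>x. dual_cost c (\<theta> x) (y x) (g x)) absolutely_integrable_on {0..s}"
proof -
  have "(\<lambda>x. (- \<theta> x) * g x) absolutely_integrable_on {0..s}"
    by (rule continuous_times_density[where f = "\<lambda>x. - \<theta> x", OF _ assms(3)])
      (intro continuous_intros assms)
  moreover have "(\<lambda>x. - \<theta> x - c * y x * (exp (\<theta> x) - 1)) absolutely_integrable_on {0..s}"
    by (intro absolutely_integrable_continuous_real continuous_intros assms)
  ultimately have "(\<lambda>x. (- \<theta> x) * g x + (- \<theta> x - c * y x * (exp (\<theta> x) - 1))) absolutely_integrable_on {0..s}"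
    by (rule set_integral_add(1))
  moreover have "(- \<theta> x) * g x + (- \<theta> x - c * y x * (exp (\<theta> x) - 1)) = dual_cost c (\<theta> x) (y x) (g x)" for x
    by (simp add: dual_cost_def algebra_simps)
  ultimately show ?thesis by simp
qed

text \<open>
  The energy identity removes the nonlinear term, leaving an exact derivative and a constant. So the result
  does not depend on the trajectory.
\<close>

lemma dual_cost_integral:
  assumes s: "0 \<le> s" and y: "has_density s y g" "y ` {0..s} \<subseteq> {0..1}" "y 0 = 1" "y s = 0"
    and \<theta>: "continuous_on {0..1} \<theta>" and E: "\<And>v. v \<in> {0..1} \<Longrightarrow> \<theta> v + c * v * (exp (\<theta> v) - 1) = E"
  shows "integral {0..s} (\<lambda>x. dual_cost c (\<theta> (y x)) (y x) (g x)) = integral {0..1} \<theta> - E * s"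
proof -
  define \<Phi> where "\<Phi> = (\<lambda>v. integral {0..v} \<theta>)"
  have \<Phi>: "(\<Phi> has_real_derivative \<theta> v) (at v within {0..1})" if "v \<in> {0..1}" for v
    unfolding \<Phi>_def by (rule integral_has_real_derivative[OF \<theta> that])
  note chain = absolutely_continuous_chain_rule[OF s y(1,2) \<theta> \<Phi>]
  have eq: "dual_cost c (\<theta> (y x)) (y x) (g x) = - (\<theta> (y x) * g x) - E" if "x \<in> {0..s}" for x
  proof -
    have "y x \<in> {0..1}" by (rule subsetD[OF y(2) imageI[OF that]])
    from E[OF this] show ?thesis by (simp add: dual_cost_def algebra_simps)
  qed
  have "((\<lambda>x. \<theta> (y x) * g x) has_integral \<Phi> (y s) - \<Phi> (y 0)) {0..s}"
    using integrable_integral[OF absolutely_integrable_imp_integrable[OF chain(1)]] chain(2)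
    by simp
  moreover have "((\<lambda>_. E) has_integral E * s) {0..s}"
    using has_integral_const_real[of E 0 s] s by (simp add: mult.commute)
  ultimately have "((\<lambda>x. - (\<theta> (y x) * g x) - E) has_integral - (\<Phi> (y s) - \<Phi> (y 0)) - E * s) {0..s}"
    by (intro has_integral_diff has_integral_neg)
  moreover have "- (\<Phi> (y s) - \<Phi> (y 0)) - E * s = integral {0..1} \<theta> - E * s"
    using y by (simp add: \<Phi>_def)
  ultimately have "((\<lambda>x. dual_cost c (\<theta> (y x)) (y x) (g x)) has_integral integral {0..1} \<theta> - E * s) {0..s}"
    using eq by (subst has_integral_cong[where g = "\<lambda>x. - (\<theta> (y x) * g x) - E"]) auto
  then show ?thesis by (rule integral_unique)
qed

lemma trajectory_cost_lower_bound:
  assumes s: "0 \<le> s" and y: "decreasing_trajectory s y"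
    and \<theta>: "continuous_on {0..1} \<theta>" and E: "\<And>v. v \<in> {0..1} \<Longrightarrow> \<theta> v + c * v * (exp (\<theta> v) - 1) = E"
  shows "ennreal (integral {0..1} \<theta> - E * s) \<le> trajectory_cost c s y"
  unfolding trajectory_cost_def
proof (rule INF_greatest)
  fix g assume "g \<in> {g. has_density s y g}"
  then have g: "has_density s y g" "g absolutely_integrable_on {0..s}" by (auto dest: has_density_integrable)
  note im = decreasing_trajectory_range[OF y s]
  have y01: "y 0 = 1" "y s = 0" using y by (auto simp: decreasing_trajectory_def)
  have yc: "continuous_on {0..s} y" by (rule has_density_continuous[OF g(1)])
  let ?h = "\<lambda>x. dual_cost c (\<theta> (y x)) (y x) (g x)"
  have h: "?h absolutely_integrable_on {0..s}"
    by (intro dual_cost_absolutely_integrable continuous_on_compose2[OF \<theta> yc im] yc g)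
  have "ennreal (integral {0..1} \<theta> - E * s) = ennreal (\<integral>x. indicator {0..s} x *\<^sub>R ?h x \<partial>lebesgue)"
    using dual_cost_integral[OF s g(1) im y01 \<theta> E] set_lebesgue_integral_eq_integral(2)[OF h]
    by (simp add: set_lebesgue_integral_def)
  also have "\<dots> \<le> (\<integral>\<^sup>+x. ennreal (indicator {0..s} x *\<^sub>R ?h x) \<partial>lebesgue)"
    using h by (intro ennreal_integral_le_nn_integral) (simp add: set_integrable_def)
  also have "\<dots> \<le> (\<integral>\<^sup>+ x\<in>{0..s}. e2ennreal (local_cost c (y x) (g x)) \<partial>lebesgue)"
    using ennreal_dual_cost_le by (intro nn_integral_mono) (simp add: indicator_def)
  finally show "ennreal (integral {0..1} \<theta> - E * s) \<le> (\<integral>\<^sup>+ x\<in>{0..s}. e2ennreal (local_cost c (y x) (g x)) \<partial>lebesgue)" .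
qed

text \<open>
  At minimal cost the dual bound with \<open>\<theta> (y)\<close> is tight almost everywhere, hence not improved by
  perturbing \<open>\<theta> (y)\<close>. Stationarity gives the slope as a continuous function of \<open>y\<close>, so \<open>y\<close> is
  differentiable everywhere.
\<close>

lemma trajectory_cost_minimal_imp_ode:
  assumes s: "0 \<le> s" and y: "decreasing_trajectory s y"
    and \<theta>: "continuous_on {0..1} \<theta>" and E: "\<And>v. v \<in> {0..1} \<Longrightarrow> \<theta> v + c * v * (exp (\<theta> v) - 1) = E"
    and nonneg: "integral {0..1} \<theta> - E * s \<ge> 0"
    and min: "trajectory_cost c s y = ennreal (integral {0..1} \<theta> - E * s)" and x: "x \<in> {0..s}"
  shows "(y has_real_derivative - 1 - c * y x * exp (\<theta> (y x))) (at x within {0..s})"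
proof -
  have "\<exists>g. has_density s y g"
  proof (rule ccontr)
    assume "\<nexists>g. has_density s y g"
    then have "trajectory_cost c s y = \<top>" by (simp add: trajectory_cost_def)
    then show False using min by simp
  qed
  then obtain g where g: "has_density s y g" "g absolutely_integrable_on {0..s}" by (auto dest: has_density_integrable)
  note im = decreasing_trajectory_range[OF y s]
  have y01: "y 0 = 1" "y s = 0" using y by (auto simp: decreasing_trajectory_def)
  have yc: "continuous_on {0..s} y" by (rule has_density_continuous[OF g(1)])
  have \<theta>y: "continuous_on {0..s} (\<lambda>x. \<theta> (y x))" by (rule continuous_on_compose2[OF \<theta> yc im])
  \<comment> \<open>the dual bound with the dual variable shifted by \<open>t\<close>\<close>
  define h where "h = (\<lambda>t x. indicator {0..s} x *\<^sub>R dual_cost c (\<theta> (y x) + t) (y x) (g x))"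
  define F where "F = (\<lambda>x. e2ennreal (local_cost c (y x) (g x)) * indicator {0..s} x)"
  have hi: "integrable lebesgue (h t)" for t
  proof -
    have "continuous_on {0..s} (\<lambda>x. \<theta> (y x) + t)" by (intro continuous_intros \<theta>y)
    from dual_cost_absolutely_integrable[OF this yc g(2), of c] show ?thesis
      by (simp add: h_def set_integrable_def)
  qed
  have h0: "(\<integral>x. h 0 x \<partial>lebesgue) = integral {0..1} \<theta> - E * s"
    using dual_cost_integral[OF s g(1) im y01 \<theta> E]
      set_lebesgue_integral_eq_integral(2)[OF dual_cost_absolutely_integrable[OF \<theta>y yc g(2)], of c]
    by (simp add: set_lebesgue_integral_def h_def)
  have hF: "ennreal (h t x) \<le> F x" for t x
    using ennreal_dual_cost_le by (simp add: h_def F_def indicator_def)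
  have F: "(\<integral>\<^sup>+x. F x \<partial>lebesgue) \<le> ennreal (\<integral>x. h 0 x \<partial>lebesgue)"
    using trajectory_cost_eq[OF g(1), of c] min by (simp add: F_def h0)
  have ae: "AE x in lebesgue. h t x \<le> h 0 x" for t
    by (rule AE_le_of_nn_integral_le[OF hi hi _ hF hF F]) (use nonneg in \<open>simp add: h0\<close>)
  have "AE x in lebesgue. (\<forall>n. h (1 / real (Suc n)) x \<le> h 0 x) \<and> (\<forall>n. h (- 1 / real (Suc n)) x \<le> h 0 x)"
    by (intro AE_conjI AE_all_countable[THEN iffD2] allI ae)
  then have "AE x in lebesgue. x \<in> {0..s} \<longrightarrow> g x = - 1 - c * y x * exp (\<theta> (y x))"
  proof eventually_elim
    case (elim x)
    show ?case
    proof
      assume "x \<in> {0..s}"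
      then have "- (1 + g x) = c * y x * exp (\<theta> (y x))"
        using elim by (intro poisson_maximiser) (auto simp: h_def dual_cost_def)
      then show "g x = - 1 - c * y x * exp (\<theta> (y x))" by simp
    qed
  qed
  then obtain N where N: "N \<in> null_sets lebesgue" "{x. \<not> (x \<in> {0..s} \<longrightarrow> g x = - 1 - c * y x * exp (\<theta> (y x)))} \<subseteq> N"
    by (auto simp: eventually_ae_filter)
  let ?V = "\<lambda>x. - 1 - c * y x * exp (\<theta> (y x))"
  have V: "continuous_on {0..s} ?V" by (intro continuous_intros yc \<theta>y)
  have yV: "y z = y 0 + integral {0..z} ?V" if z: "z \<in> {0..s}" for z
  proof -
    have "integral {0..z} g = integral {0..z} ?V"
      by (rule integral_spike[where S = N]) (use N z in \<open>auto simp: negligible_iff_null_sets\<close>)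
    moreover have "y z = y 0 + integral {0..z} g" using g(1) z unfolding has_density_def by blast
    ultimately show ?thesis by simp
  qed
  have "((\<lambda>z. y 0 + integral {0..z} ?V) has_real_derivative 0 + ?V x) (at x within {0..s})"
    by (intro DERIV_add DERIV_const integral_has_real_derivative V x)
  then show ?thesis
    by (rule has_field_derivative_transform_within[where d = 1, OF _ _ x, THEN DERIV_cong])
      (simp_all add: yV[symmetric])
qed

text \<open>
  An antiderivative \<open>T\<close> of \<open>1 / V\<close> measures the time spent: \<open>T\<close> of a solution grows with slope 1, and
  \<open>T\<close> is injective.
\<close>

lemma autonomous_ode_unique:
  fixes y z V :: "real \<Rightarrow> real"
  assumes V: "continuous_on {l..u} V" "\<And>v. v \<in> {l..u} \<Longrightarrow> V v < 0"
    and y: "\<And>x. x \<in> {0..s} \<Longrightarrow> (y has_real_derivative V (y x)) (at x within {0..s})" "y ` {0..s} \<subseteq> {l..u}"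
    and z: "\<And>x. x \<in> {0..s} \<Longrightarrow> (z has_real_derivative V (z x)) (at x within {0..s})" "z ` {0..s} \<subseteq> {l..u}"
    and eq: "y 0 = z 0" and x: "x \<in> {0..s}"
  shows "y x = z x"
proof -
  define T where "T = (\<lambda>v. integral {l..v} (\<lambda>v. 1 / V v))"
  have cont: "continuous_on {l..u} (\<lambda>v. 1 / V v)"
  proof -
    have "V v \<noteq> 0" if "v \<in> {l..u}" for v using V(2)[OF that] by simp
    then show ?thesis by (intro continuous_intros V(1)) blast
  qed
  have T: "(T has_real_derivative 1 / V v) (at v within {l..u})" if "v \<in> {l..u}" for v
    unfolding T_def by (rule integral_has_real_derivative[OF cont that])
  have time: "T (f x) - x = T (f 0) - 0"
    if f: "\<And>x. x \<in> {0..s} \<Longrightarrow> (f has_real_derivative V (f x)) (at x within {0..s})" "f ` {0..s} \<subseteq> {l..u}" for f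
  proof -
    have "((\<lambda>x. T (f x) - x) has_real_derivative 0) (at x within {0..s})" if x: "x \<in> {0..s}" for x
    proof -
      have fx: "f x \<in> {l..u}" by (rule subsetD[OF f(2) imageI[OF x]])
      have "((T \<circ> f) has_real_derivative 1 / V (f x) * V (f x)) (at x within {0..s})"
        by (rule DERIV_image_chain[OF has_field_derivative_subset[OF T[OF fx] f(2)] f(1)[OF x]])
      then have "((\<lambda>x. T (f x) - x) has_real_derivative 1 / V (f x) * V (f x) - 1) (at x within {0..s})"
        unfolding o_def by (intro DERIV_diff DERIV_ident)
      then show ?thesis using V(2)[OF fx] by simp
    qed
    then have "\<exists>k. \<forall>x\<in>{0..s}. T (f x) - x = k"
      by (intro has_field_derivative_zero_constant) auto
    then obtain k where k: "\<forall>x\<in>{0..s}. T (f x) - x = k" by blast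
    have "0 \<in> {0..s}" using x by simp
    from bspec[OF k x] bspec[OF k this] show ?thesis by simp
  qed
  have "T (y x) = T (z x)" using time[OF y] time[OF z] eq by simp
  moreover have "T v < T w" if vw: "v \<in> {l..u}" "w \<in> {l..u}" "w < v" for v w
  proof -
    obtain \<xi> where \<xi>: "w < \<xi>" "\<xi> < v" "T v - T w = (1 / V \<xi>) * (v - w)"
    proof -
      have "\<exists>\<xi>\<in>{w<..<v}. T v - T w = (\<lambda>t. (1 / V \<xi>) * t) (v - w)"
      proof (rule mvt_simple[OF vw(3)])
        fix \<xi> assume "w \<le> \<xi>" "\<xi> \<le> v"
        then have "\<xi> \<in> {l..u}" "{w..v} \<subseteq> {l..u}" using vw by auto
        from has_field_derivative_subset[OF T[OF this(1)] this(2)]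
        show "(T has_derivative (\<lambda>t. (1 / V \<xi>) * t)) (at \<xi> within {w..v})"
          by (simp only: has_field_derivative_def)
      qed
      then show ?thesis by (auto intro: that)
    qed
    have "V \<xi> < 0" using \<xi> vw by (intro V(2)) auto
    then have "1 / V \<xi> * (v - w) < 0" using vw(3) by (intro mult_neg_pos) auto
    then show ?thesis using \<xi>(3) by simp
  qed
  moreover have "y x \<in> {l..u}" "z x \<in> {l..u}"
    by (rule subsetD[OF y(2) imageI[OF x]], rule subsetD[OF z(2) imageI[OF x]])
  ultimately show ?thesis by (metis less_irrefl linorder_neqE)
qed

section \<open>Optimality of the trajectory\<close>

lemma profile_image:
  assumes c: "c > 0" "\<alpha> > -1" "\<alpha> \<noteq> 0"
  shows "profile c \<alpha> ` {0..end_time c \<alpha>} = {0..1}"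
proof
  have T: "end_time c \<alpha> > 0" by (rule exp_end_time(2)[OF c])
  show "profile c \<alpha> ` {0..end_time c \<alpha>} \<subseteq> {0..1}"
  proof
    fix v assume "v \<in> profile c \<alpha> ` {0..end_time c \<alpha>}"
    then obtain x where x: "x \<in> {0..end_time c \<alpha>}" "v = profile c \<alpha> x" by blast
    have "profile c \<alpha> x \<le> profile c \<alpha> 0"
      using monotone_onD[OF profile_strict_antimono[OF c], of 0 x] x by (cases "x = 0") auto
    moreover have "profile c \<alpha> (end_time c \<alpha>) \<le> profile c \<alpha> x"
      using monotone_onD[OF profile_strict_antimono[OF c], of x "end_time c \<alpha>"] x by (cases "x = end_time c \<alpha>") auto
    ultimately show "v \<in> {0..1}" using x profile_end[OF c] c by simp
  qed
  show "{0..1} \<subseteq> profile c \<alpha> ` {0..end_time c \<alpha>}"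
  proof
    fix v :: real assume v: "v \<in> {0..1}"
    have "\<exists>x\<ge>0. x \<le> end_time c \<alpha> \<and> profile c \<alpha> x = v"
      using v T c profile_end[OF c] by (intro IVT2' profile_continuous_on[OF c]) auto
    then show "v \<in> profile c \<alpha> ` {0..end_time c \<alpha>}" by force
  qed
qed

text \<open>
  The dual variable as a function of the height, by inverting the profile.
\<close>

definition profile_dual :: "real \<Rightarrow> real \<Rightarrow> real \<Rightarrow> real" where
  "profile_dual c \<alpha> v = - ln (1 + \<alpha> * exp (c * the_inv_into {0..end_time c \<alpha>} (profile c \<alpha>) v))"

lemma profile_inv:
  assumes c: "c > 0" "\<alpha> > -1" "\<alpha> \<noteq> 0" and x: "x \<in> {0..end_time c \<alpha>}"
  shows "the_inv_into {0..end_time c \<alpha>} (profile c \<alpha>) (profile c \<alpha> x) = x"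
proof (rule the_inv_into_f_f[OF _ x])
  show "inj_on (profile c \<alpha>) {0..end_time c \<alpha>}"
    using monotone_onD[OF profile_strict_antimono[OF c]] by (intro linorder_inj_onI) force+
qed

lemma profile_dual_profile:
  assumes "c > 0" "\<alpha> > -1" "\<alpha> \<noteq> 0" "x \<in> {0..end_time c \<alpha>}"
  shows "profile_dual c \<alpha> (profile c \<alpha> x) = - ln (1 + \<alpha> * exp (c * x))"
  unfolding profile_dual_def profile_inv[OF assms] ..

lemma profile_dual_continuous_on:
  assumes c: "c > 0" "\<alpha> > -1" "\<alpha> \<noteq> 0"
  shows "continuous_on {0..1} (profile_dual c \<alpha>)"
proof -
  let ?T = "end_time c \<alpha>"
  let ?i = "the_inv_into {0..?T} (profile c \<alpha>)"
  have inv: "continuous_on (profile c \<alpha> ` {0..?T}) ?i"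
    by (rule continuous_on_inv[OF profile_continuous_on[OF c]]) (auto simp: profile_inv[OF c])
  have im: "?i ` {0..1} \<subseteq> {0..?T}"
    unfolding profile_image[OF c, symmetric] by (auto simp: profile_inv[OF c])
  have "continuous_on {0..?T} (\<lambda>x. - ln (1 + \<alpha> * exp (c * x)))"
    using profile_domain[OF c] by (intro continuous_intros) force
  from continuous_on_compose2[OF this inv[unfolded profile_image[OF c]] im]
  show ?thesis by (simp add: profile_dual_def[abs_def])
qed

text \<open>
  Conservation of the Hamiltonian along the profile, in terms of the height.
\<close>

lemma profile_dual_energy:
  assumes c: "c > 0" "\<alpha> > -1" "\<alpha> \<noteq> 0" and v: "v \<in> {0..1}"
  shows "profile_dual c \<alpha> v + c * v * (exp (profile_dual c \<alpha> v) - 1) = - ln (1 + \<alpha>) - c * \<alpha> / (1 + \<alpha>)"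
proof -
  obtain x where x: "x \<in> {0..end_time c \<alpha>}" "v = profile c \<alpha> x"
    using v unfolding profile_image[OF c, symmetric] by blast
  define W where "W = 1 + \<alpha> * exp (c * x)"
  define E where "E = exp (c * x)"
  have W: "W > 0" unfolding W_def by (rule profile_domain[OF c x(1)])
  have E: "E > 0" by (simp add: E_def)
  have "exp (profile_dual c \<alpha> v) = 1 / W"
    unfolding x(2) profile_dual_profile[OF c x(1)] using W by (simp add: W_def exp_minus inverse_eq_divide)
  moreover have "v = W / E * profile_gap c \<alpha> x" by (simp add: x(2) profile_def W_def E_def)
  ultimately have "c * v * (exp (profile_dual c \<alpha> v) - 1) = c * (W / E * profile_gap c \<alpha> x) * (1 / W - 1)"
    by simp
  also have "\<dots> = c * profile_gap c \<alpha> x * ((1 - W) / E)" using W E by (simp add: field_simps)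
  also have "(1 - W) / E = - \<alpha>" by (simp add: W_def E_def)
  also have "c * profile_gap c \<alpha> x * - \<alpha> = ln W - ln (1 + \<alpha>) - c * \<alpha> / (1 + \<alpha>)"
  proof -
    have "c * (p - q / (c * \<alpha>)) * - \<alpha> = q - c * \<alpha> * p" for p q
      using c by (simp add: field_simps)
    then show ?thesis
      unfolding profile_gap_def W_def[symmetric] using c W by (simp add: ln_div)
  qed
  finally show ?thesis
    unfolding x(2) profile_dual_profile[OF c x(1)] by (simp add: W_def)
qed

lemma profile_velocity:
  assumes c: "c > 0" "\<alpha> > -1" "\<alpha> \<noteq> 0" and x: "x \<in> {0..end_time c \<alpha>}"
  shows "- 1 - c * profile c \<alpha> x * exp (profile_dual c \<alpha> (profile c \<alpha> x)) = - 1 - c * profile_gap c \<alpha> x / exp (c * x)"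
  unfolding profile_dual_profile[OF c x] using profile_domain[OF c x]
  by (simp add: exp_minus profile_def)

lemma has_density_profile:
  assumes c: "c > 0" "\<alpha> > -1" "\<alpha> \<noteq> 0"
  shows "has_density (end_time c \<alpha>) (profile c \<alpha>) (\<lambda>x. - 1 - c * profile_gap c \<alpha> x / exp (c * x))"
proof -
  let ?T = "end_time c \<alpha>" and ?g = "\<lambda>x. - 1 - c * profile_gap c \<alpha> x / exp (c * x)"
  have "continuous_on {0..?T} (profile_gap c \<alpha>)"
    by (intro continuous_at_imp_continuous_on ballI DERIV_isCont[OF profile_gap_derivative] c profile_domain)
  then have "continuous_on {0..?T} ?g" by (intro continuous_intros) auto
  then have 1: "?g absolutely_integrable_on {0..?T}"
    by (rule absolutely_integrable_continuous_real)
  have 2: "profile c \<alpha> x = profile c \<alpha> 0 + integral {0..x} ?g" if x: "x \<in> {0..?T}" for x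
  proof -
    have "(?g has_integral profile c \<alpha> x - profile c \<alpha> 0) {0..x}"
    proof (rule fundamental_theorem_of_calculus)
      show "0 \<le> x" using x by simp
      fix z assume "z \<in> {0..x}"
      then have "z \<in> {0..?T}" using x by simp
      from profile_derivative[OF c profile_domain[OF c this]]
      show "(profile c \<alpha> has_vector_derivative ?g z) (at z within {0..x})"
        by (rule has_vector_derivative_at_within[OF has_real_derivative_iff_has_vector_derivative[THEN iffD1]])
    qed
    from integral_unique[OF this] show ?thesis by simp
  qed
  show ?thesis unfolding has_density_def using 1 2 by blast
qed

lemma decreasing_trajectory_profile:
  assumes c: "c > 0" "\<alpha> > -1" "\<alpha> \<noteq> 0"
  shows "decreasing_trajectory (end_time c \<alpha>) (profile c \<alpha>)"
proof -
  have "antimono_on {0..end_time c \<alpha>} (profile c \<alpha>)"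
  proof (rule monotone_onI)
    fix x y assume "x \<in> {0..end_time c \<alpha>}" "y \<in> {0..end_time c \<alpha>}" "x \<le> y"
    then show "profile c \<alpha> y \<le> profile c \<alpha> x"
      using monotone_onD[OF profile_strict_antimono[OF c], of x y] by (cases "x = y") auto
  qed
  then show ?thesis
    unfolding decreasing_trajectory_def using profile_end[OF c] c by simp
qed

lemma trajectory_cost_profile:
  assumes c: "c > 0" "\<alpha> > -1" "\<alpha> \<noteq> 0"
  shows "trajectory_cost c (end_time c \<alpha>) (profile c \<alpha>)
       = ennreal (- integral {0..end_time c \<alpha>} (cost_rate c \<alpha>))"
proof -
  let ?T = "end_time c \<alpha>"
  have "trajectory_cost c ?T (profile c \<alpha>)
      = (\<integral>\<^sup>+ x\<in>{0..?T}. e2ennreal (local_cost c (profile c \<alpha> x) (- 1 - c * profile_gap c \<alpha> x / exp (c * x))) \<partial>lebesgue)"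
    by (rule trajectory_cost_eq[OF has_density_profile[OF c]])
  also have "\<dots> = (\<integral>\<^sup>+ x\<in>{0..?T}. ennreal (- cost_rate c \<alpha> x) \<partial>lebesgue)"
    by (intro nn_integral_cong) (simp add: indicator_def local_cost_profile[OF c] e2ennreal_ereal)
  also have "\<dots> = (\<integral>\<^sup>+ x. ennreal (- cost_rate c \<alpha> x) * indicator {0..?T} x \<partial>lborel)"
    by (rule nn_integral_completion)
  also have "\<dots> = ennreal (- integral {0..?T} (cost_rate c \<alpha>))"
    using cost_rate_nonpos[OF c] cost_rate_has_integral[OF c]
    by (intro nn_integral_has_integral_lebesgue' has_integral_neg)
      (auto simp: has_integral_integrable_integral)
  finally show ?thesis .
qed

lemma profile_dual_integral:
  assumes c: "c > 0" "\<alpha> > -1" "\<alpha> \<noteq> 0"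
  shows "integral {0..1} (profile_dual c \<alpha>) - (- ln (1 + \<alpha>) - c * \<alpha> / (1 + \<alpha>)) * end_time c \<alpha>
       = - integral {0..end_time c \<alpha>} (cost_rate c \<alpha>)"
proof -
  let ?T = "end_time c \<alpha>" and ?g = "\<lambda>x. - 1 - c * profile_gap c \<alpha> x / exp (c * x)"
  have T: "?T \<ge> 0" using exp_end_time(2)[OF c] by simp
  have "dual_cost c (profile_dual c \<alpha> (profile c \<alpha> x)) (profile c \<alpha> x) (?g x) = - cost_rate c \<alpha> x"
    if x: "x \<in> {0..?T}" for x
  proof -
    define W where "W = 1 + \<alpha> * exp (c * x)"
    define E where "E = exp (c * x)"
    have W: "W > 0" unfolding W_def by (rule profile_domain[OF c x])
    have E: "E > 0" by (simp add: E_def)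
    have \<alpha>E: "\<alpha> * E = W - 1" by (simp add: W_def E_def)
    have d: "profile_dual c \<alpha> (profile c \<alpha> x) = - ln W"
      unfolding W_def by (rule profile_dual_profile[OF c x])
    have p: "profile c \<alpha> x = W / E * profile_gap c \<alpha> x" by (simp add: profile_def W_def E_def)
    show ?thesis
      unfolding dual_cost_def d cost_rate_def
      unfolding p W_def[symmetric] E_def[symmetric] \<alpha>E
      using W E by (simp add: exp_minus field_simps)
  qed
  then have "integral {0..?T} (\<lambda>x. dual_cost c (profile_dual c \<alpha> (profile c \<alpha> x)) (profile c \<alpha> x) (?g x))
      = integral {0..?T} (\<lambda>x. - cost_rate c \<alpha> x)"
    by (rule integral_cong)
  also have "\<dots> = - integral {0..?T} (cost_rate c \<alpha>)" by simp
  finally show ?thesis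
    using dual_cost_integral[OF T has_density_profile[OF c] equalityD1[OF profile_image[OF c]] _ profile_end[OF c]
        profile_dual_continuous_on[OF c] profile_dual_energy[OF c]] c by simp
qed

theorem profile_optimal:
  assumes c: "c > 0" "\<alpha> > -1" "\<alpha> \<noteq> 0" and y: "decreasing_trajectory (end_time c \<alpha>) y"
  shows "trajectory_cost c (end_time c \<alpha>) (profile c \<alpha>) \<le> trajectory_cost c (end_time c \<alpha>) y"
    and "trajectory_cost c (end_time c \<alpha>) y = trajectory_cost c (end_time c \<alpha>) (profile c \<alpha>)
          \<Longrightarrow> \<forall>x\<in>{0..end_time c \<alpha>}. y x = profile c \<alpha> x"
proof -
  let ?T = "end_time c \<alpha>" and ?V = "\<lambda>v. - 1 - c * v * exp (profile_dual c \<alpha> v)"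
  have T: "?T \<ge> 0" using exp_end_time(2)[OF c] by simp
  note \<theta> = profile_dual_continuous_on[OF c] profile_dual_energy[OF c]
  show "trajectory_cost c ?T (profile c \<alpha>) \<le> trajectory_cost c ?T y"
    using trajectory_cost_lower_bound[OF T y \<theta>]
    unfolding trajectory_cost_profile[OF c] profile_dual_integral[OF c] .
  assume eq: "trajectory_cost c ?T y = trajectory_cost c ?T (profile c \<alpha>)"
  have "integral {0..?T} (\<lambda>x. - cost_rate c \<alpha> x) \<ge> 0"
    using cost_rate_nonpos[OF c] has_integral_integrable[OF cost_rate_has_integral[OF c]]
    by (intro Henstock_Kurzweil_Integration.integral_nonneg integrable_neg) auto
  then have nonneg: "- integral {0..?T} (cost_rate c \<alpha>) \<ge> 0" by simp
  have nonneg': "integral {0..1} (profile_dual c \<alpha>) - (- ln (1 + \<alpha>) - c * \<alpha> / (1 + \<alpha>)) * ?T \<ge> 0"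
    unfolding profile_dual_integral[OF c] by (rule nonneg)
  have min: "trajectory_cost c ?T y
      = ennreal (integral {0..1} (profile_dual c \<alpha>) - (- ln (1 + \<alpha>) - c * \<alpha> / (1 + \<alpha>)) * ?T)"
    unfolding profile_dual_integral[OF c] eq by (rule trajectory_cost_profile[OF c])
  have ode: "(y has_real_derivative ?V (y x)) (at x within {0..?T})" if "x \<in> {0..?T}" for x
    by (rule trajectory_cost_minimal_imp_ode[OF T y \<theta> nonneg' min that])
  have ode': "(profile c \<alpha> has_real_derivative ?V (profile c \<alpha> x)) (at x within {0..?T})" if "x \<in> {0..?T}" for x
    unfolding profile_velocity[OF c that]
    by (rule has_field_derivative_at_within[OF profile_derivative[OF c profile_domain[OF c that]]])
  have V: "continuous_on {0..1} ?V" by (intro continuous_intros \<theta>(1))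
  have neg: "?V v < 0" if "v \<in> {0..1}" for v
  proof -
    have "c * v * exp (profile_dual c \<alpha> v) \<ge> 0"
      using that c(1) by (intro mult_nonneg_nonneg) auto
    then show ?thesis by linarith
  qed
  have "y 0 = profile c \<alpha> 0" using y c by (simp add: decreasing_trajectory_def)
  then show "\<forall>x\<in>{0..?T}. y x = profile c \<alpha> x"
    using autonomous_ode_unique[OF V neg ode decreasing_trajectory_range[OF y T] ode' equalityD1[OF profile_image[OF c]]]
    by blast
qed

section \<open>From trajectories to events of the greedy algorithm\<close>

lemma avail_at_antimono: "j \<le> k \<Longrightarrow> avail_at n \<omega> k \<subseteq> avail_at n \<omega> j"
  unfolding avail_at_def by (intro available_antimono set_take_subset_set_take)

lemma card_avail_at_antimono: "j \<le> k \<Longrightarrow> card (avail_at n \<omega> k) \<le> card (avail_at n \<omega> j)"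
  by (intro card_mono avail_at_antimono) (simp add: avail_at_def)

lemma size_profile_nth: "k \<le> n \<Longrightarrow> size_profile n \<omega> ! k = card (avail_at n \<omega> k)"
  by (simp add: size_profile_def del: upt_Suc)

lemma size_profile_in_chain:
  assumes "0 \<le> p" "p \<le> 1" "\<omega> \<in> set_pmf (greedy_law n p)"
  shows "size_profile n \<omega> \<in> set_pmf (thinning_chain (\<lambda>_. p) 0 n n)"
  using assms(3) by (simp flip: size_profile_law[OF assms(1,2)])

text \<open>
  The least element that defines \<open>greedy_size\<close> exists because every step removes a vertex, so nothing is
  available after \<open>n\<close> steps.
\<close>

lemma greedy_size_le_iff:
  assumes "0 \<le> p" "p \<le> 1" "\<omega> \<in> set_pmf (greedy_law n p)" "k \<le> n"
  shows "greedy_size n \<omega> \<le> k \<longleftrightarrow> size_profile n \<omega> ! k = 0"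
proof -
  have card_0: "card (avail_at n \<omega> j) = 0 \<longleftrightarrow> avail_at n \<omega> j = {}" for j
    by (simp add: avail_at_def)
  have "size_profile n \<omega> ! n = 0"
    using thinning_chain_decreasing[OF size_profile_in_chain[OF assms(1-3)], of 0 n]
      set_thinning_chain[OF size_profile_in_chain[OF assms(1-3)]] by simp
  then have "avail_at n \<omega> n = {}" using size_profile_nth[of n n \<omega>] card_0 by simp
  then have empty: "avail_at n \<omega> (greedy_size n \<omega>) = {}"
    unfolding greedy_size_def by (rule LeastI)
  have "greedy_size n \<omega> \<le> k \<longleftrightarrow> avail_at n \<omega> k = {}"
    using avail_at_antimono[of "greedy_size n \<omega>" k n \<omega>] empty
    by (auto simp: greedy_size_def intro: Least_le)
  then show ?thesis using size_profile_nth[OF assms(4)] card_0 by simp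
qed

lemma prob_size_profile_prefix:
  assumes p: "0 \<le> p" "p \<le> 1" and k: "k \<le> n"
    and P: "\<And>xs ys. take (Suc k) xs = take (Suc k) ys \<Longrightarrow> P xs \<longleftrightarrow> P ys"
  shows "measure_pmf.prob (greedy_law n p) {\<omega>. P (size_profile n \<omega>)}
       = measure_pmf.prob (thinning_chain (\<lambda>_. p) 0 n k) {xs. P xs}"
proof -
  have "measure_pmf.prob (thinning_chain (\<lambda>_. p) 0 n k) {xs. P xs}
      = measure_pmf.prob (map_pmf (take (Suc k)) (thinning_chain (\<lambda>_. p) 0 n (k + (n - k)))) {xs. P xs}"
    by (simp only: thinning_chain_take)
  also have "\<dots> = measure_pmf.prob (thinning_chain (\<lambda>_. p) 0 n n) {xs. P (take (Suc k) xs)}"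
    using k by (simp add: vimage_def)
  also have "{xs. P (take (Suc k) xs)} = {xs. P xs}"
    using P[of "take (Suc k) _"] by simp
  also have "measure_pmf.prob (thinning_chain (\<lambda>_. p) 0 n n) {xs. P xs}
      = measure_pmf.prob (map_pmf (size_profile n) (greedy_law n p)) {xs. P xs}"
    by (simp only: size_profile_law[OF p])
  also have "\<dots> = measure_pmf.prob (greedy_law n p) {\<omega>. P (size_profile n \<omega>)}"
    by (simp add: vimage_def)
  finally show ?thesis by simp
qed

lemma measure_pmf_mono_support:
  assumes "\<And>x. x \<in> set_pmf M \<Longrightarrow> x \<in> A \<Longrightarrow> x \<in> B"
  shows "measure_pmf.prob M A \<le> measure_pmf.prob M B"
  using assms by (intro measure_pmf.finite_measure_mono_AE) (auto simp: AE_measure_pmf_iff)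

lemma take_Suc_nth_eq: "take (Suc k) xs = take (Suc k) ys \<Longrightarrow> i \<le> k \<Longrightarrow> xs ! i = ys ! i"
  by (metis le_imp_less_Suc nth_take)

text \<open>
  The integral of \<open>\<ell>\<close>, in the form in which the tilting produces it.
\<close>

definition deviation_rate :: "real \<Rightarrow> real \<Rightarrow> real" where
  "deviation_rate c \<alpha> = ln (1 + \<alpha>) - log_weight_integral \<alpha> (c * end_time c \<alpha>) / c"

text \<open>
  In the upper tail, time \<open>k\<close> is at least one step before \<open>t n * n\<close>, so that a run of at least that length is still
  alive at time \<open>k\<close>.
\<close>

lemma deviation_prob_upper_bound:
  assumes c: "c > 0" "\<alpha> > -1" "\<alpha> \<noteq> 0" and s: "end_time c \<alpha> < 1"
    and crit: "\<alpha> < 0 \<longleftrightarrow> end_time c \<alpha> < s_crit c" "end_time c \<alpha> \<noteq> s_crit c"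
    and t: "t \<longlonglongrightarrow> end_time c \<alpha>" and e: "e > 0"
  shows "eventually (\<lambda>n. deviation_prob c n (t n) \<le> exp (real n * (deviation_rate c \<alpha> + e))) sequentially"
proof -
  let ?s = "end_time c \<alpha>"
  have s0: "?s > 0" by (rule exp_end_time(2)[OF c])
  define t' where "t' = (if \<alpha> < 0 then t else (\<lambda>n. t n - 1 / real n))"
  define k where "k = (\<lambda>n. nat \<lfloor>t' n * real n\<rfloor>)"
  have t': "t' \<longlonglongrightarrow> ?s"
    unfolding t'_def using t tendsto_diff[OF t lim_1_over_n] by simp
  have k: "(\<lambda>n. real (k n) / real n) \<longlonglongrightarrow> ?s"
    unfolding k_def by (rule nat_floor_div_tendsto[OF t']) (use s0 in simp)
  have D: "1 + \<alpha> * exp (c * ?s) > 0" using s0 by (intro profile_domain c) simp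
  have side: "eventually (\<lambda>n. t n < s_crit c \<longleftrightarrow> \<alpha> < 0) sequentially"
  proof (cases "\<alpha> < 0")
    case True
    then show ?thesis using order_tendstoD(2)[OF t, of "s_crit c"] crit by simp
  next
    case False
    then have "?s > s_crit c" using crit by simp
    from order_tendstoD(1)[OF t this] show ?thesis
      by eventually_elim (use False in simp)
  qed
  show ?thesis
    using tail_prob_upper_bound[OF c(1) k less_imp_le[OF s0] c(2,3) D e] side
      order_tendstoD(1)[OF t' s0] order_tendstoD(2)[OF t' s] order_tendstoD(1)[OF t s0] eventually_real_gt[of c]
      eventually_gt_at_top[of 0]
  proof eventually_elim
    case (elim n)
    have p: "0 \<le> c / real n" "c / real n \<le> 1" using elim c by auto
    have tn: "t' n * real n \<ge> 0" "t' n * real n \<le> real n" using elim by auto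
    have kn: "k n \<le> n" unfolding k_def using tn by linarith
    have kt: "real (k n) \<le> t' n * real n" "t' n * real n < real (k n) + 1"
      unfolding k_def using tn by linarith+
    have "deviation_prob c n (t n) \<le> measure_pmf.prob (greedy_law n (c / real n))
        {\<omega>. if \<alpha> < 0 then size_profile n \<omega> ! k n = 0 else size_profile n \<omega> ! k n > 0}"
      unfolding deviation_prob_def
    proof (rule measure_pmf_mono_support)
      fix \<omega> assume \<omega>: "\<omega> \<in> set_pmf (greedy_law n (c / real n))" "\<omega> \<in> deviation c n (t n)"
      note iff = greedy_size_le_iff[OF p \<omega>(1) kn]
      show "\<omega> \<in> {\<omega>. if \<alpha> < 0 then size_profile n \<omega> ! k n = 0 else size_profile n \<omega> ! k n > 0}"
      proof (cases "\<alpha> < 0")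
        case True
        then have "real (greedy_size n \<omega>) \<le> t' n * real n"
          using \<omega>(2) elim(2) by (simp add: deviation_def t'_def)
        then have "greedy_size n \<omega> \<le> k n" using kt by linarith
        then show ?thesis using iff True by simp
      next
        case False
        then have "real (greedy_size n \<omega>) \<ge> t n * real n"
          using \<omega>(2) elim(2) by (simp add: deviation_def)
        moreover have "t' n * real n = t n * real n - 1"
          using False elim(7) by (simp add: t'_def left_diff_distrib)
        ultimately have "\<not> greedy_size n \<omega> \<le> k n" using kt by linarith
        then show ?thesis using iff False by simp
      qed
    qed
    also have "\<dots> = measure_pmf.prob (thinning_chain (\<lambda>_. c / real n) 0 n (k n))
        {xs. if \<alpha> < 0 then xs ! k n = 0 else xs ! k n > 0}"
    proof (rule prob_size_profile_prefix[OF p kn])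
      fix xs ys :: "nat list" assume "take (Suc (k n)) xs = take (Suc (k n)) ys"
      from take_Suc_nth_eq[OF this order_refl]
      show "(if \<alpha> < 0 then xs ! k n = 0 else xs ! k n > 0) \<longleftrightarrow> (if \<alpha> < 0 then ys ! k n = 0 else ys ! k n > 0)"
        by simp
    qed
    also have "\<dots> \<le> exp (real n * (deviation_rate c \<alpha> + e))"
      using elim(1) by (simp add: deviation_rate_def)
    finally show ?case .
  qed
qed

text \<open>
  Between two grid points both functions are squeezed by monotonicity. Beyond the last grid point \<open>y\<close> is
  small, and \<open>f\<close> lies between 0 and its value there.
\<close>

lemma antimono_tube_grid:
  fixes y :: "real \<Rightarrow> real"
  assumes s: "s > 0" and y: "continuous_on {0..s} y" "antimono_on {0..s} y" "y s = 0" and e: "e > 0"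
  obtains G where "finite G" "G \<subseteq> {0..<s}"
    "\<forall>f. antimono_on {0..s} f \<longrightarrow> (\<forall>x\<in>{0..s}. f x \<ge> 0) \<longrightarrow>
       (\<forall>x\<in>G. \<bar>f x - y x\<bar> \<le> e / 2) \<longrightarrow> (\<forall>x\<in>{0..s}. \<bar>f x - y x\<bar> \<le> e)"
proof -
  have "uniformly_continuous_on {0..s} y" by (rule compact_uniformly_continuous[OF y(1)]) simp
  then obtain d where d: "d > 0"
    "\<And>v w. v \<in> {0..s} \<Longrightarrow> w \<in> {0..s} \<Longrightarrow> \<bar>v - w\<bar> < d \<Longrightarrow> \<bar>y v - y w\<bar> < e / 2"
    using e unfolding uniformly_continuous_on_def dist_real_def by (metis half_gt_zero abs_minus_commute)
  obtain N :: nat where N: "N > 0" "s / real N < d"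
    using reals_Archimedean2[of "s / d"] d(1) s
    by (metis divide_pos_pos gr0I linorder_not_less of_nat_0 of_nat_0_less_iff pos_divide_less_eq mult.commute less_asym)
  define h where "h = s / real N"
  have h: "h > 0" "h < d" "real N * h = s" using N s by (auto simp: h_def)
  show ?thesis
  proof (rule that[of "(\<lambda>i. real i * h) ` {..<N}"])
    show "(\<lambda>i. real i * h) ` {..<N} \<subseteq> {0..<s}"
    proof
      fix x assume "x \<in> (\<lambda>i. real i * h) ` {..<N}"
      then obtain i where i: "i < N" "x = real i * h" by blast
      have "real i * h < real N * h" using i h by (intro mult_strict_right_mono) auto
      then show "x \<in> {0..<s}" using i h by simp
    qed
    have "\<bar>f x - y x\<bar> \<le> e"
      if f: "antimono_on {0..s} f" "\<forall>x\<in>{0..s}. f x \<ge> 0"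
        "\<forall>x\<in>(\<lambda>i. real i * h) ` {..<N}. \<bar>f x - y x\<bar> \<le> e / 2" and x: "x \<in> {0..s}" for f x
    proof -
      have fm: "f w \<le> f v" and ym: "y w \<le> y v" if "v \<in> {0..s}" "w \<in> {0..s}" "v \<le> w" for v w
        using that monotone_onD[OF f(1), of v w] monotone_onD[OF y(2), of v w] by auto
      show ?thesis
      proof (cases "x = s")
        case True
        let ?l = "real (N - 1) * h"
        have "real (N - 1) = real N - 1" using N by simp
        then have ls: "?l = s - h" using h(3) by (simp only: left_diff_distrib mult_1)
        have "?l \<ge> 0" using h(1) by simp
        then have "s - h \<ge> 0" by (simp only: ls)
        then have l: "?l \<in> {0..s}" "\<bar>?l - s\<bar> < d"
          unfolding ls atLeastAtMost_iff using h(1,2) by linarith+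
        have "N - 1 \<in> {..<N}" using N by simp
        then have l': "?l \<in> (\<lambda>i. real i * h) ` {..<N}" by (rule imageI)
        have "\<bar>y ?l - y s\<bar> < e / 2" using l s by (intro d(2)) auto
        moreover have "f s \<le> f ?l" using l s by (intro fm) auto
        ultimately have "f s \<le> e" using bspec[OF f(3) l'] y(3) by linarith
        then show ?thesis using bspec[OF f(2), of s] s True y(3) by simp
      next
        case False
        \<comment> \<open>the grid point to the left of \<open>x\<close>\<close>
        define i where "i = nat \<lfloor>x / h\<rfloor>"
        have "x / h \<ge> 0" "x / h < real N"
          using x h False by (auto simp: pos_divide_less_eq)
        then have i: "real i \<le> x / h" "x / h < real i + 1" "i < N"
          unfolding i_def by linarith+
        then have ix: "real i * h \<le> x" "x < (real i + 1) * h"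
          using h by (auto simp: pos_le_divide_eq pos_divide_less_eq)
        have i0: "real i * h \<in> {0..s}" "real i * h \<in> (\<lambda>i. real i * h) ` {..<N}"
          using i ix x h by auto
        have yi: "\<bar>y (real i * h) - y x\<bar> < e / 2"
          using i0 x ix h by (intro d(2)) (auto simp: distrib_right)
        have fi: "f x \<le> f (real i * h)" using i0 x ix by (intro fm) auto
        have up: "f x - y x \<le> e" using yi fi bspec[OF f(3) i0(2)] by linarith
        have "- e \<le> f x - y x"
        proof (cases "Suc i < N")
          case True
          have j: "real (Suc i) * h \<in> (\<lambda>i. real i * h) ` {..<N}" using True by blast
          have "real (Suc i) * h \<le> real N * h" using True h by (intro mult_right_mono) auto
          then have j0: "real (Suc i) * h \<in> {0..s}" using h by simp
          have "\<bar>y (real (Suc i) * h) - y x\<bar> < e / 2"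
            using j0 x ix h by (intro d(2)) (auto simp: distrib_right)
          moreover have "f (real (Suc i) * h) \<le> f x" using j0 x ix by (intro fm) (auto simp: distrib_right)
          ultimately show ?thesis using bspec[OF f(3) j] by linarith
        next
          case False
          then have "real i + 1 = real N" using i(3) by linarith
          then have "(real i + 1) * h = s" using h(3) by simp
          then have "\<bar>y s - y x\<bar> < e / 2"
            using x ix h s by (intro d(2)) (auto simp: distrib_right)
          then show ?thesis using bspec[OF f(2) x] y(3) e by linarith
        qed
        with up show ?thesis by linarith
      qed
    qed
    then show "\<forall>f. antimono_on {0..s} f \<longrightarrow> (\<forall>x\<in>{0..s}. f x \<ge> 0) \<longrightarrow>
       (\<forall>x\<in>(\<lambda>i. real i * h) ` {..<N}. \<bar>f x - y x\<bar> \<le> e / 2) \<longrightarrow> (\<forall>x\<in>{0..s}. \<bar>f x - y x\<bar> \<le> e)"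
      by blast
  qed auto
qed

text \<open>
  A fixed domain of integration makes joint continuity in both parameters available.
\<close>

lemma log_weight_integral_rescaled:
  assumes "\<alpha> > -1" "1 + \<alpha> * exp v > 0" "v \<ge> 0"
  shows "log_weight_integral \<alpha> v = v * integral {0..1} (\<lambda>t. ln (1 + \<alpha> * exp (v * t)))"
proof -
  have im: "(*) v ` {0..1} \<subseteq> {0..v}" using assms(3) by (auto intro: mult_left_le)
  have "((\<lambda>t. ln (1 + \<alpha> * exp (v * t)) * v) has_integral log_weight_integral \<alpha> (v * 1) - log_weight_integral \<alpha> (v * 0)) {0..1}"
  proof (rule fundamental_theorem_of_calculus)
    fix t :: real assume t: "t \<in> {0..1}"
    have "(log_weight_integral \<alpha> has_real_derivative ln (1 + \<alpha> * exp (v * t))) (at (v * t) within (*) v ` {0..1})"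
      by (rule has_field_derivative_subset[OF log_weight_integral_derivative[OF assms(1,2)] im])
        (rule subsetD[OF im imageI[OF t]])
    from DERIV_image_chain[OF this, of v]
    have "((\<lambda>t. log_weight_integral \<alpha> (v * t)) has_real_derivative ln (1 + \<alpha> * exp (v * t)) * v) (at t within {0..1})"
      by (simp add: o_def)
    then show "((\<lambda>t. log_weight_integral \<alpha> (v * t)) has_vector_derivative ln (1 + \<alpha> * exp (v * t)) * v) (at t within {0..1})"
      by (rule has_real_derivative_iff_has_vector_derivative[THEN iffD1])
  qed simp
  from integral_unique[OF this] show ?thesis by (simp add: mult.commute)
qed

lemma log_weight_integral_tendsto:
  assumes \<alpha>: "(a \<longlongrightarrow> \<alpha>) F" "\<alpha> > -1" and v: "(b \<longlongrightarrow> v) F" "v > 0" and D: "1 + \<alpha> * exp v > 0"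
  shows "((\<lambda>m. log_weight_integral (a m) (b m)) \<longlongrightarrow> log_weight_integral \<alpha> v) F"
proof -
  define U where "U = {(\<alpha>, v). \<alpha> > -1 \<and> 1 + \<alpha> * exp v > 0 \<and> v \<ge> (0::real)}"
  have pos: "1 + \<alpha> * exp (v * t) > 0" if "(\<alpha>, v) \<in> U" "t \<in> {0..1}" for \<alpha> v t
  proof (rule weight_pos)
    show "\<alpha> > -1" "1 + \<alpha> * exp v > 0" using that(1) by (simp_all add: U_def)
    have "v * t \<le> v * 1" using that by (intro mult_left_mono) (auto simp: U_def)
    then show "v * t \<in> {0..v}" using that by (simp add: U_def)
  qed
  have "continuous_on (U \<times> cbox 0 1) (\<lambda>(z, t). ln (1 + fst z * exp (snd z * t)))"
    unfolding case_prod_unfold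
  proof (intro continuous_intros ballI)
    fix z :: "(real \<times> real) \<times> real" assume "z \<in> U \<times> cbox 0 1"
    then have "1 + fst (fst z) * exp (snd (fst z) * snd z) > 0"
      by (intro pos) (auto simp: cbox_interval)
    then show "1 + fst (fst z) * exp (snd (fst z) * snd z) \<noteq> 0" by simp
  qed
  from integral_continuous_on_param[OF this]
  have cont: "continuous_on U (\<lambda>z. integral {0..1} (\<lambda>t. ln (1 + fst z * exp (snd z * t))))"
    by (simp add: cbox_interval)
  have "((\<lambda>m. 1 + a m * exp (b m)) \<longlongrightarrow> 1 + \<alpha> * exp v) F" by (intro tendsto_intros \<alpha> v)
  from order_tendstoD(1)[OF this D] order_tendstoD(1)[OF \<alpha>] order_tendstoD(1)[OF v]
  have ev: "eventually (\<lambda>m. (a m, b m) \<in> U) F"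
    by eventually_elim (simp add: U_def)
  have "((\<lambda>m. integral {0..1} (\<lambda>t. ln (1 + fst (a m, b m) * exp (snd (a m, b m) * t))))
      \<longlongrightarrow> integral {0..1} (\<lambda>t. ln (1 + fst (\<alpha>, v) * exp (snd (\<alpha>, v) * t)))) F"
    by (rule continuous_on_tendsto_compose[OF cont]) (use \<alpha> v D ev in \<open>auto intro: tendsto_Pair simp: U_def\<close>)
  then have "((\<lambda>m. b m * integral {0..1} (\<lambda>t. ln (1 + a m * exp (b m * t))))
      \<longlongrightarrow> v * integral {0..1} (\<lambda>t. ln (1 + \<alpha> * exp (v * t)))) F"
    by (intro tendsto_mult v) simp
  also have "v * integral {0..1} (\<lambda>t. ln (1 + \<alpha> * exp (v * t))) = log_weight_integral \<alpha> v"
    using \<alpha> v D by (intro log_weight_integral_rescaled[symmetric]) auto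
  finally show ?thesis
  proof (rule Lim_transform_eventually)
    show "eventually (\<lambda>m. b m * integral {0..1} (\<lambda>t. ln (1 + a m * exp (b m * t))) = log_weight_integral (a m) (b m)) F"
      using ev by eventually_elim (auto simp: U_def log_weight_integral_rescaled)
  qed
qed

lemma profile_tendsto:
  assumes c: "c > 0" and \<alpha>: "(a \<longlongrightarrow> \<alpha>) F" "\<alpha> > -1" "\<alpha> \<noteq> 0" and x: "(b \<longlongrightarrow> x) F" and D: "1 + \<alpha> * exp (c * x) > 0"
  shows "((\<lambda>m. profile c (a m) (b m)) \<longlongrightarrow> profile c \<alpha> x) F"
  unfolding profile_def profile_gap_def using assms
  by (intro tendsto_intros) auto

section \<open>Lower bound and conclusion\<close>

lemma profile_small_before_end:
  assumes c: "c > 0" "\<alpha> > -1" "\<alpha> \<noteq> 0" and "l < end_time c \<alpha>" "q > 0"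
  obtains x where "l < x" "x < end_time c \<alpha>" "profile c \<alpha> x < q"
proof -
  let ?T = "end_time c \<alpha>"
  have "?T \<in> {0..?T}" using exp_end_time(2)[OF c] by simp
  from DERIV_isCont[OF profile_derivative[OF c profile_domain[OF c this]]]
  have "(profile c \<alpha> \<longlongrightarrow> 0) (at_left ?T)"
    using profile_end[OF c] by (simp add: isCont_def filterlim_at_split)
  from order_tendstoD(2)[OF this assms(5)] eventually_at_left_real[OF assms(4)]
  have "eventually (\<lambda>x. profile c \<alpha> x < q \<and> x \<in> {l<..<?T}) (at_left ?T)"
    by eventually_elim simp
  from eventually_happens[OF this] show ?thesis using that by auto
qed

text \<open>
  In the lower tail a chain that is extinct too early is needed: \<open>\<beta> < \<alpha>\<close>, and at time \<open>x\<close> so few vertices are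
  left that even one removal per step finishes before time \<open>s\<close>. In the upper tail \<open>\<beta> > \<alpha>\<close>, and the chain
  is still alive at a time \<open>x > s\<close>. As \<open>\<beta>\<close> tends to \<open>\<alpha>\<close>, everything tends to its value at \<open>(\<alpha>, s)\<close>.
\<close>

lemma tilt_parameters_exist:
  assumes c: "c > 0" "\<alpha> > -1" "\<alpha> \<noteq> 0" and s1: "end_time c \<alpha> < 1"
    and G: "finite G" "G \<subseteq> {0..<end_time c \<alpha>}" and e: "e > 0"
  obtains \<beta> x \<eta> where "\<beta> > -1" "\<beta> \<noteq> 0" "0 \<le> x" "x < 1" "1 + \<beta> * exp (c * x) > 0" "profile_gap c \<beta> x > 0"
    "\<eta> > 0" "\<eta> \<le> e" "G \<subseteq> {0..x}" "\<And>z. z \<in> G \<Longrightarrow> \<bar>profile c \<beta> z - profile c \<alpha> z\<bar> \<le> e"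
    "ln (1 + \<beta>) - log_weight_integral \<beta> (c * x) / c
       - max 0 (ln (1 + \<beta> * exp (c * x))) * (profile c \<beta> x + \<eta>) - \<eta> > deviation_rate c \<alpha> - e"
    "\<alpha> < 0 \<Longrightarrow> x + profile c \<beta> x + \<eta> < end_time c \<alpha>" "\<alpha> > 0 \<Longrightarrow> x > end_time c \<alpha>"
proof -
  define s where "s = end_time c \<alpha>"
  have s0: "s > 0" unfolding s_def by (rule exp_end_time(2)[OF c])
  have sD: "1 + \<alpha> * exp (c * s) > 0" using s0 by (intro profile_domain c) (simp add: s_def)
  have GD: "1 + \<alpha> * exp (c * z) > 0" if "z \<in> G" for z
    using that G by (intro profile_domain c) (auto simp: less_imp_le)
  \<comment> \<open>parameters approaching \<open>\<alpha>\<close> from the side on which extinction is more atypical\<close>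
  define a where "a = (\<lambda>m. \<alpha> + (if \<alpha> < 0 then - 1 else 1) / real (Suc m))"
  define T where "T = (\<lambda>m. end_time c (a m))"
  define \<eta> where "\<eta> = (\<lambda>m. \<bar>s - T m\<bar> / 4)"
  have inv: "(\<lambda>m. d / real (Suc m)) \<longlonglongrightarrow> 0" for d :: real
    using tendsto_mult[OF tendsto_const[of d] LIMSEQ_inverse_real_of_nat] by (simp add: divide_inverse)
  have a: "a \<longlonglongrightarrow> \<alpha>"
    unfolding a_def using tendsto_add[OF tendsto_const inv, of \<alpha>] by simp
  have T: "T \<longlonglongrightarrow> s"
    unfolding T_def s_def using isCont_tendsto_compose[OF isCont_end_time[OF c] a] .
  define good where "good = (\<lambda>m. a m > -1 \<and> a m \<noteq> 0)"
  have good: "eventually good sequentially"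
    using order_tendstoD(1)[OF a c(2)] tendsto_imp_eventually_ne[OF a c(3)]
    by eventually_elim (simp add: good_def)
  have side: "\<alpha> < 0 \<Longrightarrow> T m < s" "\<alpha> > 0 \<Longrightarrow> T m > s" if "good m" for m
  proof -
    assume "\<alpha> < 0"
    then have "a m < \<alpha>" by (simp add: a_def)
    then show "T m < s" unfolding T_def s_def using that c by (intro end_time_strict_mono) (auto simp: good_def)
  next
    assume "\<alpha> > 0"
    then have "a m > \<alpha>" by (simp add: a_def)
    then show "T m > s" unfolding T_def s_def using that c by (intro end_time_strict_mono) (auto simp: good_def)
  qed
  have ne: "T m \<noteq> s" if "good m" for m
    using side[OF that] c(3) by (cases "\<alpha> < 0") auto
  \<comment> \<open>a lower bound for the end of the time window, close to extinction and beyond \<open>s\<close> in the upper tail\<close>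
  define l where "l = (\<lambda>m. max (T m - 1 / real (Suc m)) (if \<alpha> < 0 then 0 else s))"
  have lT: "l m < T m" if "good m" for m
    using side[OF that] c exp_end_time(2)[OF c(1), of "a m"] that
    by (cases "\<alpha> < 0") (auto simp: l_def good_def T_def)
  have "\<exists>x. good m \<longrightarrow> l m < x \<and> x < T m \<and> profile c (a m) x < \<bar>s - T m\<bar> / 2" for m
  proof (cases "good m")
    case True
    then have am: "a m > -1" "a m \<noteq> 0" by (auto simp: good_def)
    obtain x where "l m < x" "x < end_time c (a m)" "profile c (a m) x < \<bar>s - T m\<bar> / 2"
      using profile_small_before_end[OF c(1) am, of "l m" "\<bar>s - T m\<bar> / 2"] lT[OF True] ne[OF True]
      by (auto simp: T_def)
    then show ?thesis by (auto simp: T_def)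
  qed simp
  then obtain x where x: "\<And>m. good m \<Longrightarrow> l m < x m \<and> x m < T m \<and> profile c (a m) (x m) < \<bar>s - T m\<bar> / 2"
    by metis
  have xs: "x \<longlonglongrightarrow> s"
  proof (rule tendsto_sandwich)
    show "(\<lambda>m. T m - 1 / real (Suc m)) \<longlonglongrightarrow> s" using tendsto_diff[OF T inv[of 1]] by simp
    show "eventually (\<lambda>m. T m - 1 / real (Suc m) \<le> x m) sequentially"
      using good by eventually_elim (use x in \<open>force simp: l_def\<close>)
    show "eventually (\<lambda>m. x m \<le> T m) sequentially"
      using good by eventually_elim (use x in force)
  qed (rule T)
  have \<eta>0: "\<eta> \<longlonglongrightarrow> 0"
  proof -
    have "\<eta> \<longlonglongrightarrow> \<bar>s - s\<bar> / 4" unfolding \<eta>_def by (intro tendsto_intros T) simp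
    then show ?thesis by simp
  qed
  have prof: "(\<lambda>m. profile c (a m) (x m)) \<longlonglongrightarrow> 0"
    using profile_tendsto[OF c(1) a c(2,3) xs sD] profile_end[OF c] by (simp add: s_def)
  have "(\<lambda>m. ln (1 + a m) - log_weight_integral (a m) (c * x m) / c
       - max 0 (ln (1 + a m * exp (c * x m))) * (profile c (a m) (x m) + \<eta> m) - \<eta> m)
     \<longlonglongrightarrow> ln (1 + \<alpha>) - log_weight_integral \<alpha> (c * s) / c
       - max 0 (ln (1 + \<alpha> * exp (c * s))) * (0 + 0) - 0"
    using c s0 sD by (intro tendsto_intros a xs prof \<eta>0 log_weight_integral_tendsto) auto
  then have "(\<lambda>m. ln (1 + a m) - log_weight_integral (a m) (c * x m) / c
       - max 0 (ln (1 + a m * exp (c * x m))) * (profile c (a m) (x m) + \<eta> m) - \<eta> m) \<longlonglongrightarrow> deviation_rate c \<alpha>"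
    by (simp add: deviation_rate_def s_def)
  from order_tendstoD(1)[OF this, of "deviation_rate c \<alpha> - e"] e
  have rate: "eventually (\<lambda>m. ln (1 + a m) - log_weight_integral (a m) (c * x m) / c
       - max 0 (ln (1 + a m * exp (c * x m))) * (profile c (a m) (x m) + \<eta> m) - \<eta> m > deviation_rate c \<alpha> - e) sequentially"
    by simp
  have Gx: "eventually (\<lambda>m. \<forall>z\<in>G. z < x m) sequentially"
    using G by (intro eventually_ball_finite ballI order_tendstoD(1)[OF xs]) (auto simp: s_def)
  have Gp: "eventually (\<lambda>m. \<forall>z\<in>G. \<bar>profile c (a m) z - profile c \<alpha> z\<bar> < e) sequentially"
  proof (intro eventually_ball_finite ballI G)
    fix z assume "z \<in> G"
    from profile_tendsto[OF c(1) a c(2,3) tendsto_const GD[OF this]]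
    show "eventually (\<lambda>m. \<bar>profile c (a m) z - profile c \<alpha> z\<bar> < e) sequentially"
      using e unfolding tendsto_iff dist_real_def by blast
  qed
  have "eventually (\<lambda>m. good m \<and> x m < 1 \<and> x m > 0 \<and> \<eta> m < e \<and> (\<forall>z\<in>G. z < x m) \<and>
      (\<forall>z\<in>G. \<bar>profile c (a m) z - profile c \<alpha> z\<bar> < e) \<and>
      ln (1 + a m) - log_weight_integral (a m) (c * x m) / c
       - max 0 (ln (1 + a m * exp (c * x m))) * (profile c (a m) (x m) + \<eta> m) - \<eta> m > deviation_rate c \<alpha> - e) sequentially"
    using good order_tendstoD(2)[OF xs, of 1] order_tendstoD(1)[OF xs s0] order_tendstoD(2)[OF \<eta>0 e] Gx Gp rate s1
    by (simp add: eventually_conj_iff s_def)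
  from eventually_happens[OF this] obtain m where m: "good m" "x m < 1" "x m > 0" "\<eta> m < e" "\<forall>z\<in>G. z < x m"
      "\<forall>z\<in>G. \<bar>profile c (a m) z - profile c \<alpha> z\<bar> < e"
      "ln (1 + a m) - log_weight_integral (a m) (c * x m) / c
       - max 0 (ln (1 + a m * exp (c * x m))) * (profile c (a m) (x m) + \<eta> m) - \<eta> m > deviation_rate c \<alpha> - e"
    by auto
  have am: "a m > -1" "a m \<noteq> 0" using m(1) by (auto simp: good_def)
  note xm = x[OF m(1)]
  show ?thesis
  proof (rule that[of "a m" "x m" "\<eta> m"])
    show "1 + a m * exp (c * x m) > 0"
      using xm m(3) by (intro profile_domain c(1) am) (auto simp: T_def)
    show "profile_gap c (a m) (x m) > 0"
      using xm m(3) by (intro profile_gap_pos c(1) am) (auto simp: T_def)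
    show "\<eta> m > 0" using ne[OF m(1)] by (simp add: \<eta>_def)
    show "G \<subseteq> {0..x m}" using m(5) G by (auto simp: less_imp_le)
    show "x m + profile c (a m) (x m) + \<eta> m < end_time c \<alpha>" if "\<alpha> < 0"
    proof -
      have "x m < T m" "profile c (a m) (x m) < \<bar>s - T m\<bar> / 2" using xm by auto
      moreover have "\<bar>s - T m\<bar> = s - T m" "T m < s" using side(1)[OF m(1) that] by simp_all
      moreover have "u + p + (v - w) / 4 < v" if "u < w" "p < (v - w) / 2" "w < v" for u p v w :: real
        using that by (simp add: field_simps)
      ultimately show ?thesis unfolding \<eta>_def s_def[symmetric] by simp
    qed
    show "x m > end_time c \<alpha>" if "\<alpha> > 0"
      using xm that by (auto simp: l_def s_def)
  qed (use am m in \<open>auto simp: less_imp_le\<close>)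
qed

text \<open>
  The tilted event fixes the sizes at grid times up to \<open>x\<close>. The tube over the rest of the interval and the
  time of termination then follow from monotonicity.
\<close>

lemma deviation_tube_lower_bound:
  assumes c: "c > 0" "\<alpha> > -1" "\<alpha> \<noteq> 0" and s: "end_time c \<alpha> < 1"
    and crit: "\<alpha> < 0 \<longleftrightarrow> end_time c \<alpha> < s_crit c" "end_time c \<alpha> \<noteq> s_crit c"
    and t: "t \<longlonglongrightarrow> end_time c \<alpha>" and \<epsilon>: "\<epsilon> > 0" and e: "e > 0"
  shows "eventually (\<lambda>n. measure_pmf.prob (greedy_law n (c / real n))
            (deviation c n (t n) \<inter> tube n (end_time c \<alpha>) (profile c \<alpha>) \<epsilon>)
          \<ge> exp (real n * (deviation_rate c \<alpha> - e))) sequentially"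
proof -
  let ?s = "end_time c \<alpha>"
  have s0: "?s > 0" by (rule exp_end_time(2)[OF c])
  have mono: "antimono_on {0..?s} (profile c \<alpha>)"
    using decreasing_trajectory_profile[OF c] by (simp add: decreasing_trajectory_def)
  obtain G where G: "finite G" "G \<subseteq> {0..<?s}"
    "\<forall>f. antimono_on {0..?s} f \<longrightarrow> (\<forall>x\<in>{0..?s}. f x \<ge> 0) \<longrightarrow>
       (\<forall>x\<in>G. \<bar>f x - profile c \<alpha> x\<bar> \<le> \<epsilon> / 2) \<longrightarrow> (\<forall>x\<in>{0..?s}. \<bar>f x - profile c \<alpha> x\<bar> \<le> \<epsilon>)"
    using antimono_tube_grid[OF s0 profile_continuous_on[OF c] mono profile_end[OF c] \<epsilon>] .
  define e' where "e' = min e (\<epsilon> / 4)"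
  have e': "e' > 0" "e' \<le> e" "e' \<le> \<epsilon> / 4" using e \<epsilon> by (auto simp: e'_def)
  obtain \<beta> x \<eta> where \<beta>: "\<beta> > -1" "\<beta> \<noteq> 0" and x: "0 \<le> x" "x < 1" and D: "1 + \<beta> * exp (c * x) > 0"
    and gap: "profile_gap c \<beta> x > 0" and \<eta>: "\<eta> > 0" "\<eta> \<le> e'" and Gx: "G \<subseteq> {0..x}"
    and Gp: "\<And>z. z \<in> G \<Longrightarrow> \<bar>profile c \<beta> z - profile c \<alpha> z\<bar> \<le> e'"
    and rate: "ln (1 + \<beta>) - log_weight_integral \<beta> (c * x) / c
       - max 0 (ln (1 + \<beta> * exp (c * x))) * (profile c \<beta> x + \<eta>) - \<eta> > deviation_rate c \<alpha> - e'"
    and low: "\<alpha> < 0 \<Longrightarrow> x + profile c \<beta> x + \<eta> < ?s" and up: "\<alpha> > 0 \<Longrightarrow> x > ?s"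
    using tilt_parameters_exist[OF c s G(1,2) e'(1)] by metis
  have side: "eventually (\<lambda>n. (t n < s_crit c \<longleftrightarrow> \<alpha> < 0) \<and>
      (\<alpha> < 0 \<longrightarrow> x + profile c \<beta> x + \<eta> < t n) \<and> (\<alpha> > 0 \<longrightarrow> t n < x)) sequentially"
  proof (cases "\<alpha> < 0")
    case True
    then have "?s < s_crit c" using crit by simp
    from order_tendstoD(2)[OF t this] order_tendstoD(1)[OF t low[OF True]] show ?thesis
      by eventually_elim (use True in simp)
  next
    case False
    then have "?s > s_crit c" "\<alpha> > 0" using crit c by simp_all
    from order_tendstoD(1)[OF t this(1)] order_tendstoD(2)[OF t up[OF this(2)]] show ?thesis
      by eventually_elim (use False in simp)
  qed
  show ?thesis
    using chain_tube_lower_bound[OF c(1) x(1) \<beta> D gap G(1) Gx \<eta>(1)] side eventually_real_gt[of c] eventually_gt_at_top[of 0]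
  proof eventually_elim
    case (elim n)
    define k where "k = nat \<lfloor>x * real n\<rfloor>"
    define P where "P = (\<lambda>xs :: nat list. (\<forall>z\<in>insert x G. \<bar>real (xs ! nat \<lfloor>z * real n\<rfloor>) / real n - profile c \<beta> z\<bar> \<le> \<eta>) \<and> xs ! k > 0)"
    have p: "0 \<le> c / real n" "c / real n \<le> 1" using elim c by auto
    have n: "real n > 0" using elim by simp
    have idx: "nat \<lfloor>z * real n\<rfloor> \<le> n" if "z < 1" for z
    proof -
      have "z * real n \<le> real n" using that n by simp
      then show ?thesis by linarith
    qed
    have kn: "k \<le> n" unfolding k_def by (rule idx[OF x(2)])
    have kx: "real k \<le> x * real n" "x * real n < real k + 1"
      unfolding k_def using x n by (simp_all add: mult_nonneg_nonneg) 
    have "exp (real n * (deviation_rate c \<alpha> - e)) \<le> exp (real n * (ln (1 + \<beta>) - log_weight_integral \<beta> (c * x) / c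
       - max 0 (ln (1 + \<beta> * exp (c * x))) * (profile c \<beta> x + \<eta>) - \<eta>))"
      unfolding exp_le_cancel_iff using rate e'(2) n by (intro mult_left_mono) auto
    also have "\<dots> \<le> measure_pmf.prob (thinning_chain (\<lambda>_. c / real n) 0 n k) {xs. P xs}"
      using elim(1) by (simp add: P_def k_def)
    also have "\<dots> = measure_pmf.prob (greedy_law n (c / real n)) {\<omega>. P (size_profile n \<omega>)}"
    proof (rule prob_size_profile_prefix[OF p kn, symmetric])
      fix xs ys :: "nat list" assume eq: "take (Suc k) xs = take (Suc k) ys"
      have "xs ! nat \<lfloor>z * real n\<rfloor> = ys ! nat \<lfloor>z * real n\<rfloor>" if "z \<in> insert x G" for z
      proof -
        have "z \<le> x" using that Gx by auto
        then have "nat \<lfloor>z * real n\<rfloor> \<le> k" unfolding k_def by (intro nat_mono floor_mono mult_right_mono) auto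
        with take_Suc_nth_eq[OF eq] show ?thesis by blast
      qed
      then show "P xs \<longleftrightarrow> P ys"
        unfolding P_def using take_Suc_nth_eq[OF eq order_refl] by simp
    qed
    also have "\<dots> \<le> measure_pmf.prob (greedy_law n (c / real n))
            (deviation c n (t n) \<inter> tube n ?s (profile c \<alpha>) \<epsilon>)"
    proof (rule measure_pmf_mono_support)
      fix \<omega> assume \<omega>: "\<omega> \<in> set_pmf (greedy_law n (c / real n))" "\<omega> \<in> {\<omega>. P (size_profile n \<omega>)}"
      define f where "f = (\<lambda>z. real (card (avail_at n \<omega> (nat \<lfloor>z * real n\<rfloor>))) / real n)"
      have close: "\<bar>real (size_profile n \<omega> ! nat \<lfloor>z * real n\<rfloor>) / real n - profile c \<beta> z\<bar> \<le> \<eta>" if "z \<in> insert x G" for z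
        using \<omega>(2) that unfolding P_def by blast
      have alive: "size_profile n \<omega> ! k > 0" using \<omega>(2) by (simp add: P_def)
      have "\<forall>z\<in>{0..?s}. \<bar>f z - profile c \<alpha> z\<bar> \<le> \<epsilon>"
      proof (rule G(3)[THEN spec, THEN mp, THEN mp, THEN mp]; (intro ballI)?)
        show "antimono_on {0..?s} f"
        proof (rule monotone_onI)
          fix v w assume "v \<in> {0..?s}" "w \<in> {0..?s}" "v \<le> w"
          then have "nat \<lfloor>v * real n\<rfloor> \<le> nat \<lfloor>w * real n\<rfloor>" by (intro nat_mono floor_mono mult_right_mono) auto
          then show "f w \<le> f v"
            unfolding f_def by (intro divide_right_mono) (auto intro: card_avail_at_antimono)
        qed
        show "\<And>v. v \<in> {0..?s} \<Longrightarrow> f v \<ge> 0" by (simp add: f_def)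
        fix v assume v: "v \<in> G"
        then have "v < 1" using G(2) s by auto
        then have "f v = real (size_profile n \<omega> ! nat \<lfloor>v * real n\<rfloor>) / real n"
          by (simp add: f_def size_profile_nth idx)
        moreover have "\<bar>real (size_profile n \<omega> ! nat \<lfloor>v * real n\<rfloor>) / real n - profile c \<beta> v\<bar> \<le> \<eta>"
          using v by (intro close) simp
        ultimately show "\<bar>f v - profile c \<alpha> v\<bar> \<le> \<epsilon> / 2"
          using Gp[OF v] \<eta>(2) e'(3) by linarith
      qed
      then have "\<omega> \<in> tube n ?s (profile c \<alpha>) \<epsilon>" by (simp add: tube_def f_def)
      moreover have "\<omega> \<in> deviation c n (t n)"
      proof (cases "\<alpha> < 0")
        case True
        let ?N = "size_profile n \<omega> ! k"
        have "real ?N / real n \<le> profile c \<beta> x + \<eta>" using close[of x] by (simp add: k_def)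
        then have "real ?N \<le> (profile c \<beta> x + \<eta>) * real n" using n by (simp add: pos_divide_le_eq)
        then have *: "real (k + ?N) \<le> (x + profile c \<beta> x + \<eta>) * real n"
          using kx by (simp add: algebra_simps)
        also have "\<dots> \<le> 1 * real n" using low[OF True] s n by (intro mult_right_mono) auto
        finally have kN: "k + ?N \<le> n" by simp
        have "size_profile n \<omega> ! (k + ?N) = 0"
          using thinning_chain_decreasing[OF size_profile_in_chain[OF p \<omega>(1)], of k "k + ?N"] kN by simp
        then have "greedy_size n \<omega> \<le> k + ?N" using greedy_size_le_iff[OF p \<omega>(1) kN] by simp
        then have "real (greedy_size n \<omega>) \<le> (x + profile c \<beta> x + \<eta>) * real n" using * by linarith
        also have "\<dots> \<le> t n * real n" using elim(2) True n by (intro mult_right_mono) auto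
        finally show ?thesis using elim(2) True by (simp add: deviation_def)
      next
        case False
        have "\<not> greedy_size n \<omega> \<le> k" using alive greedy_size_le_iff[OF p \<omega>(1) kn] by simp
        then have "real (greedy_size n \<omega>) \<ge> x * real n" using kx by linarith
        moreover have "t n * real n \<le> x * real n" using elim(2) False c n by (intro mult_right_mono) auto
        ultimately show ?thesis using elim(2) False by (simp add: deviation_def)
      qed
      ultimately show "\<omega> \<in> deviation c n (t n) \<inter> tube n ?s (profile c \<alpha>) \<epsilon>" by simp
    qed
    finally show ?case .
  qed
qed

lemma log_prob_tendsto:
  fixes P :: "nat \<Rightarrow> real"
  assumes "\<And>e. e > 0 \<Longrightarrow> eventually (\<lambda>n. P n \<le> exp (real n * (R + e))) sequentially"
    and "\<And>e. e > 0 \<Longrightarrow> eventually (\<lambda>n. P n \<ge> exp (real n * (R - e))) sequentially"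
  shows "(\<lambda>n. 1 / real n * ln (P n)) \<longlonglongrightarrow> R"
proof (rule tendstoI)
  fix e :: real assume "e > 0"
  then have "e / 2 > 0" by simp
  from assms(1)[OF this] assms(2)[OF this] eventually_gt_at_top[of 0]
  show "eventually (\<lambda>n. dist (1 / real n * ln (P n)) R < e) sequentially"
  proof eventually_elim
    case (elim n)
    have pos: "P n > 0" using elim(2) exp_gt_zero less_le_trans by blast
    have "ln (P n) \<le> real n * (R + e / 2)" "ln (P n) \<ge> real n * (R - e / 2)"
      using elim pos by (metis ln_exp ln_le_cancel_iff exp_gt_zero)+
    then have "1 / real n * ln (P n) \<le> R + e / 2" "1 / real n * ln (P n) \<ge> R - e / 2"
      using elim(3) by (simp_all add: field_simps)
    then show ?case using \<open>e > 0\<close> by (simp add: dist_real_def)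
  qed
qed

theorem theorem2:
  fixes c s :: real
  assumes "c > 0" and "0 < s" and "s < 1" and "s \<noteq> s_crit c"
  shows
    "(strict_antimono_on {0..s} (y_hat c s) \<and> y_hat c s 0 = 1 \<and> y_hat c s s = 0
      \<and> (\<forall>x\<in>{0..s}. y_hat c s differentiable (at x))
      \<and> (\<forall>y. decreasing_trajectory s y \<longrightarrow>
             trajectory_cost c s (y_hat c s) \<le> trajectory_cost c s y
           \<and> (trajectory_cost c s y = trajectory_cost c s (y_hat c s)
                \<longrightarrow> (\<forall>x\<in>{0..s}. y x = y_hat c s x))))
   \<and> (\<forall>t :: nat \<Rightarrow> real. \<forall>\<epsilon>>0. t \<longlonglongrightarrow> s \<longrightarrow>
        (\<lambda>n. 1 / real n * ln (measure_pmf.prob (greedy_law n (c / real n))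
                                (deviation c n (t n) \<inter> tube n s (y_hat c s) \<epsilon>)))
          \<longlonglongrightarrow> integral {0..s} (ell c s))
   \<and> (\<forall>t :: nat \<Rightarrow> real. t \<longlonglongrightarrow> s \<longrightarrow>
        (\<lambda>n. 1 / real n * ln (deviation_prob c n (t n))) \<longlonglongrightarrow> integral {0..s} (ell c s))
   \<and> (\<forall>x\<in>{0..s}. ell c s x =
        (let a = a_param c s in
         (ln ((1 + (a - 1) * exp (c * x)) / a) - c * (a - 1) / a) *
         (1 - ln (1 + (a - 1) * exp (c * x)) / ((a - 1) * exp (c * x)))))
   \<and> (\<forall>x\<in>{0..s}. ereal (ell c s x) = - local_cost c (y_hat c s x) (deriv (y_hat c s) x))
   \<and> ell c s integrable_on {0..s}
   \<and> trajectory_cost c s (y_hat c s) = ennreal (- integral {0..s} (ell c s))"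
proof -
  note a = a_param_properties[OF assms]
  define \<alpha> where "\<alpha> = a_param c s - 1"
  have c: "c > 0" "\<alpha> > -1" "\<alpha> \<noteq> 0" using a assms by (auto simp: \<alpha>_def)
  have s: "end_time c \<alpha> = s" using a by (simp add: \<alpha>_def)
  have y: "y_hat c s = profile c \<alpha>" by (simp add: y_hat_eq_profile \<alpha>_def)
  have crit: "\<alpha> < 0 \<longleftrightarrow> end_time c \<alpha> < s_crit c" "end_time c \<alpha> \<noteq> s_crit c"
    using a assms(4) by (simp_all add: \<alpha>_def)
  have s1: "end_time c \<alpha> < 1" using assms(3) s by simp
  have ell: "ell c s x = cost_rate c \<alpha> x" if "x \<in> {0..s}" for x
    unfolding \<alpha>_def by (rule ell_eq_cost_rate[OF assms(1) a(1-3) that])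
  note deriv = profile_derivative[OF c profile_domain[OF c]]
  have int: "(ell c s has_integral deviation_rate c \<alpha>) {0..s}"
    using cost_rate_has_integral[OF c] ell unfolding deviation_rate_def s
    by (subst has_integral_cong[where g = "cost_rate c \<alpha>"]) auto
  have intc: "integral {0..s} (cost_rate c \<alpha>) = integral {0..s} (ell c s)"
    by (rule integral_cong) (simp add: ell)
  have shape: "strict_antimono_on {0..s} (y_hat c s)" "y_hat c s 0 = 1" "y_hat c s s = 0"
    using profile_strict_antimono[OF c] profile_end[OF c] c unfolding y s by simp_all
  have diff: "y_hat c s differentiable (at x)" if "x \<in> {0..s}" for x
    using deriv[unfolded s, OF that] unfolding y real_differentiable_def by blast
  have opt: "trajectory_cost c s (y_hat c s) \<le> trajectory_cost c s z"
    "trajectory_cost c s z = trajectory_cost c s (y_hat c s) \<Longrightarrow> \<forall>x\<in>{0..s}. z x = y_hat c s x"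
    if "decreasing_trajectory s z" for z
    using profile_optimal[OF c, unfolded s, OF that] unfolding y by blast+
  have upper: "eventually (\<lambda>n. deviation_prob c n (t n) \<le> exp (real n * (integral {0..s} (ell c s) + e))) sequentially"
    if "t \<longlonglongrightarrow> s" "e > 0" for t e
    unfolding integral_unique[OF int]
    by (rule deviation_prob_upper_bound[OF c s1 crit]) (use that s in auto)
  have lower: "eventually (\<lambda>n. measure_pmf.prob (greedy_law n (c / real n))
        (deviation c n (t n) \<inter> tube n s (y_hat c s) \<epsilon>) \<ge> exp (real n * (integral {0..s} (ell c s) - e))) sequentially"
    if "t \<longlonglongrightarrow> s" "e > 0" "\<epsilon> > 0" for t e \<epsilon>
    unfolding integral_unique[OF int] y
    using deviation_tube_lower_bound[OF c s1 crit, of t \<epsilon> e] that s by simp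
  have le: "measure_pmf.prob (greedy_law n (c / real n)) (deviation c n (t n) \<inter> tube n s (y_hat c s) \<epsilon>)
      \<le> deviation_prob c n (t n)" for n t \<epsilon>
    unfolding deviation_prob_def by (intro measure_pmf.finite_measure_mono) auto
  have lim_tube: "(\<lambda>n. 1 / real n * ln (measure_pmf.prob (greedy_law n (c / real n))
        (deviation c n (t n) \<inter> tube n s (y_hat c s) \<epsilon>))) \<longlonglongrightarrow> integral {0..s} (ell c s)"
    if "t \<longlonglongrightarrow> s" "\<epsilon> > 0" for t \<epsilon>
  proof (rule log_prob_tendsto)
    fix e :: real assume e: "e > 0"
    from upper[OF that(1) e] show "eventually (\<lambda>n. measure_pmf.prob (greedy_law n (c / real n))
        (deviation c n (t n) \<inter> tube n s (y_hat c s) \<epsilon>) \<le> exp (real n * (integral {0..s} (ell c s) + e))) sequentially"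
      by eventually_elim (rule order_trans[OF le])
  qed (rule lower[OF that(1) _ that(2)])
  have lim: "(\<lambda>n. 1 / real n * ln (deviation_prob c n (t n))) \<longlonglongrightarrow> integral {0..s} (ell c s)"
    if "t \<longlonglongrightarrow> s" for t
  proof (rule log_prob_tendsto[OF upper[OF that]])
    fix e :: real assume e: "e > 0"
    from lower[OF that e zero_less_one]
    show "eventually (\<lambda>n. deviation_prob c n (t n) \<ge> exp (real n * (integral {0..s} (ell c s) - e))) sequentially"
      by eventually_elim (rule order_trans[OF _ le])
  qed
  have ell2: "ell c s x = (let a = a_param c s in
         (ln ((1 + (a - 1) * exp (c * x)) / a) - c * (a - 1) / a) *
         (1 - ln (1 + (a - 1) * exp (c * x)) / ((a - 1) * exp (c * x))))" if "x \<in> {0..s}" for x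
    unfolding Let_def ell[OF that] \<alpha>_def by (rule cost_rate_alt[OF assms(1) a(1,2)])
  have cost: "ereal (ell c s x) = - local_cost c (y_hat c s x) (deriv (y_hat c s) x)" if "x \<in> {0..s}" for x
    using local_cost_profile[OF c, unfolded s, OF that] DERIV_imp_deriv[OF deriv[unfolded s, OF that]] ell[OF that]
    unfolding y by simp
  have total: "trajectory_cost c s (y_hat c s) = ennreal (- integral {0..s} (ell c s))"
    using trajectory_cost_profile[OF c, unfolded s] unfolding y intc .
  show ?thesis
    using shape diff opt lim_tube lim ell2 cost has_integral_integrable[OF int] total by blast
qed

end
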